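(* Let $\Omega\subset\mathbb{R}^d$ ($d\ge2$) be a bounded, simply connected Lipschitz domain. There is a constant $C>0$ such that for every mesh $\mathcal{T}$ of $\Omega$ and every $\boldsymbol{f}\in\boldsymbol{L}_2(\Omega)$ the following holds, with $\mathfrak{U}$, $\mathfrak{V}(\mathcal{T})$, $b$, $L$ as defined in the context. There exists a unique $\mathfrak{u}=(\boldsymbol{u},\boldsymbol{w},\widehat{\boldsymbol{u}},\widehat{\boldsymbol{w}})\in\mathfrak{U}$ such that $$b(\mathfrak{u},\mathfrak{v})=L(\mathfrak{v})\qquad\forall\,\mathfrak{v}\in\mathfrak{V}(\mathcal{T}),$$ and it satisfies $$\|\mathfrak{u}\|_{\mathfrak{U}}\le C\,\|\boldsymbol{f}\|,$$ where $C$ is independent of $\boldsymbol{f}$ and $\mathcal{T}$. Furthermore, $\boldsymbol{u}$ solves $$(\nabla\operatorname{div})^2\boldsymbol{u}+\boldsymbol{u}=\boldsymbol{f}\ \text{ in }\Omega,\qquad \operatorname{div}\boldsymbol{u}=\boldsymbol{u}\cdot\boldsymbol{n}=0\ \text{ on }\Gamma.$$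
   Context: $\Omega\subset\mathbb{R}^d$, $d\ge2$, is a bounded, simply connected Lipschitz domain with boundary $\Gamma$; $\boldsymbol{n}$ denotes the exterior unit normal vector. A mesh $\mathcal{T}=\{T\}$ is a finite collection of pairwise disjoint (open) Lipschitz domains $T\subset\Omega$ with $\bar\Omega=\bigcup_T\bar T$; its skeleton is $\mathcal{S}=\{\partial T:T\in\mathcal{T}\}$. $\boldsymbol{L}_2=(L_2)^d$; $\|\cdot\|$ is the $L_2(\Omega)$-norm, $(\cdot,\cdot)$ the $L_2(\Omega)$ inner product, $(\cdot,\cdot)_{\mathcal{T}}=\sum_T(\cdot,\cdot)_T$ with differential operators taken piecewise. For a Lipschitz domain $\omega\subset\Omega$: $\boldsymbol{H}(\nabla\mathrm{div},\omega)=\{\boldsymbol{v}\in\boldsymbol{L}_2(\omega):\nabla\operatorname{div}\boldsymbol{v}\in\boldsymbol{L}_2(\omega)\}$ with $\|\boldsymbol{v}\|_{\nabla\mathrm{div},\omega}^2=\|\boldsymbol{v}\|_\omega^2+\|\nabla\operatorname{div}\boldsymbol{v}\|_\omega^2$ (index dropped for $\omega=\Omega$); its elements satisfy $\operatorname{div}\boldsymbol{v}\in H^1(\omega)$, so the traces $\boldsymbol{v}\cdot\boldsymbol{n}$ and $\operatorname{div}\boldsymbol{v}$ on $\partial\omega$ are well defined; $\boldsymbol{H}_0(\nabla\mathrm{div},\omega)$ is the subspace where both vanish on $\partial\omega$. $\boldsymbol{H}(\nabla\mathrm{div},\mathcal{T})=\prod_T\boldsymbol{H}(\nabla\mathrm{div},T)$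 with product norm $\|\cdot\|_{\nabla\mathrm{div},\mathcal{T}}$. The trace operator $\mathrm{tr}^{\nabla\mathrm{div}}:\boldsymbol{H}(\nabla\mathrm{div},\mathcal{T})\to\boldsymbol{H}(\nabla\mathrm{div},\mathcal{T})'$ is defined by $\langle\mathrm{tr}^{\nabla\mathrm{div}}(\boldsymbol{v}),\boldsymbol{\tau}\rangle^{\nabla\mathrm{div}}_{\mathcal{S}}:=(\boldsymbol{v},\nabla\operatorname{div}\boldsymbol{\tau})_{\mathcal{T}}-(\nabla\operatorname{div}\boldsymbol{v},\boldsymbol{\tau})_{\mathcal{T}}$. Set $\boldsymbol{H}^{\nabla\mathrm{div}}(\mathcal{S})=\mathrm{tr}^{\nabla\mathrm{div}}(\boldsymbol{H}(\nabla\mathrm{div},\Omega))$, $\boldsymbol{H}^{\nabla\mathrm{div}}_0(\mathcal{S})=\mathrm{tr}^{\nabla\mathrm{div}}(\boldsymbol{H}_0(\nabla\mathrm{div},\Omega))$ with norm $\|\hat{\boldsymbol{v}}\|_{-1/2,1/2,\mathcal{S}}=\inf\{\|\boldsymbol{v}\|_{\nabla\mathrm{div}}:\boldsymbol{v}\in\boldsymbol{H}(\nabla\mathrm{div},\Omega),\ \mathrm{tr}^{\nabla\mathrm{div}}(\boldsymbol{v})=\hat{\boldsymbol{v}}\}$; $\langle\hat{\boldsymbol{v}},\boldsymbol{\tau}\rangle^{\nabla\mathrm{div}}_{\mathcal{S}}$ is the evaluation of the functional $\hat{\boldsymbol{v}}$ at $\boldsymbol{\tau}\in\boldsymbol{H}(\nabla\mathrm{div},\mathcal{T})$.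 Formulation: $\mathfrak{U}=\boldsymbol{L}_2(\Omega)\times\boldsymbol{L}_2(\Omega)\times\boldsymbol{H}^{\nabla\mathrm{div}}_0(\mathcal{S})\times\boldsymbol{H}^{\nabla\mathrm{div}}(\mathcal{S})$ with $\|(\boldsymbol{u},\boldsymbol{w},\widehat{\boldsymbol{u}},\widehat{\boldsymbol{w}})\|_{\mathfrak{U}}^2=\|\boldsymbol{u}\|^2+\|\boldsymbol{w}\|^2+\|\widehat{\boldsymbol{u}}\|_{-1/2,1/2,\mathcal{S}}^2+\|\widehat{\boldsymbol{w}}\|_{-1/2,1/2,\mathcal{S}}^2$; $\mathfrak{V}(\mathcal{T})=\boldsymbol{H}(\nabla\mathrm{div},\mathcal{T})\times\boldsymbol{H}(\nabla\mathrm{div},\mathcal{T})$ with the product norm. For $\mathfrak{v}=(\boldsymbol{v},\boldsymbol{\tau})$, $$b(\mathfrak{u},\mathfrak{v})=(\boldsymbol{u},\boldsymbol{v}-\nabla\operatorname{div}\boldsymbol{\tau})_{\mathcal{T}}-(\boldsymbol{w},\boldsymbol{\tau}+\nabla\operatorname{div}\boldsymbol{v})_{\mathcal{T}}+\langle\widehat{\boldsymbol{u}},\boldsymbol{\tau}\rangle^{\nabla\mathrm{div}}_{\mathcal{S}}+\langle\widehat{\boldsymbol{w}},\boldsymbol{v}\rangle^{\nabla\mathrm{div}}_{\mathcal{S}},\qquad L(\mathfrak{v})=(\boldsymbol{f},\boldsymbol{v}).$$ The boundary value problem is understood as: $\boldsymbol{u}\in\boldsymbol{H}(\nabla\mathrm{div},\Omega)$,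 the boundary conditions hold in the sense of traces, and the equation holds in the sense of distributions. *)

theory Defs
  imports "HOL-Analysis.Analysis"
begin

section \<open>Lipschitz domains and meshes\<close>

text \<open>
  Near each boundary point the domain is the strict subgraph of a Lipschitz function \<open>g\<close> in some
  unit direction \<open>e\<close>; \<open>g\<close> is a function on the hyperplane orthogonal to \<open>e\<close>.
\<close>

definition lipschitz_domain :: "'a::euclidean_space set \<Rightarrow> bool" where
  "lipschitz_domain \<omega> \<longleftrightarrow>
     open \<omega> \<and> connected \<omega> \<and> \<omega> \<noteq> {} \<and>
     (\<forall>p \<in> frontier \<omega>. \<exists>U e g L.
        open U \<and> p \<in> U \<and> norm e = 1 \<and> L-lipschitz_on {y. y \<bullet> e = 0} g \<and>
        \<omega> \<inter> U = {x \<in> U. x \<bullet> e < g (x - (x \<bullet> e) *\<^sub>R e)})"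

definition mesh :: "'a::euclidean_space set \<Rightarrow> 'a set set \<Rightarrow> bool" where
  "mesh \<Omega> \<T> \<longleftrightarrow>
     finite \<T> \<and> disjoint \<T> \<and> (\<forall>T\<in>\<T>. lipschitz_domain T \<and> T \<subseteq> \<Omega>) \<and>
     closure \<Omega> = (\<Union>T\<in>\<T>. closure T)"


section \<open>Smooth functions, classical operators, test functions\<close>

primrec C_diff :: "nat \<Rightarrow> ('a::euclidean_space \<Rightarrow> 'b::euclidean_space) \<Rightarrow> bool" where
  "C_diff 0 f \<longleftrightarrow> continuous_on UNIV f"
| "C_diff (Suc k) f \<longleftrightarrow>
     (\<exists>f'. (\<forall>x. (f has_derivative f' x) (at x)) \<and> (\<forall>h. C_diff k (\<lambda>x. f' x h)))"

definition grad :: "('a::euclidean_space \<Rightarrow> real) \<Rightarrow> 'a \<Rightarrow> 'a" where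
  "grad \<phi> x = (\<Sum>b\<in>Basis. frechet_derivative \<phi> (at x) b *\<^sub>R b)"

definition divg :: "('a::euclidean_space \<Rightarrow> 'a) \<Rightarrow> 'a \<Rightarrow> real" where
  "divg \<phi> x = (\<Sum>b\<in>Basis. frechet_derivative \<phi> (at x) b \<bullet> b)"

definition test_functions :: "'a::euclidean_space set \<Rightarrow> ('a \<Rightarrow> 'b::euclidean_space) set" where
  "test_functions \<omega> =
     {\<phi>. (\<forall>k. C_diff k \<phi>) \<and> compact (closure {x. \<phi> x \<noteq> 0}) \<and> closure {x. \<phi> x \<noteq> 0} \<subseteq> \<omega>}"


section \<open>Square-integrable functions\<close>

text \<open>
  Elements of \<open>L\<^sub>2(\<omega>)\<close> are represented by functions on the whole space whose values outside \<open>\<omega>\<close> are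
  irrelevant; two functions represent the same element iff they agree almost everywhere on \<open>\<omega>\<close>.
\<close>

definition L2_space :: "'a::euclidean_space set \<Rightarrow> ('a \<Rightarrow> 'b::euclidean_space) set" where
  "L2_space \<omega> = {f \<in> borel_measurable (lebesgue_on \<omega>).
     integrable (lebesgue_on \<omega>) (\<lambda>x. (norm (f x))\<^sup>2)}"

definition L2_inner ::
  "'a::euclidean_space set \<Rightarrow> ('a \<Rightarrow> 'b::euclidean_space) \<Rightarrow> ('a \<Rightarrow> 'b) \<Rightarrow> real" where
  "L2_inner \<omega> f g = (\<integral>x. f x \<bullet> g x \<partial>lebesgue_on \<omega>)"

definition L2_norm :: "'a::euclidean_space set \<Rightarrow> ('a \<Rightarrow> 'b::euclidean_space) \<Rightarrow> real" where
  "L2_norm \<omega> f = sqrt (\<integral>x. (norm (f x))\<^sup>2 \<partial>lebesgue_on \<omega>)"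


section \<open>Distributional derivatives in \<open>L\<^sub>2\<close>\<close>

text \<open>
  The predicates say that the distribution \<open>\<nabla>p\<close>, \<open>div v\<close> or \<open>\<nabla>div v\<close> on \<open>\<omega>\<close> is represented by
  the given square-integrable function. As \<open>-div\<close> and \<open>\<nabla>\<close> are formally adjoint,
  \<open>\<nabla>div\<close> is formally self-adjoint; in particular \<open>div v\<close> is not assumed to be a function in
  the last predicate. The operators \<open>wgrad\<close>, \<open>wdiv\<close>, \<open>wgraddiv\<close> choose a representative, which is
  unique almost everywhere on \<open>\<omega>\<close> if it exists.
\<close>

definition weak_grad :: "'a::euclidean_space set \<Rightarrow> ('a \<Rightarrow> real) \<Rightarrow> ('a \<Rightarrow> 'a) \<Rightarrow> bool" where
  "weak_grad \<omega> p g \<longleftrightarrow> g \<in> L2_space \<omega> \<and>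
     (\<forall>\<phi>\<in>test_functions \<omega>. L2_inner \<omega> p (divg \<phi>) = - L2_inner \<omega> g \<phi>)"

definition weak_div :: "'a::euclidean_space set \<Rightarrow> ('a \<Rightarrow> 'a) \<Rightarrow> ('a \<Rightarrow> real) \<Rightarrow> bool" where
  "weak_div \<omega> v q \<longleftrightarrow> q \<in> L2_space \<omega> \<and>
     (\<forall>\<phi>\<in>test_functions \<omega>. L2_inner \<omega> v (grad \<phi>) = - L2_inner \<omega> q \<phi>)"

definition weak_graddiv :: "'a::euclidean_space set \<Rightarrow> ('a \<Rightarrow> 'a) \<Rightarrow> ('a \<Rightarrow> 'a) \<Rightarrow> bool" where
  "weak_graddiv \<omega> v g \<longleftrightarrow> g \<in> L2_space \<omega> \<and>
     (\<forall>\<phi>\<in>test_functions \<omega>. L2_inner \<omega> v (grad (divg \<phi>)) = L2_inner \<omega> g \<phi>)"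

definition wgrad :: "'a::euclidean_space set \<Rightarrow> ('a \<Rightarrow> real) \<Rightarrow> 'a \<Rightarrow> 'a" where
  "wgrad \<omega> p = (SOME g. weak_grad \<omega> p g)"

definition wdiv :: "'a::euclidean_space set \<Rightarrow> ('a \<Rightarrow> 'a) \<Rightarrow> 'a \<Rightarrow> real" where
  "wdiv \<omega> v = (SOME q. weak_div \<omega> v q)"

definition wgraddiv :: "'a::euclidean_space set \<Rightarrow> ('a \<Rightarrow> 'a) \<Rightarrow> 'a \<Rightarrow> 'a" where
  "wgraddiv \<omega> v = (SOME g. weak_graddiv \<omega> v g)"

definition H1 :: "'a::euclidean_space set \<Rightarrow> ('a \<Rightarrow> real) set" where
  "H1 \<omega> = {p \<in> L2_space \<omega>. \<exists>g. weak_grad \<omega> p g}"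

definition Hdiv :: "'a::euclidean_space set \<Rightarrow> ('a \<Rightarrow> 'a) set" where
  "Hdiv \<omega> = {v \<in> L2_space \<omega>. \<exists>q. weak_div \<omega> v q}"

definition Hgraddiv :: "'a::euclidean_space set \<Rightarrow> ('a \<Rightarrow> 'a) set" where
  "Hgraddiv \<omega> = {v \<in> L2_space \<omega>. \<exists>g. weak_graddiv \<omega> v g}"

definition graddiv_norm :: "'a::euclidean_space set \<Rightarrow> ('a \<Rightarrow> 'a) \<Rightarrow> real" where
  "graddiv_norm \<omega> v = sqrt ((L2_norm \<omega> v)\<^sup>2 + (L2_norm \<omega> (wgraddiv \<omega> v))\<^sup>2)"


section \<open>Traces on the boundary\<close>

text \<open>
  The normal trace \<open>v \<cdot> n\<close> of \<open>v \<in> H(div, \<omega>)\<close> is the element of \<open>H\<^sup>-\<^sup>1\<^sup>/\<^sup>2(\<partial>\<omega>)\<close> given by Green's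
  formula \<open>\<langle>v \<cdot> n, \<phi>\<rangle> = (v, \<nabla>\<phi>) + (div v, \<phi>)\<close> for \<open>\<phi> \<in> H\<^sup>1(\<omega>)\<close>. The trace of \<open>p \<in> H\<^sup>1(\<omega>)\<close> is the
  element of \<open>H\<^sup>1\<^sup>/\<^sup>2(\<partial>\<omega>)\<close>, identified with a functional on \<open>H\<^sup>-\<^sup>1\<^sup>/\<^sup>2(\<partial>\<omega>)\<close>, i.e. on normal traces
  \<open>\<tau> \<cdot> n\<close> of \<open>\<tau> \<in> H(div, \<omega>)\<close>, by the same formula.
\<close>

definition normal_trace :: "'a::euclidean_space set \<Rightarrow> ('a \<Rightarrow> 'a) \<Rightarrow> ('a \<Rightarrow> real) \<Rightarrow> real" where
  "normal_trace \<omega> v = (\<lambda>\<phi>\<in>H1 \<omega>. L2_inner \<omega> v (wgrad \<omega> \<phi>) + L2_inner \<omega> (wdiv \<omega> v) \<phi>)"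

definition scalar_trace :: "'a::euclidean_space set \<Rightarrow> ('a \<Rightarrow> real) \<Rightarrow> ('a \<Rightarrow> 'a) \<Rightarrow> real" where
  "scalar_trace \<omega> p = (\<lambda>\<tau>\<in>Hdiv \<omega>. L2_inner \<omega> (wgrad \<omega> p) \<tau> + L2_inner \<omega> p (wdiv \<omega> \<tau>))"

text \<open>
  The first two conjuncts express that both traces are defined; on bounded Lipschitz domains they
  hold for every \<open>v \<in> H(\<nabla>div, \<omega>)\<close>.
\<close>

definition vanishing_traces :: "'a::euclidean_space set \<Rightarrow> ('a \<Rightarrow> 'a) \<Rightarrow> bool" where
  "vanishing_traces \<omega> v \<longleftrightarrow>
     v \<in> Hdiv \<omega> \<and> wdiv \<omega> v \<in> H1 \<omega> \<and>
     normal_trace \<omega> v = (\<lambda>\<phi>\<in>H1 \<omega>. 0) \<and>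
     scalar_trace \<omega> (wdiv \<omega> v) = (\<lambda>\<tau>\<in>Hdiv \<omega>. 0)"

definition H0graddiv :: "'a::euclidean_space set \<Rightarrow> ('a \<Rightarrow> 'a) set" where
  "H0graddiv \<omega> = {v \<in> Hgraddiv \<omega>. vanishing_traces \<omega> v}"


section \<open>Broken spaces, skeleton traces and the ultraweak formulation\<close>

text \<open>
  As mesh elements are disjoint, a tuple in the product of the \<open>H(\<nabla>div, T)\<close> is represented by a
  single function, considered separately on each \<open>T\<close>.
\<close>

definition broken_Hgraddiv :: "'a::euclidean_space set set \<Rightarrow> ('a \<Rightarrow> 'a) set" where
  "broken_Hgraddiv \<T> = {v. \<forall>T\<in>\<T>. v \<in> Hgraddiv T}"

text \<open>
  Functionals on the broken space are extensional functions, so that equality of functionals is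
  equality in HOL.
\<close>

definition tr_graddiv ::
  "'a::euclidean_space set set \<Rightarrow> ('a \<Rightarrow> 'a) \<Rightarrow> ('a \<Rightarrow> 'a) \<Rightarrow> real" where
  "tr_graddiv \<T> v = (\<lambda>\<tau>\<in>broken_Hgraddiv \<T>.
     (\<Sum>T\<in>\<T>. L2_inner T v (wgraddiv T \<tau>)) - (\<Sum>T\<in>\<T>. L2_inner T (wgraddiv T v) \<tau>))"

definition skel_space :: "'a::euclidean_space set \<Rightarrow> 'a set set \<Rightarrow> (('a \<Rightarrow> 'a) \<Rightarrow> real) set" where
  "skel_space \<Omega> \<T> = tr_graddiv \<T> ` Hgraddiv \<Omega>"

definition skel_space0 :: "'a::euclidean_space set \<Rightarrow> 'a set set \<Rightarrow> (('a \<Rightarrow> 'a) \<Rightarrow> real) set" where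
  "skel_space0 \<Omega> \<T> = tr_graddiv \<T> ` H0graddiv \<Omega>"

definition skel_norm ::
  "'a::euclidean_space set \<Rightarrow> 'a set set \<Rightarrow> (('a \<Rightarrow> 'a) \<Rightarrow> real) \<Rightarrow> real" where
  "skel_norm \<Omega> \<T> vh = Inf {graddiv_norm \<Omega> v | v. v \<in> Hgraddiv \<Omega> \<and> tr_graddiv \<T> v = vh}"

type_synonym 'a trial = "('a \<Rightarrow> 'a) \<times> ('a \<Rightarrow> 'a) \<times> (('a \<Rightarrow> 'a) \<Rightarrow> real) \<times> (('a \<Rightarrow> 'a) \<Rightarrow> real)"

definition trial_space :: "'a::euclidean_space set \<Rightarrow> 'a set set \<Rightarrow> 'a trial set" where
  "trial_space \<Omega> \<T> = L2_space \<Omega> \<times> L2_space \<Omega> \<times> skel_space0 \<Omega> \<T> \<times> skel_space \<Omega> \<T>"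

definition trial_norm :: "'a::euclidean_space set \<Rightarrow> 'a set set \<Rightarrow> 'a trial \<Rightarrow> real" where
  "trial_norm \<Omega> \<T> = (\<lambda>(u, w, uh, wh).
     sqrt ((L2_norm \<Omega> u)\<^sup>2 + (L2_norm \<Omega> w)\<^sup>2 + (skel_norm \<Omega> \<T> uh)\<^sup>2 + (skel_norm \<Omega> \<T> wh)\<^sup>2))"

definition test_space :: "'a::euclidean_space set set \<Rightarrow> (('a \<Rightarrow> 'a) \<times> ('a \<Rightarrow> 'a)) set" where
  "test_space \<T> = broken_Hgraddiv \<T> \<times> broken_Hgraddiv \<T>"

definition bform ::
  "'a::euclidean_space set set \<Rightarrow> 'a trial \<Rightarrow> ('a \<Rightarrow> 'a) \<times> ('a \<Rightarrow> 'a) \<Rightarrow> real" where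
  "bform \<T> = (\<lambda>(u, w, uh, wh) (v, \<tau>).
     (\<Sum>T\<in>\<T>. L2_inner T u (\<lambda>x. v x - wgraddiv T \<tau> x))
     - (\<Sum>T\<in>\<T>. L2_inner T w (\<lambda>x. \<tau> x + wgraddiv T v x))
     + uh \<tau> + wh v)"

definition load :: "'a::euclidean_space set \<Rightarrow> ('a \<Rightarrow> 'a) \<Rightarrow> ('a \<Rightarrow> 'a) \<times> ('a \<Rightarrow> 'a) \<Rightarrow> real" where
  "load \<Omega> f = (\<lambda>(v, \<tau>). L2_inner \<Omega> f v)"

definition trial_eq :: "'a::euclidean_space set \<Rightarrow> 'a trial \<Rightarrow> 'a trial \<Rightarrow> bool" where
  "trial_eq \<Omega> = (\<lambda>(u, w, uh, wh) (u', w', uh', wh').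
     (AE x in lebesgue_on \<Omega>. u x = u' x) \<and> (AE x in lebesgue_on \<Omega>. w x = w' x) \<and>
     uh = uh' \<and> wh = wh')"


section \<open>The boundary value problem\<close>

definition solves_bvp :: "'a::euclidean_space set \<Rightarrow> ('a \<Rightarrow> 'a) \<Rightarrow> ('a \<Rightarrow> 'a) \<Rightarrow> bool" where
  "solves_bvp \<Omega> f u \<longleftrightarrow>
     u \<in> Hgraddiv \<Omega> \<and>
     (\<forall>\<phi>\<in>test_functions \<Omega>.
        L2_inner \<Omega> u (grad (divg (grad (divg \<phi>)))) + L2_inner \<Omega> u \<phi> = L2_inner \<Omega> f \<phi>) \<and>
     vanishing_traces \<Omega> u"

end

theory Submission
  imports Defs
begin

text \<open>
  Testing with smooth functions compactly supported in \<open>\<Omega>\<close> shows that every solution satisfies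
  \<open>\<nabla>div u = - w\<close> and \<open>\<nabla>div w = u - f\<close> on \<open>\<Omega>\<close>; testing with broken functions then gives
  \<open>uh = tr u\<close> and \<open>wh = tr w\<close>. Hence existence amounts to solving
  \<open>(u, v) + (\<nabla>div u, \<nabla>div v) = (f, v)\<close> in \<open>H\<^sub>0(\<nabla>div, \<Omega>)\<close>, by the Riesz representation theorem, and
  uniqueness amounts to Green's formula \<open>(a, \<nabla>div w) = (\<nabla>div a, w)\<close> for \<open>a \<in> H\<^sub>0(\<nabla>div, \<Omega>)\<close> and
  \<open>w \<in> H(\<nabla>div, \<Omega>)\<close>. Green's formula is immediate from the definition of vanishing traces once
  \<open>div w \<in> L\<^sub>2(\<Omega>)\<close> is known, and this is the only place where the geometry of \<open>\<Omega>\<close> matters.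

  To bound the distribution \<open>\<phi> \<mapsto> - (w, \<nabla>\<phi>)\<close> in the \<open>L\<^sub>2\<close>-norm near a point of the closure of
  \<open>\<Omega>\<close>, let \<open>A\<phi>\<close> be the average of \<open>\<phi>\<close> over translations along \<open>d + 1\<close> short segments that point into
  \<open>\<Omega>\<close>. Then \<open>\<phi> - A\<phi> = div \<psi>\<close> with \<open>\<parallel>\<psi>\<parallel> \<le> C \<parallel>\<phi>\<parallel>\<close>, so this part only sees \<open>\<nabla>div w\<close>, while
  \<open>\<parallel>\<nabla>A\<phi>\<parallel> \<le> C \<parallel>\<phi>\<parallel>\<close> because a derivative of an average along a segment is a difference quotient.
\<close>

section \<open>The space of square-integrable functions\<close>

text \<open>Uniformity in the mesh comes from the fact that \<open>u\<close> and \<open>w\<close>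
  are determined on \<Omega> alone. The mesh enters only through the skeleton norms, which are
  infima over extensions and hence bounded by the graph norms of \<open>u\<close> and
  \<open>w\<close>. In the uniqueness argument the component \<open>u\<close> of a solution is not
  known to have vanishing traces: only its skeleton trace agrees with that of some \<open>a\<close>
  in \<open>H\<^sub>0(\<nabla>div, \<Omega>)\<close>. Equal skeleton traces give equal values when
  paired with functions of \<open>H(\<nabla>div, \<Omega>)\<close>, so Green's formula is applied to
  \<open>a\<close> in place of \<open>u\<close>. The obstacle in bounding div w is the boundary.
  Translated supports must stay inside \<Omega>, so the directions have to point inwards; one vector
  and d small perturbations of it do, and their differences still span the space. Since the local
  bounds contain only \<parallel>\<phi>\<parallel> and no derivative of \<phi>, multiplication by
  cut-off functions does not spoil them, and finitely many can be added.\<close>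

lemma L2_spaceD:
  assumes "f \<in> L2_space \<omega>"
  shows "f \<in> borel_measurable (lebesgue_on \<omega>)"
    and "integrable (lebesgue_on \<omega>) (\<lambda>x. (norm (f x))\<^sup>2)"
  using assms by (auto simp: L2_space_def)

lemma integrable_L2_inner:
  fixes f g :: "'a::euclidean_space \<Rightarrow> 'b::euclidean_space"
  assumes "f \<in> L2_space \<omega>" "g \<in> L2_space \<omega>"
  shows "integrable (lebesgue_on \<omega>) (\<lambda>x. f x \<bullet> g x)"
proof (rule Bochner_Integration.integrable_bound)
  show "integrable (lebesgue_on \<omega>) (\<lambda>x. (norm (f x))\<^sup>2 + (norm (g x))\<^sup>2)"
    using L2_spaceD[OF assms(1)] L2_spaceD[OF assms(2)] by auto
  show "(\<lambda>x. f x \<bullet> g x) \<in> borel_measurable (lebesgue_on \<omega>)"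
    using L2_spaceD[OF assms(1)] L2_spaceD[OF assms(2)] by (intro borel_measurable_inner)
  show "AE x in lebesgue_on \<omega>. norm (f x \<bullet> g x) \<le> norm ((norm (f x))\<^sup>2 + (norm (g x))\<^sup>2)"
  proof (intro AE_I2)
    fix x
    have "\<bar>f x \<bullet> g x\<bar> \<le> norm (f x) * norm (g x)" by (rule Cauchy_Schwarz_ineq2)
    moreover have "0 \<le> (norm (f x) - norm (g x))\<^sup>2" by simp
    then have "2 * (norm (f x) * norm (g x)) \<le> (norm (f x))\<^sup>2 + (norm (g x))\<^sup>2"
      by (simp add: power2_diff)
    moreover have "0 \<le> norm (f x) * norm (g x)" by simp
    ultimately show "norm (f x \<bullet> g x) \<le> norm ((norm (f x))\<^sup>2 + (norm (g x))\<^sup>2)"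
      by simp
  qed
qed

lemma zero_in_L2: "(\<lambda>x. 0) \<in> L2_space \<omega>"
  by (simp add: L2_space_def)

lemma scaleR_in_L2:
  fixes f :: "'a::euclidean_space \<Rightarrow> 'b::euclidean_space"
  assumes "f \<in> L2_space \<omega>"
  shows "(\<lambda>x. c *\<^sub>R f x) \<in> L2_space \<omega>"
  using L2_spaceD[OF assms] by (auto simp: L2_space_def power_mult_distrib)

lemma add_in_L2:
  fixes f g :: "'a::euclidean_space \<Rightarrow> 'b::euclidean_space"
  assumes "f \<in> L2_space \<omega>" "g \<in> L2_space \<omega>"
  shows "(\<lambda>x. f x + g x) \<in> L2_space \<omega>"
proof -
  have "integrable (lebesgue_on \<omega>) (\<lambda>x. f x \<bullet> f x + 2 * (f x \<bullet> g x) + g x \<bullet> g x)"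
    using assms by (intro Bochner_Integration.integrable_add integrable_mult_right integrable_L2_inner)
  moreover have "f x \<bullet> f x + 2 * (f x \<bullet> g x) + g x \<bullet> g x = (norm (f x + g x))\<^sup>2" for x
    by (simp add: power2_norm_eq_inner inner_add_left inner_add_right inner_commute)
  ultimately show ?thesis
    using L2_spaceD[OF assms(1)] L2_spaceD[OF assms(2)] by (simp add: L2_space_def)
qed

lemma uminus_in_L2:
  fixes f :: "'a::euclidean_space \<Rightarrow> 'b::euclidean_space"
  assumes "f \<in> L2_space \<omega>"
  shows "(\<lambda>x. - f x) \<in> L2_space \<omega>"
  using scaleR_in_L2[OF assms, of "-1"] by simp

lemma diff_in_L2:
  fixes f g :: "'a::euclidean_space \<Rightarrow> 'b::euclidean_space"
  assumes "f \<in> L2_space \<omega>" "g \<in> L2_space \<omega>"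
  shows "(\<lambda>x. f x - g x) \<in> L2_space \<omega>"
  using add_in_L2[OF assms(1) uminus_in_L2[OF assms(2)]] by simp

lemmas L2_intros = zero_in_L2 scaleR_in_L2 add_in_L2 uminus_in_L2 diff_in_L2

lemma L2_space_subset:
  fixes f :: "'a::euclidean_space \<Rightarrow> 'b::euclidean_space"
  assumes f: "f \<in> L2_space \<omega>" and "T \<subseteq> \<omega>" "T \<in> sets lebesgue" "\<omega> \<in> sets lebesgue"
  shows "f \<in> L2_space T"
proof -
  have "f \<in> borel_measurable (lebesgue_on T)"
    using measurable_restrict_mono[OF L2_spaceD(1)[OF f] \<open>T \<subseteq> \<omega>\<close>] .
  moreover have "integrable (lebesgue_on T) (\<lambda>x. (norm (f x))\<^sup>2)"
  proof -
    have "set_integrable lebesgue \<omega> (\<lambda>x. (norm (f x))\<^sup>2)"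
      using L2_spaceD(2)[OF f] assms by (simp add: set_integrable_def integrable_restrict_space)
    then have "set_integrable lebesgue T (\<lambda>x. (norm (f x))\<^sup>2)"
      by (rule set_integrable_subset) (use assms in auto)
    then show ?thesis
      using assms by (simp add: set_integrable_def integrable_restrict_space)
  qed
  ultimately show ?thesis by (simp add: L2_space_def)
qed

lemma Pair_in_L2:
  assumes "f \<in> L2_space \<omega>" "g \<in> L2_space \<omega>"
  shows "(\<lambda>x. (f x, g x)) \<in> L2_space \<omega>"
  using L2_spaceD[OF assms(1)] L2_spaceD[OF assms(2)] by (simp add: L2_space_def norm_Pair)

lemma fst_in_L2:
  fixes f :: "'a::euclidean_space \<Rightarrow> 'b::euclidean_space \<times> 'c::euclidean_space"
  assumes "f \<in> L2_space \<omega>"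
  shows "(\<lambda>x. fst (f x)) \<in> L2_space \<omega>"
proof -
  have le: "norm (fst p) \<le> norm p" for p :: "'b \<times> 'c" by (cases p) (simp add: norm_fst_le)
  have m: "(\<lambda>x. fst (f x)) \<in> borel_measurable (lebesgue_on \<omega>)"
    by (rule measurable_compose[OF L2_spaceD(1)[OF assms]])
      (intro borel_measurable_continuous_onI continuous_intros)
  moreover have "integrable (lebesgue_on \<omega>) (\<lambda>x. (norm (fst (f x)))\<^sup>2)"
    using m by (intro Bochner_Integration.integrable_bound[OF L2_spaceD(2)[OF assms]] AE_I2)
      (auto intro!: power_mono le)
  ultimately show ?thesis by (simp add: L2_space_def)
qed

lemma snd_in_L2:
  fixes f :: "'a::euclidean_space \<Rightarrow> 'b::euclidean_space \<times> 'c::euclidean_space"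
  assumes "f \<in> L2_space \<omega>"
  shows "(\<lambda>x. snd (f x)) \<in> L2_space \<omega>"
proof -
  have le: "norm (snd p) \<le> norm p" for p :: "'b \<times> 'c" by (cases p) (simp add: norm_snd_le)
  have m: "(\<lambda>x. snd (f x)) \<in> borel_measurable (lebesgue_on \<omega>)"
    by (rule measurable_compose[OF L2_spaceD(1)[OF assms]])
      (intro borel_measurable_continuous_onI continuous_intros)
  moreover have "integrable (lebesgue_on \<omega>) (\<lambda>x. (norm (snd (f x)))\<^sup>2)"
    using m by (intro Bochner_Integration.integrable_bound[OF L2_spaceD(2)[OF assms]] AE_I2)
      (auto intro!: power_mono le)
  ultimately show ?thesis by (simp add: L2_space_def)
qed

section \<open>Scalar product and norm of L2\<close>

lemma L2_inner_commute: "L2_inner \<omega> f g = L2_inner \<omega> g f"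
  by (simp add: L2_inner_def inner_commute)

lemma L2_inner_add_left:
  assumes "f \<in> L2_space \<omega>" "g \<in> L2_space \<omega>" "h \<in> L2_space \<omega>"
  shows "L2_inner \<omega> (\<lambda>x. f x + g x) h = L2_inner \<omega> f h + L2_inner \<omega> g h"
  using integrable_L2_inner[OF assms(1,3)] integrable_L2_inner[OF assms(2,3)]
  by (simp add: L2_inner_def inner_add_left)

lemma L2_inner_diff_left:
  assumes "f \<in> L2_space \<omega>" "g \<in> L2_space \<omega>" "h \<in> L2_space \<omega>"
  shows "L2_inner \<omega> (\<lambda>x. f x - g x) h = L2_inner \<omega> f h - L2_inner \<omega> g h"
  using integrable_L2_inner[OF assms(1,3)] integrable_L2_inner[OF assms(2,3)]
  by (simp add: L2_inner_def inner_diff_left)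

lemma L2_inner_scaleR_left: "L2_inner \<omega> (\<lambda>x. c *\<^sub>R f x) h = c * L2_inner \<omega> f h"
  by (simp add: L2_inner_def)

lemma L2_inner_uminus_left: "L2_inner \<omega> (\<lambda>x. - f x) h = - L2_inner \<omega> f h"
  by (simp add: L2_inner_def)

lemma L2_inner_zero_left: "L2_inner \<omega> (\<lambda>x. 0) h = 0"
  by (simp add: L2_inner_def)

lemma L2_inner_cong_AE:
  assumes "AE x in lebesgue_on \<omega>. f x = f' x" 
    "f \<in> borel_measurable (lebesgue_on \<omega>)" "f' \<in> borel_measurable (lebesgue_on \<omega>)"
    "g \<in> borel_measurable (lebesgue_on \<omega>)"
  shows "L2_inner \<omega> f g = L2_inner \<omega> f' g"
  unfolding L2_inner_def using assms by (intro integral_cong_AE borel_measurable_inner) auto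

lemma L2_norm_nonneg [simp]: "L2_norm \<omega> f \<ge> 0"
  by (simp add: L2_norm_def)

lemma L2_norm_sq: "(L2_norm \<omega> f)\<^sup>2 = L2_inner \<omega> f f"
  by (simp add: L2_norm_def L2_inner_def power2_norm_eq_inner)

lemma L2_inner_self_nonneg [simp]: "L2_inner \<omega> f f \<ge> 0"
  using L2_norm_sq[of \<omega> f] by (metis zero_le_power2)

lemma L2_norm_cong_AE:
  assumes "AE x in lebesgue_on \<omega>. f x = f' x" 
    "f \<in> borel_measurable (lebesgue_on \<omega>)" "f' \<in> borel_measurable (lebesgue_on \<omega>)"
  shows "L2_norm \<omega> f = L2_norm \<omega> f'"
  unfolding L2_norm_def using assms by (intro arg_cong[where f = sqrt] integral_cong_AE) auto

lemma L2_inner_self_eq_0: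
  fixes f :: "'a::euclidean_space \<Rightarrow> 'b::euclidean_space"
  assumes "f \<in> L2_space \<omega>" "L2_inner \<omega> f f = 0"
  shows "AE x in lebesgue_on \<omega>. f x = 0"
proof -
  have "AE x in lebesgue_on \<omega>. f x \<bullet> f x = 0"
    using integral_nonneg_eq_0_iff_AE[OF integrable_L2_inner[OF assms(1,1)]] assms(2)
    by (simp add: L2_inner_def)
  then show ?thesis by simp
qed

lemma L2_expand:
  fixes f g :: "'a::euclidean_space \<Rightarrow> 'b::euclidean_space"
  assumes "f \<in> L2_space \<omega>" "g \<in> L2_space \<omega>"
  shows "L2_inner \<omega> (\<lambda>x. f x + c *\<^sub>R g x) (\<lambda>x. f x + c *\<^sub>R g x)
    = L2_inner \<omega> f f + 2 * c * L2_inner \<omega> f g + c\<^sup>2 * L2_inner \<omega> g g"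
proof -
  define k where "k = (\<lambda>x. f x + c *\<^sub>R g x)"
  have k: "k \<in> L2_space \<omega>" unfolding k_def using assms by (intro L2_intros)
  have e: "L2_inner \<omega> k h = L2_inner \<omega> f h + c * L2_inner \<omega> g h" if "h \<in> L2_space \<omega>" for h
    unfolding k_def using assms that by (simp add: L2_inner_add_left L2_inner_scaleR_left scaleR_in_L2)
  have "L2_inner \<omega> k k = L2_inner \<omega> k f + c * L2_inner \<omega> k g"
    using e[OF k] by (simp only: L2_inner_commute[of \<omega> f k] L2_inner_commute[of \<omega> g k])
  then show ?thesis unfolding k_def[symmetric]
    using e[OF assms(1)] e[OF assms(2)] L2_inner_commute[of \<omega> g f]
    by (simp add: algebra_simps power2_eq_square)
qed

lemma L2_Cauchy_Schwarz:
  fixes f g :: "'a::euclidean_space \<Rightarrow> 'b::euclidean_space"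
  assumes f: "f \<in> L2_space \<omega>" and g: "g \<in> L2_space \<omega>"
  shows "\<bar>L2_inner \<omega> f g\<bar> \<le> L2_norm \<omega> f * L2_norm \<omega> g"
proof -
  define a b c where "a = L2_inner \<omega> f f" and "b = L2_inner \<omega> f g" and "c = L2_inner \<omega> g g"
  have q: "0 \<le> a + 2 * t * b + t\<^sup>2 * c" for t
    using L2_inner_self_nonneg[of \<omega> "\<lambda>x. f x + t *\<^sub>R g x"] L2_expand[OF f g, of t]
    by (simp add: a_def b_def c_def)
  have "b\<^sup>2 \<le> a * c"
  proof (cases "c = 0")
    case True
    have "b = 0"
    proof (rule ccontr)
      assume "b \<noteq> 0"
      \<comment> \<open>For \<open>c = 0\<close> the polynomial in \<open>t\<close> is affine, and
        this \<open>t\<close> gives it the value \<open>- 1\<close>.\<close>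
      with q[of "- (a + 1) / (2 * b)"] True show False by (simp add: field_simps)
    qed
    with True show ?thesis by simp
  next
    case False
    then have "c > 0" using L2_inner_self_nonneg[of \<omega> g] unfolding c_def by linarith
    \<comment> \<open>The minimiser of the quadratic polynomial.\<close>
    with q[of "- b / c"] show ?thesis by (simp add: field_simps power2_eq_square)
  qed
  then have "b\<^sup>2 \<le> (L2_norm \<omega> f * L2_norm \<omega> g)\<^sup>2"
    by (simp add: a_def c_def power_mult_distrib L2_norm_sq)
  then show ?thesis unfolding b_def by (metis L2_norm_nonneg abs_le_square_iff abs_of_nonneg mult_nonneg_nonneg)
qed

lemma L2_norm_scaleR: "L2_norm \<omega> (\<lambda>x. c *\<^sub>R f x) = \<bar>c\<bar> * L2_norm \<omega> f"
  by (simp add: L2_norm_def power_mult_distrib real_sqrt_mult)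

lemma L2_norm_triangle:
  fixes f g :: "'a::euclidean_space \<Rightarrow> 'b::euclidean_space"
  assumes f: "f \<in> L2_space \<omega>" and g: "g \<in> L2_space \<omega>"
  shows "L2_norm \<omega> (\<lambda>x. f x + g x) \<le> L2_norm \<omega> f + L2_norm \<omega> g"
proof (rule power2_le_imp_le)
  have "(L2_norm \<omega> (\<lambda>x. f x + g x))\<^sup>2 = L2_inner \<omega> f f + 2 * L2_inner \<omega> f g + L2_inner \<omega> g g"
    using L2_expand[OF f g, of 1] by (simp add: L2_norm_sq)
  also have "\<dots> \<le> (L2_norm \<omega> f + L2_norm \<omega> g)\<^sup>2"
    using L2_Cauchy_Schwarz[OF f g] by (simp add: power2_sum L2_norm_sq)
  finally show "(L2_norm \<omega> (\<lambda>x. f x + g x))\<^sup>2 \<le> (L2_norm \<omega> f + L2_norm \<omega> g)\<^sup>2" .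
qed simp

lemma L2_norm_triangle_diff:
  fixes f g :: "'a::euclidean_space \<Rightarrow> 'b::euclidean_space"
  assumes f: "f \<in> L2_space \<omega>" and g: "g \<in> L2_space \<omega>"
  shows "L2_norm \<omega> (\<lambda>x. f x - g x) \<le> L2_norm \<omega> f + L2_norm \<omega> g"
  using L2_norm_triangle[OF f uminus_in_L2[OF g]] L2_norm_scaleR[of \<omega> "-1" g] by simp

section \<open>Completeness and the Riesz representation theorem\<close>

lemma L2_integral_sq:
  assumes "f \<in> L2_space \<omega>"
  shows "(\<integral>\<^sup>+x. ennreal ((norm (f x))\<^sup>2) \<partial>lebesgue_on \<omega>) = ennreal ((L2_norm \<omega> f)\<^sup>2)"
  using nn_integral_eq_integral[OF L2_spaceD(2)[OF assms]] by (simp add: L2_norm_def)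

text \<open>Riesz-Fischer: a subsequence with increments below \<open>(1/2)^k\<close> converges
  almost everywhere, and Fatou's lemma turns the Cauchy bound into a bound for the distance to its
  limit.\<close>

lemma L2_complete:
  fixes d :: "nat \<Rightarrow> 'a::euclidean_space \<Rightarrow> 'b::euclidean_space"
  assumes d: "\<And>n. d n \<in> L2_space \<omega>"
    and Cauchy: "\<And>e. e > 0 \<Longrightarrow> \<exists>N. \<forall>m\<ge>N. \<forall>n\<ge>N. L2_norm \<omega> (\<lambda>x. d m x - d n x) < e"
  obtains f where "f \<in> L2_space \<omega>" "(\<lambda>n. L2_norm \<omega> (\<lambda>x. d n x - f x)) \<longlonglongrightarrow> 0"
proof -
  let ?M = "lebesgue_on \<omega>"
  have [measurable]: "d n \<in> borel_measurable ?M" for n using L2_spaceD(1)[OF d] .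
  have "\<exists>N. \<forall>m\<ge>N. \<forall>n\<ge>N. L2_norm \<omega> (\<lambda>x. d m x - d n x) < (1/2)^k" for k :: nat
    by (rule Cauchy) simp
  then obtain N where N: "\<And>k m n. m \<ge> N k \<Longrightarrow> n \<ge> N k \<Longrightarrow> L2_norm \<omega> (\<lambda>x. d m x - d n x) < (1/2)^k"
    by metis
  \<comment> \<open>A sum of thresholds dominates each of them: \<open>r k\<close> is at least
    \<open>N j\<close> for all \<open>j \<le> k\<close>, whether or not \<open>N\<close> is
    monotone.\<close>
  define r where "r k = (\<Sum>i\<le>k. N i)" for k
  have rN: "r k \<ge> N k" for k unfolding r_def by (rule member_le_sum) auto
  have rS: "r (Suc k) \<ge> N k" for k using rN[of k] by (simp add: r_def)
  define D where "D k x = d (r (Suc k)) x - d (r k) x" for k x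
  have DL: "D k \<in> L2_space \<omega>" for k unfolding D_def by (intro diff_in_L2 d)
  have [measurable]: "D k \<in> borel_measurable ?M" for k using L2_spaceD(1)[OF DL] .
  \<comment> \<open>Of the decay \<open>(1/2)^(2*k)\<close> of the squared increments, one half is
    spent on the weight \<open>2^k\<close> and the other makes the series of integrals converge.
    Where the weighted series is finite, the increments decay geometrically with ratio
    \<open>sqrt (1/2)\<close>.\<close>
  have Dn: "(\<integral>\<^sup>+x. ennreal (2^k * (norm (D k x))\<^sup>2) \<partial>?M) \<le> ennreal ((1/2)^k)" for k
  proof -
    have "(\<integral>\<^sup>+x. ennreal (2^k * (norm (D k x))\<^sup>2) \<partial>?M) = ennreal (2^k) * (\<integral>\<^sup>+x. ennreal ((norm (D k x))\<^sup>2) \<partial>?M)"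
      by (subst nn_integral_cmult[symmetric]) (auto simp: ennreal_mult')
    also have "\<dots> = ennreal (2^k * (L2_norm \<omega> (D k))\<^sup>2)"
      by (simp add: L2_integral_sq[OF DL] ennreal_mult')
    also have "\<dots> \<le> ennreal (2^k * ((1/2)^k)\<^sup>2)"
      using less_imp_le[OF N[OF rS rN, of k]]
      by (intro ennreal_leI mult_left_mono power_mono) (auto simp: D_def[abs_def])
    also have "2^k * ((1/2)^k)\<^sup>2 = ((1/2)^k :: real)"
      by (simp add: power2_eq_square power_divide)
    finally show ?thesis .
  qed
  have "(\<integral>\<^sup>+x. (\<Sum>k. ennreal (2^k * (norm (D k x))\<^sup>2)) \<partial>?M) = (\<Sum>k. (\<integral>\<^sup>+x. ennreal (2^k * (norm (D k x))\<^sup>2) \<partial>?M))"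
    by (rule nn_integral_suminf) auto
  also have "\<dots> \<le> (\<Sum>k. ennreal ((1/2)^k))"
    by (intro suminf_le Dn) auto
  also have "\<dots> = ennreal (\<Sum>k. (1/2)^k)"
    by (intro suminf_ennreal2) auto
  also have "\<dots> < \<infinity>" by simp
  finally have "(\<integral>\<^sup>+x. (\<Sum>k. ennreal (2^k * (norm (D k x))\<^sup>2)) \<partial>?M) \<noteq> \<infinity>" by simp
  then have "AE x in ?M. (\<Sum>k. ennreal (2^k * (norm (D k x))\<^sup>2)) \<noteq> \<infinity>"
    by (intro nn_integral_noteq_infinite) auto
  then have conv: "AE x in ?M. convergent (\<lambda>k. d (r k) x)"
  proof (rule AE_mp, intro AE_I2 impI)
    fix x assume fin: "(\<Sum>k. ennreal (2^k * (norm (D k x))\<^sup>2)) \<noteq> \<infinity>"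
    define S where "S = enn2real (\<Sum>k. ennreal (2^k * (norm (D k x))\<^sup>2))"
    have S: "S \<ge> 0" "(\<Sum>k. ennreal (2^k * (norm (D k x))\<^sup>2)) = ennreal S"
      unfolding S_def by (rule enn2real_nonneg)
        (rule ennreal_enn2real[symmetric], use fin in \<open>simp only: infinity_ennreal_def less_top\<close>)
    have bd: "norm (D k x) \<le> sqrt S * (sqrt (1/2))^k" for k
    proof -
      have "ennreal (2^k * (norm (D k x))\<^sup>2) \<le> ennreal S"
        unfolding S(2)[symmetric]
        by (rule order_trans[OF _ sum_le_suminf[of _ "{k}"]]) (auto intro: summableI)
      then have "2^k * (norm (D k x))\<^sup>2 \<le> S" using S(1) by (simp add: ennreal_le_iff)
      then have "(norm (D k x))\<^sup>2 \<le> S * (1/2)^k" by (simp add: field_simps)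
      then have "norm (D k x) \<le> sqrt (S * (1/2)^k)" by (rule real_le_rsqrt)
      then show ?thesis by (simp only: real_sqrt_mult real_sqrt_power)
    qed
    have "summable (\<lambda>k. D k x)"
    proof (rule summable_comparison_test')
      show "summable (\<lambda>k. sqrt S * (sqrt (1/2))^k)"
        by (intro summable_mult summable_geometric) (simp add: real_sqrt_divide)
    qed (use bd in auto)
    then have "convergent (\<lambda>n. \<Sum>k<n. D k x)" by (simp add: summable_iff_convergent)
    moreover have "(\<Sum>k<n. D k x) = d (r n) x - d (r 0) x" for n
      unfolding D_def by (rule sum_lessThan_telescope)
    ultimately have "convergent (\<lambda>n. (d (r n) x - d (r 0) x) + d (r 0) x)"
      by (intro convergent_add) (auto intro: convergent_const)
    then show "convergent (\<lambda>k. d (r k) x)" by simp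
  qed
  \<comment> \<open>On the exceptional null set \<open>lim\<close> is some unspecified value; the
    function is measurable all the same.\<close>
  define f where "f x = lim (\<lambda>k. d (r k) x)" for x
  have fm[measurable]: "f \<in> borel_measurable ?M"
    unfolding f_def by measurable
  have rk: "r k \<ge> N j" if "k \<ge> j" for k j
  proof -
    have "N j \<le> r k" unfolding r_def by (rule member_le_sum) (use that in auto)
    then show ?thesis .
  qed
  have key: "(\<integral>\<^sup>+x. ennreal ((norm (d n x - f x))\<^sup>2) \<partial>?M) \<le> ennreal (((1/2)^j)\<^sup>2)" if n: "n \<ge> N j" for n j
  proof -
    have "(\<integral>\<^sup>+x. ennreal ((norm (d n x - f x))\<^sup>2) \<partial>?M)
      = (\<integral>\<^sup>+x. liminf (\<lambda>k. ennreal ((norm (d n x - d (r k) x))\<^sup>2)) \<partial>?M)"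
    proof (rule nn_integral_cong_AE, rule AE_mp[OF conv], intro AE_I2 impI)
      fix x assume "convergent (\<lambda>k. d (r k) x)"
      then have "(\<lambda>k. d (r k) x) \<longlonglongrightarrow> f x" unfolding f_def by (simp add: convergent_LIMSEQ_iff)
      then have "(\<lambda>k. ennreal ((norm (d n x - d (r k) x))\<^sup>2)) \<longlonglongrightarrow> ennreal ((norm (d n x - f x))\<^sup>2)"
        by (intro tendsto_ennrealI tendsto_intros)
      then show "ennreal ((norm (d n x - f x))\<^sup>2) = liminf (\<lambda>k. ennreal ((norm (d n x - d (r k) x))\<^sup>2))"
        by (intro lim_imp_Liminf[symmetric]) auto
    qed
    also have "\<dots> \<le> liminf (\<lambda>k. \<integral>\<^sup>+x. ennreal ((norm (d n x - d (r k) x))\<^sup>2) \<partial>?M)"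
      by (rule nn_integral_liminf) auto
    also have "\<dots> \<le> ennreal (((1/2)^j)\<^sup>2)"
    proof (rule Liminf_le)
      show "\<forall>\<^sub>F k in sequentially. (\<integral>\<^sup>+x. ennreal ((norm (d n x - d (r k) x))\<^sup>2) \<partial>?M) \<le> ennreal (((1/2)^j)\<^sup>2)"
        using eventually_ge_at_top[of j]
      proof eventually_elim
        case (elim k)
        show ?case
          unfolding L2_integral_sq[OF diff_in_L2[OF d d]]
          using N[OF n rk[OF elim]] by (intro ennreal_leI power_mono) auto
      qed
    qed simp
    finally show ?thesis .
  qed
  have dfL: "(\<lambda>x. d n x - f x) \<in> L2_space \<omega>" if "n \<ge> N 0" for n
  proof -
    have "integrable ?M (\<lambda>x. (norm (d n x - f x))\<^sup>2)"
      using key[OF that] by (intro integrableI_bounded) (auto simp: less_top[symmetric] top_unique)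
    then show ?thesis by (simp add: L2_space_def)
  qed
  have fL: "f \<in> L2_space \<omega>"
    using diff_in_L2[OF d[of "N 0"] dfL[of "N 0"]] by simp
  have "L2_norm \<omega> (\<lambda>x. d n x - f x) \<le> (1/2)^j" if "n \<ge> N j" for n j
  proof -
    have "ennreal ((L2_norm \<omega> (\<lambda>x. d n x - f x))\<^sup>2) \<le> ennreal (((1/2)^j)\<^sup>2)"
      using key[OF that] L2_integral_sq[OF diff_in_L2[OF d fL]] by simp
    then have "(L2_norm \<omega> (\<lambda>x. d n x - f x))\<^sup>2 \<le> ((1/2)^j)\<^sup>2"
      by (subst (asm) ennreal_le_iff) simp_all
    then show ?thesis by (rule power2_le_imp_le) simp
  qed
  then have "(\<lambda>n. L2_norm \<omega> (\<lambda>x. d n x - f x)) \<longlonglongrightarrow> 0"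
  proof (intro LIMSEQ_I)
    fix e :: real assume "e > 0"
    obtain j where j: "(1/2)^j < e" using real_arch_pow_inv[of e "1/2"] \<open>e > 0\<close> by auto
    show "\<exists>no. \<forall>n\<ge>no. norm (L2_norm \<omega> (\<lambda>x. d n x - f x) - 0) < e"
      using \<open>\<And>n j. n \<ge> N j \<Longrightarrow> L2_norm \<omega> (\<lambda>x. d n x - f x) \<le> (1/2)^j\<close> j
      by (intro exI[of _ "N j"]) (auto intro: le_less_trans)
  qed
  with fL that show thesis by blast
qed

lemma L2_inner_tendsto:
  fixes d :: "nat \<Rightarrow> 'a::euclidean_space \<Rightarrow> 'b::euclidean_space"
  assumes d: "\<And>n. d n \<in> L2_space \<omega>" and f: "f \<in> L2_space \<omega>" and h: "h \<in> L2_space \<omega>"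
    and lim: "(\<lambda>n. L2_norm \<omega> (\<lambda>x. d n x - f x)) \<longlonglongrightarrow> 0"
  shows "(\<lambda>n. L2_inner \<omega> (d n) h) \<longlonglongrightarrow> L2_inner \<omega> f h"
proof -
  have "(\<lambda>n. L2_inner \<omega> (d n) h - L2_inner \<omega> f h) \<longlonglongrightarrow> 0"
  proof (rule Lim_null_comparison)
    show "(\<lambda>n. L2_norm \<omega> (\<lambda>x. d n x - f x) * L2_norm \<omega> h) \<longlonglongrightarrow> 0"
      using tendsto_mult_left_zero[OF lim] .
    show "\<forall>\<^sub>F n in sequentially. norm (L2_inner \<omega> (d n) h - L2_inner \<omega> f h)
       \<le> L2_norm \<omega> (\<lambda>x. d n x - f x) * L2_norm \<omega> h"
      using L2_Cauchy_Schwarz[OF diff_in_L2[OF d f] h] L2_inner_diff_left[OF d f h] by simp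
  qed
  then show ?thesis using LIM_zero_iff by blast
qed

text \<open>The representer minimises the quadratic functional \<open>J\<close>. As \<open>D\<close>
  is not assumed closed, it lies only in the closure of \<open>D\<close>; the approximating sequence
  in \<open>D\<close> belongs to the conclusion because membership in a concrete space is later
  shown by passing to the limit along it.\<close>

lemma L2_Riesz:
  fixes D :: "('a::euclidean_space \<Rightarrow> 'b::euclidean_space) set"
  assumes DL: "D \<subseteq> L2_space \<omega>" and D0: "(\<lambda>x. 0) \<in> D"
    and D_lin: "\<And>f g c. f \<in> D \<Longrightarrow> g \<in> D \<Longrightarrow> (\<lambda>x. f x + c *\<^sub>R g x) \<in> D"
    and F_lin: "\<And>f g c. f \<in> D \<Longrightarrow> g \<in> D \<Longrightarrow> F (\<lambda>x. f x + c *\<^sub>R g x) = F f + c * F g"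
    and F_bd: "\<And>f. f \<in> D \<Longrightarrow> \<bar>F f\<bar> \<le> C * L2_norm \<omega> f"
  shows "\<exists>u d. u \<in> L2_space \<omega> \<and> (\<forall>v\<in>D. L2_inner \<omega> u v = F v) \<and>
    (\<forall>n::nat. d n \<in> D) \<and> (\<lambda>n. L2_norm \<omega> (\<lambda>x. d n x - u x)) \<longlonglongrightarrow> 0"
proof -
  define J where "J v = L2_inner \<omega> v v - 2 * F v" for v
  have inL: "f \<in> L2_space \<omega>" if "f \<in> D" for f using that DL by auto
  have Jlow: "J v \<ge> - C\<^sup>2" if "v \<in> D" for v
  proof -
    have "0 \<le> (L2_norm \<omega> v - C)\<^sup>2" by simp
    moreover have "F v \<le> C * L2_norm \<omega> v" using F_bd[OF that] by linarith
    ultimately show ?thesis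
      unfolding J_def by (simp add: L2_norm_sq[symmetric] power2_diff mult.commute)
  qed
  define m where "m = Inf (J ` D)"
  have bdd: "bdd_below (J ` D)" using Jlow by (auto simp: bdd_below_def)
  have mle: "m \<le> J v" if "v \<in> D" for v
    unfolding m_def using that bdd by (intro cInf_lower) auto
  define w where "w n = 1 / real (Suc n)" for n
  have "\<exists>v\<in>D. J v < m + w n" for n
  proof -
    have "m < m + w n" by (simp add: w_def)
    then obtain y where "y \<in> J ` D" "y < m + w n"
      unfolding m_def using cInf_lessD[of "J ` D"] D0 by blast
    then show ?thesis by blast
  qed
  then obtain d where dD: "\<And>n. d n \<in> D" and dJ: "\<And>n. J (d n) < m + w n" by metis
  have expand: "J (\<lambda>x. f x + c *\<^sub>R g x) = J f + 2 * c * (L2_inner \<omega> f g - F g) + c\<^sup>2 * L2_inner \<omega> g g"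
    if "f \<in> D" "g \<in> D" for f g c
    unfolding J_def using that inL F_lin by (simp add: L2_expand algebra_simps)
  \<comment> \<open>The midpoint of \<open>f\<close> and \<open>g\<close> has energy at least
    \<open>m\<close>; by the parallelogram law this bounds their distance, so minimising sequences
    are Cauchy.\<close>
  have par: "(L2_norm \<omega> (\<lambda>x. f x - g x))\<^sup>2 \<le> 2 * (J f - m) + 2 * (J g - m)"
    if f: "f \<in> D" and g: "g \<in> D" for f g
  proof -
    define h where "h = (\<lambda>x. g x + (-1) *\<^sub>R f x)"
    have h: "h \<in> D" unfolding h_def by (intro D_lin f g)
    have "J g = J (\<lambda>x. f x + 1 *\<^sub>R h x)" by (simp add: h_def)
    also have "\<dots> = J f + 2 * (L2_inner \<omega> f h - F h) + L2_inner \<omega> h h"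
      by (subst expand[OF f h]) simp
    finally have 1: "J g = J f + 2 * (L2_inner \<omega> f h - F h) + L2_inner \<omega> h h" .
    have "m \<le> J (\<lambda>x. f x + (1/2) *\<^sub>R h x)" by (intro mle D_lin f h)
    also have "\<dots> = J f + (L2_inner \<omega> f h - F h) + L2_inner \<omega> h h / 4"
      by (subst expand[OF f h]) (simp add: power2_eq_square)
    finally have "L2_inner \<omega> h h \<le> 2 * (J f - m) + 2 * (J g - m)" using 1 by simp
    moreover have "(L2_norm \<omega> (\<lambda>x. f x - g x))\<^sup>2 = (L2_norm \<omega> h)\<^sup>2"
      by (simp add: L2_norm_def h_def norm_minus_commute)
    ultimately show ?thesis by (simp add: L2_norm_sq)
  qed
  have Cau: "\<exists>N. \<forall>k\<ge>N. \<forall>n\<ge>N. L2_norm \<omega> (\<lambda>x. d k x - d n x) < e" if "e > 0" for e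
  proof -
    \<comment> \<open>Both energies exceed \<open>m\<close> by less than
      \<open>e\<^sup>2 / 4\<close>, and each excess enters \<open>par\<close> with the factor
      2.\<close>
    obtain N where N: "w N < e\<^sup>2 / 4" using \<open>e > 0\<close> nat_approx_posE[of "e\<^sup>2 / 4"] by (auto simp: w_def)
    have "L2_norm \<omega> (\<lambda>x. d k x - d n x) < e" if "k \<ge> N" "n \<ge> N" for k n
    proof -
      have "w k \<le> w N" "w n \<le> w N"
        using that by (auto simp: w_def field_simps)
      then have "(L2_norm \<omega> (\<lambda>x. d k x - d n x))\<^sup>2 < e\<^sup>2"
        using par[OF dD[of k] dD[of n]] dJ[of k] dJ[of n] N by argo
      then show ?thesis using \<open>e > 0\<close> by (simp add: power_less_imp_less_base)
    qed
    then show ?thesis by blast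
  qed
  obtain u where u: "u \<in> L2_space \<omega>" "(\<lambda>n. L2_norm \<omega> (\<lambda>x. d n x - u x)) \<longlonglongrightarrow> 0"
    using L2_complete[of d \<omega>] inL[OF dD] Cau by blast
  have w0: "w \<longlonglongrightarrow> 0" unfolding w_def by (rule LIMSEQ_Suc[OF lim_inverse_n'])
  have "L2_inner \<omega> u v = F v" if v: "v \<in> D" for v
  proof -
    define b where "b = L2_inner \<omega> u v - F v"
    define c where "c = L2_inner \<omega> v v"
    \<comment> \<open>First variation: perturbing \<open>d n\<close> by a multiple of
      \<open>v\<close> lowers the energy by less than \<open>w n\<close>, and this excess disappears
      in the limit.\<close>
    have q: "0 \<le> 2 * t * b + t\<^sup>2 * c" for t
    proof -
      have "m \<le> m + w n + 2 * t * (L2_inner \<omega> (d n) v - F v) + t\<^sup>2 * c" for n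
        using mle[OF D_lin[OF dD v], of n t] expand[OF dD v, of n t] dJ[of n] unfolding c_def by linarith
      moreover have "(\<lambda>n. m + w n + 2 * t * (L2_inner \<omega> (d n) v - F v) + t\<^sup>2 * c)
          \<longlonglongrightarrow> m + 0 + 2 * t * (L2_inner \<omega> u v - F v) + t\<^sup>2 * c"
        by (intro tendsto_intros L2_inner_tendsto inL[OF dD] inL[OF v] u w0)
      ultimately have "m \<le> m + 0 + 2 * t * (L2_inner \<omega> u v - F v) + t\<^sup>2 * c"
        by (intro LIMSEQ_le_const) auto
      then show ?thesis by (simp add: b_def)
    qed
    have "c \<ge> 0" by (simp add: c_def)
    have "b = 0"
    proof (cases "c = 0")
      case True
      then show ?thesis using q[of "-b"] by (auto simp: mult_le_0_iff zero_le_mult_iff)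
    next
      case False
      then have "c > 0" using \<open>c \<ge> 0\<close> by simp
      moreover have "2 * (- b / c) * b + (- b / c)\<^sup>2 * c = - (b\<^sup>2 / c)"
        using \<open>c > 0\<close> by (simp add: field_simps power2_eq_square)
      ultimately have "b\<^sup>2 / c \<le> 0" using q[of "- b / c"] by linarith
      then show ?thesis using \<open>c > 0\<close> by (simp add: divide_le_0_iff)
    qed
    then show ?thesis by (simp add: b_def)
  qed
  with u dD show ?thesis by blast
qed

section \<open>Smooth functions\<close>

text \<open>The derivative in a fixed direction as a function of the point, which is what
  \<open>C_diff\<close> recurses on.\<close>

definition dird :: "'a::euclidean_space \<Rightarrow> ('a \<Rightarrow> 'b::euclidean_space) \<Rightarrow> 'a \<Rightarrow> 'b" where
  "dird v f x = frechet_derivative f (at x) v"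

lemma dird_eq: "(f has_derivative f') (at x) \<Longrightarrow> dird v f x = f' v"
  unfolding dird_def by (simp add: frechet_derivative_at[symmetric])

declare C_diff.simps(2) [simp del]

lemma C_diff_SucI:
  assumes "\<And>x. (f has_derivative f' x) (at x)" "\<And>h. C_diff k (\<lambda>x. f' x h)"
  shows "C_diff (Suc k) f"
  unfolding C_diff.simps using assms by blast

text \<open>The derivative inside \<open>C_diff\<close> is an existential witness; uniqueness of
  derivatives identifies it with \<open>dird\<close>, so that the inductions below can name
  it.\<close>

lemma C_diff_SucD:
  assumes "C_diff (Suc k) f"
  shows "(f has_derivative (\<lambda>v. dird v f x)) (at x)" and "C_diff k (dird v f)"
proof -
  obtain f' where f': "\<forall>x. (f has_derivative f' x) (at x)" "\<forall>h. C_diff k (\<lambda>x. f' x h)"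
    using assms unfolding C_diff.simps by blast
  have *: "dird v f = (\<lambda>x. f' x v)" for v
    using f'(1) dird_eq by blast
  show "(f has_derivative (\<lambda>v. dird v f x)) (at x)" "C_diff k (dird v f)"
    unfolding * using f' by auto
qed

lemma C_diff_mono_Suc: "C_diff (Suc k) f \<Longrightarrow> C_diff k f"
proof (induction k arbitrary: f)
  case 0
  then show ?case by (simp, intro continuous_at_imp_continuous_on ballI has_derivative_continuous[OF C_diff_SucD(1)])
next
  case (Suc k)
  show ?case
    by (rule C_diff_SucI[OF C_diff_SucD(1)[OF Suc.prems] Suc.IH[OF C_diff_SucD(2)[OF Suc.prems]]])
qed

lemma C_diff_const: "C_diff k (\<lambda>x. c)"
proof (induction k arbitrary: c)
  case (Suc k)
  then show ?case by (intro C_diff_SucI[of _ "\<lambda>x h. 0"]) auto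
qed auto

lemma C_diff_bounded_linear: "bounded_linear f \<Longrightarrow> C_diff k f"
proof (cases k)
  case 0
  assume "bounded_linear f" then show ?thesis using 0 by (simp add: linear_continuous_on)
next
  case (Suc j)
  assume "bounded_linear f" then show ?thesis unfolding Suc
    by (intro C_diff_SucI[of _ "\<lambda>x. f"] C_diff_const bounded_linear_imp_has_derivative)
qed

lemma C_diff_add: "C_diff k f \<Longrightarrow> C_diff k g \<Longrightarrow> C_diff k (\<lambda>x. f x + g x)"
proof (induction k arbitrary: f g)
  case 0 then show ?case by (auto intro: continuous_intros)
next
  case (Suc k)
  note f = C_diff_SucD[OF Suc.prems(1)]
  note g = C_diff_SucD[OF Suc.prems(2)]
  show ?case
    by (rule C_diff_SucI[of _ "\<lambda>x h. dird h f x + dird h g x"]) (auto intro!: has_derivative_add f g Suc.IH)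
qed

lemma C_diff_linear_compose:
  assumes L: "bounded_linear L"
  shows "C_diff k f \<Longrightarrow> C_diff k (\<lambda>x. L (f x))"
proof (induction k arbitrary: f)
  case 0 then show ?case using linear_continuous_on_compose[of UNIV f L] L by (simp add: linear_conv_bounded_linear)
next
  case (Suc k)
  note f = C_diff_SucD[OF Suc.prems(1)]
  show ?case
    by (rule C_diff_SucI[of _ "\<lambda>x h. L (dird h f x)"])
      (auto intro!: bounded_linear.has_derivative[OF L] f Suc.IH)
qed

lemma C_diff_scaleR:
  fixes u :: "'a::euclidean_space \<Rightarrow> real"
  shows "C_diff k u \<Longrightarrow> C_diff k f \<Longrightarrow> C_diff k (\<lambda>x. u x *\<^sub>R f x)"
proof (induction k arbitrary: f u)
  case 0 then show ?case by (auto intro: continuous_intros)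
next
  case (Suc k)
  note f = C_diff_SucD[OF Suc.prems(2)]
  note u = C_diff_SucD[OF Suc.prems(1)]
  show ?case
    by (rule C_diff_SucI[of _ "\<lambda>x h. u x *\<^sub>R dird h f x + dird h u x *\<^sub>R f x"])
      (auto intro!: has_derivative_scaleR f u Suc.IH C_diff_add C_diff_mono_Suc[OF Suc.prems(1)]
        C_diff_mono_Suc[OF Suc.prems(2)])
qed

text \<open>Scalar outer functions suffice for building cut-offs. Their derivative has the single
  component \<open>dird 1 g\<close>, so the chain rule yields a product to which the induction
  hypothesis applies.\<close>

lemma C_diff_real_compose:
  fixes g :: "real \<Rightarrow> real" and f :: "'a::euclidean_space \<Rightarrow> real"
  shows "C_diff k g \<Longrightarrow> C_diff k f \<Longrightarrow> C_diff k (\<lambda>x. g (f x))"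
proof (induction k arbitrary: f g)
  case 0 then show ?case
    using continuous_on_compose2[of UNIV g UNIV f] by simp
next
  case (Suc k)
  note f = C_diff_SucD[OF Suc.prems(2)]
  note g = C_diff_SucD[OF Suc.prems(1)]
  have g1: "dird t g x = t * dird 1 g x" for x t
    using linear_cmul[OF has_derivative_linear[OF g(1)], of t 1 x] by simp
  show ?case
  proof (rule C_diff_SucI)
    fix x show "((\<lambda>x. g (f x)) has_derivative (\<lambda>h. dird h f x *\<^sub>R dird 1 g (f x))) (at x)"
      by (rule has_derivative_eq_rhs[OF has_derivative_compose[OF f(1) g(1)]])
        (simp add: g1[of "dird _ f x"])
  next
    fix h show "C_diff k (\<lambda>x. dird h f x *\<^sub>R dird 1 g (f x))"
      using C_diff_scaleR[OF f(2) Suc.IH[OF g(2) C_diff_mono_Suc[OF Suc.prems(2)]]] .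
  qed
qed

lemma C_diff_inverse:
  fixes f :: "'a::euclidean_space \<Rightarrow> real"
  assumes "\<And>x. f x \<noteq> 0"
  shows "C_diff k f \<Longrightarrow> C_diff k (\<lambda>x. inverse (f x))"
proof (induction k)
  case 0 then show ?case using assms by (auto intro!: continuous_intros)
next
  case (Suc k)
  note f = C_diff_SucD[OF Suc.prems(1)]
  have i: "C_diff k (\<lambda>x. inverse (f x))" using Suc.IH C_diff_mono_Suc[OF Suc.prems] by blast
  show ?case
  proof (rule C_diff_SucI)
    fix x show "((\<lambda>x. inverse (f x)) has_derivative (\<lambda>h. (- 1) *\<^sub>R (inverse (f x) *\<^sub>R (dird h f x *\<^sub>R inverse (f x))))) (at x)"
      using Deriv.has_derivative_inverse[OF assms[of x] f(1)[of x]] by (rule has_derivative_eq_rhs) (simp add: fun_eq_iff)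
  next
    fix h show "C_diff k (\<lambda>x. (- 1) *\<^sub>R (inverse (f x) *\<^sub>R (dird h f x *\<^sub>R inverse (f x))))"
      by (intro C_diff_scaleR i f(2) C_diff_const)
  qed
qed

lemma C_diff_translate: "C_diff k f \<Longrightarrow> C_diff k (\<lambda>x. f (x + c))"
proof (induction k arbitrary: f)
  case 0 then show ?case using continuous_on_compose2[of UNIV f UNIV "\<lambda>x. x + c"]
    by (simp add: continuous_intros)
next
  case (Suc k)
  note f = C_diff_SucD[OF Suc.prems(1)]
  have "((\<lambda>x. f (x + c)) has_derivative (\<lambda>v. dird v f (x + c))) (at x)" for x
    using has_derivative_compose[OF has_derivative_add_const[OF has_derivative_ident] f(1), of c x UNIV] by simp
  then show ?case
    by (intro C_diff_SucI[of _ "\<lambda>x v. dird v f (x + c)"] Suc.IH[OF f(2)])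
qed

section \<open>Infinitely differentiable functions\<close>

definition smooth :: "('a::euclidean_space \<Rightarrow> 'b::euclidean_space) \<Rightarrow> bool" where
  "smooth f \<longleftrightarrow> (\<forall>k. C_diff k f)"

lemma smooth_derivative:
  assumes "smooth f"
  shows "(f has_derivative (\<lambda>v. dird v f x)) (at x)" and "smooth (dird v f)"
proof -
  have "C_diff (Suc k) f" for k using assms by (simp add: smooth_def)
  from C_diff_SucD[OF this] show "(f has_derivative (\<lambda>v. dird v f x)) (at x)" "smooth (dird v f)"
    by (auto simp: smooth_def)
qed

lemma smooth_const: "smooth (\<lambda>x. c)"
  and smooth_bounded_linear: "bounded_linear L \<Longrightarrow> smooth L"
  and smooth_add: "smooth f \<Longrightarrow> smooth g \<Longrightarrow> smooth (\<lambda>x. f x + g x)"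
  and smooth_linear_compose: "bounded_linear M \<Longrightarrow> smooth f \<Longrightarrow> smooth (\<lambda>x. M (f x))"
  and smooth_translate: "smooth f \<Longrightarrow> smooth (\<lambda>x. f (x + c))"
  by (auto simp: smooth_def C_diff_const C_diff_bounded_linear C_diff_add C_diff_linear_compose C_diff_translate)

lemma smooth_scaleR: "smooth u \<Longrightarrow> smooth f \<Longrightarrow> smooth (\<lambda>x. u x *\<^sub>R f x)"
  for u :: "'a::euclidean_space \<Rightarrow> real"
  and f :: "'a \<Rightarrow> 'b::euclidean_space"
  by (simp add: smooth_def C_diff_scaleR)

lemma smooth_mult: "smooth u \<Longrightarrow> smooth f \<Longrightarrow> smooth (\<lambda>x. u x * f x :: real)"
  using smooth_scaleR[of u f] by simp

lemma smooth_real_compose: "smooth g \<Longrightarrow> smooth u \<Longrightarrow> smooth (\<lambda>x. g (u x))"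
  for u :: "'a::euclidean_space \<Rightarrow> real" and g :: "real \<Rightarrow> real"
  by (simp add: smooth_def C_diff_real_compose)

lemma smooth_inverse: "smooth u \<Longrightarrow> (\<And>x. u x \<noteq> 0) \<Longrightarrow> smooth (\<lambda>x. inverse (u x))"
  for u :: "'a::euclidean_space \<Rightarrow> real"
  by (simp add: smooth_def C_diff_inverse)

lemma smooth_sum: "(\<And>i. i \<in> I \<Longrightarrow> smooth (f i)) \<Longrightarrow> smooth (\<lambda>x. \<Sum>i\<in>I. f i x)"
  by (induction I rule: infinite_finite_induct) (auto intro: smooth_const smooth_add)

lemma smooth_inner_const: "smooth f \<Longrightarrow> smooth (\<lambda>x. f x \<bullet> c)"
  by (rule smooth_linear_compose[OF bounded_linear_inner_left])

lemma smooth_inner: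
  fixes f g :: "'a::euclidean_space \<Rightarrow> 'b::euclidean_space"
  assumes "smooth f" "smooth g"
  shows "smooth (\<lambda>x. f x \<bullet> g x)"
proof -
  have "smooth (\<lambda>x. \<Sum>b\<in>Basis. (f x \<bullet> b) * (g x \<bullet> b))"
    by (rule smooth_sum, rule smooth_mult; rule smooth_inner_const, rule assms)
  then show ?thesis
    by (subst euclidean_inner)
qed

lemma smooth_uminus: "smooth f \<Longrightarrow> smooth (\<lambda>x. - f x)"
  by (rule smooth_linear_compose[OF bounded_linear_minus[OF bounded_linear_ident]])

lemma smooth_diff:
  assumes "smooth f" "smooth g"
  shows "smooth (\<lambda>x. f x - g x)"
  using smooth_add[OF assms(1) smooth_uminus[OF assms(2)]] by simp

lemma smooth_ident: "smooth (\<lambda>x. x)"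
  by (rule smooth_bounded_linear[OF bounded_linear_ident])

lemmas smooth_intros = smooth_const smooth_add smooth_scaleR smooth_mult smooth_sum smooth_inner
  smooth_uminus smooth_diff smooth_ident smooth_derivative(2)

lemma smooth_continuous:
  assumes "smooth f"
  shows "continuous_on S f"
proof -
  have "C_diff 0 f" using assms unfolding smooth_def by (rule spec)
  then have "continuous_on UNIV f" by (simp only: C_diff.simps(1))
  then show ?thesis by (rule continuous_on_subset) simp
qed

lemma smooth_measurable: "smooth f \<Longrightarrow> f \<in> borel_measurable borel"
  by (rule borel_measurable_continuous_onI[OF smooth_continuous])

lemma grad_eq: "grad \<phi> = (\<lambda>x. \<Sum>b\<in>Basis. dird b \<phi> x *\<^sub>R b)"
  by (simp add: grad_def dird_def fun_eq_iff)

lemma divg_eq: "divg \<phi> = (\<lambda>x. \<Sum>b\<in>Basis. dird b \<phi> x \<bullet> b)"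
  by (simp add: divg_def dird_def fun_eq_iff)

lemma smooth_grad: "smooth \<phi> \<Longrightarrow> smooth (grad \<phi>)"
  unfolding grad_eq by (intro smooth_intros)

lemma smooth_divg: "smooth \<phi> \<Longrightarrow> smooth (divg \<phi>)"
  unfolding divg_eq by (intro smooth_intros)

lemma dird_linear:
  assumes "smooth f"
  shows "linear (\<lambda>v. dird v f x)"
  using smooth_derivative(1)[OF assms] has_derivative_linear by blast

lemma dird_add: "smooth f \<Longrightarrow> smooth g \<Longrightarrow> dird v (\<lambda>x. f x + g x) x = dird v f x + dird v g x"
  by (rule dird_eq) (intro has_derivative_add smooth_derivative)

lemma dird_bounded_linear:
  assumes "bounded_linear L" "smooth f"
  shows "dird v (\<lambda>x. L (f x)) x = L (dird v f x)"
  by (rule dird_eq) (intro bounded_linear.has_derivative[OF assms(1)] smooth_derivative assms)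

lemma dird_scaleR:
  fixes u :: "'a::euclidean_space \<Rightarrow> real"
  shows "smooth u \<Longrightarrow> smooth f \<Longrightarrow> dird v (\<lambda>x. u x *\<^sub>R f x) x = u x *\<^sub>R dird v f x + dird v u x *\<^sub>R f x"
  by (rule dird_eq) (intro has_derivative_scaleR smooth_derivative)

lemma grad_inner: "smooth \<phi> \<Longrightarrow> grad \<phi> x \<bullet> v = dird v \<phi> x"
proof -
  assume s: "smooth \<phi>"
  have "dird v \<phi> x = dird (\<Sum>b\<in>Basis. (v \<bullet> b) *\<^sub>R b) \<phi> x" by (simp add: euclidean_representation)
  also have "\<dots> = (\<Sum>b\<in>Basis. (v \<bullet> b) * dird b \<phi> x)"
    using linear_sum[OF dird_linear[OF s], of "\<lambda>b. (v \<bullet> b) *\<^sub>R b" Basis x]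
      linear_cmul[OF dird_linear[OF s]] by simp
  finally show ?thesis by (simp add: grad_eq inner_sum_left inner_commute[of v] mult.commute[of "dird _ _ _"])
qed

subsection \<open>Test functions\<close>

text \<open>Any compact subset of \<open>\<omega>\<close> outside which the function vanishes can
  replace the closed support; such sets are easy to exhibit for sums, products and averages.\<close>

lemma test_functions_iff:
  "\<phi> \<in> test_functions \<omega> \<longleftrightarrow> smooth \<phi> \<and> (\<exists>K. compact K \<and> K \<subseteq> \<omega> \<and> (\<forall>x. x \<notin> K \<longrightarrow> \<phi> x = 0))"
proof
  assume "\<phi> \<in> test_functions \<omega>"
  then show "smooth \<phi> \<and> (\<exists>K. compact K \<and> K \<subseteq> \<omega> \<and> (\<forall>x. x \<notin> K \<longrightarrow> \<phi> x = 0))"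
    unfolding test_functions_def smooth_def
    using closure_subset[of "{x. \<phi> x \<noteq> 0}"] by blast
next
  assume "smooth \<phi> \<and> (\<exists>K. compact K \<and> K \<subseteq> \<omega> \<and> (\<forall>x. x \<notin> K \<longrightarrow> \<phi> x = 0))"
  then obtain K where K: "smooth \<phi>" "compact K" "K \<subseteq> \<omega>" "\<forall>x. x \<notin> K \<longrightarrow> \<phi> x = 0" by blast
  then have "closure {x. \<phi> x \<noteq> 0} \<subseteq> K"
    by (intro closure_minimal compact_imp_closed) auto
  moreover from this have "compact (closure {x. \<phi> x \<noteq> 0})"
    using K(2) compact_Int_closed[of K "closure {x. \<phi> x \<noteq> 0}"] by (simp add: Int_absorb1)
  ultimately show "\<phi> \<in> test_functions \<omega>"
    using K by (auto simp: test_functions_def smooth_def)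
qed

lemma test_functionsE:
  assumes "\<phi> \<in> test_functions \<omega>"
  obtains K where "smooth \<phi>" "compact K" "K \<subseteq> \<omega>" "\<forall>x. x \<notin> K \<longrightarrow> \<phi> x = 0"
  using assms unfolding test_functions_iff by blast

lemma test_functionsI:
  assumes "smooth \<phi>" "compact K" "K \<subseteq> \<omega>" "\<And>x. x \<notin> K \<Longrightarrow> \<phi> x = 0"
  shows "\<phi> \<in> test_functions \<omega>"
  using assms unfolding test_functions_iff by blast

lemma test_smooth: "\<phi> \<in> test_functions \<omega> \<Longrightarrow> smooth \<phi>"
  by (auto elim: test_functionsE)

lemma test_functions_mono: "\<omega> \<subseteq> \<omega>' \<Longrightarrow> test_functions \<omega> \<subseteq> test_functions \<omega>'"
  by (auto simp: test_functions_def)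

lemma dird_zero_off_support:
  assumes "compact K" "\<And>x. x \<notin> K \<Longrightarrow> \<phi> x = 0" "x \<notin> K"
  shows "dird v \<phi> x = 0"
proof (rule dird_eq)
  have "((\<lambda>x. 0) has_derivative (\<lambda>v. 0)) (at x)" by simp
  then show "(\<phi> has_derivative (\<lambda>v. 0)) (at x)"
    by (rule has_derivative_transform_within_open[of _ _ _ _ "- K"])
      (use assms in \<open>auto simp: compact_imp_closed\<close>)
qed

lemma dird_test: "\<phi> \<in> test_functions \<omega> \<Longrightarrow> dird v \<phi> \<in> test_functions \<omega>"
  by (elim test_functionsE, rule test_functionsI)
    (auto intro: smooth_derivative dird_zero_off_support)

lemma test_scaleR_left:
  fixes u :: "'a::euclidean_space \<Rightarrow> real" and f :: "'a \<Rightarrow> 'b::euclidean_space"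
  shows "u \<in> test_functions \<omega> \<Longrightarrow> smooth f \<Longrightarrow> (\<lambda>x. u x *\<^sub>R f x) \<in> test_functions \<omega>"
  by (elim test_functionsE, rule test_functionsI) (auto intro: smooth_intros)

lemma test_scaleR_right:
  fixes u :: "'a::euclidean_space \<Rightarrow> real" and f :: "'a \<Rightarrow> 'b::euclidean_space"
  shows "smooth u \<Longrightarrow> f \<in> test_functions \<omega> \<Longrightarrow> (\<lambda>x. u x *\<^sub>R f x) \<in> test_functions \<omega>"
  by (elim test_functionsE, rule test_functionsI) (auto intro: smooth_intros)

lemma test_linear_compose:
  assumes "bounded_linear L" "\<phi> \<in> test_functions \<omega>"
  shows "(\<lambda>x. L (\<phi> x)) \<in> test_functions \<omega>"
  using assms(2) by (elim test_functionsE, intro test_functionsI)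
    (auto intro: smooth_linear_compose[OF assms(1)] simp: linear_0[OF bounded_linear.linear[OF assms(1)]])

lemma test_zero: "(\<lambda>x. 0) \<in> test_functions \<omega>"
  by (rule test_functionsI[of _ "{}"]) (auto intro: smooth_const)

lemma test_add:
  assumes "\<phi> \<in> test_functions \<omega>" "\<psi> \<in> test_functions \<omega>"
  shows "(\<lambda>x. \<phi> x + \<psi> x) \<in> test_functions \<omega>"
proof -
  obtain K where K: "smooth \<phi>" "compact K" "K \<subseteq> \<omega>" "\<forall>x. x \<notin> K \<longrightarrow> \<phi> x = 0"
    using assms(1) by (rule test_functionsE)
  obtain M where M: "smooth \<psi>" "compact M" "M \<subseteq> \<omega>" "\<forall>x. x \<notin> M \<longrightarrow> \<psi> x = 0"
    using assms(2) by (rule test_functionsE)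
  show ?thesis
    by (rule test_functionsI[of _ "K \<union> M"]) (use K M in \<open>auto intro: smooth_intros\<close>)
qed

lemma test_sum: "(\<And>i. i \<in> I \<Longrightarrow> f i \<in> test_functions \<omega>) \<Longrightarrow> (\<lambda>x. \<Sum>i\<in>I. f i x) \<in> test_functions \<omega>"
  by (induction I rule: infinite_finite_induct) (auto intro: test_zero test_add)

lemma test_cmul: "f \<in> test_functions \<omega> \<Longrightarrow> (\<lambda>x. c *\<^sub>R f x) \<in> test_functions \<omega>"
  by (rule test_scaleR_right[OF smooth_const])

lemma grad_test: "\<phi> \<in> test_functions \<omega> \<Longrightarrow> grad \<phi> \<in> test_functions \<omega>"
  unfolding grad_eq by (intro test_sum test_scaleR_left dird_test smooth_const)

lemma divg_test: "\<phi> \<in> test_functions \<omega> \<Longrightarrow> divg \<phi> \<in> test_functions \<omega>"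
  unfolding divg_eq by (intro test_sum test_linear_compose[OF bounded_linear_inner_left] dird_test)

subsection \<open>Bump functions\<close>

text \<open>For \<open>n = 0\<close> this is the classical flat function. The powers of
  \<open>inverse t\<close> make the family closed under differentiation up to linear combinations,
  so one induction with \<open>n\<close> arbitrary proves all members smooth.\<close>

definition exp_tail :: "nat \<Rightarrow> real \<Rightarrow> real" where
  "exp_tail n t = (if t > 0 then exp (- inverse t) * inverse t ^ n else 0)"

lemma exp_tail_limit: "((\<lambda>t. exp_tail n t) \<longlongrightarrow> 0) (at 0)"
proof (rule filterlim_split_at)
  have "(exp_tail n \<longlongrightarrow> 0) (at_left 0)"
    by (rule tendsto_eventually) (auto simp: exp_tail_def eventually_at_left_field intro!: exI[of _ "-1"])
  then show "LIM t at_left 0. exp_tail n t :> nhds 0" .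
  have "((\<lambda>t. inverse t ^ n / exp (inverse t)) \<longlongrightarrow> 0) (at_right (0::real))"
    by (rule filterlim_compose[OF tendsto_power_div_exp_0 filterlim_inverse_at_top_right])
  then have "(exp_tail n \<longlongrightarrow> 0) (at_right 0)"
    by (rule Lim_transform_eventually)
      (auto simp: exp_tail_def eventually_at_right_field exp_minus field_simps intro!: exI[of _ 1])
  then show "LIM t at_right 0. exp_tail n t :> nhds 0" .
qed

lemma exp_tail_derivative:
  "(exp_tail n has_real_derivative exp_tail (n + 2) t - real n * exp_tail (n + 1) t) (at t)"
proof (cases t "0 :: real" rule: linorder_cases)
  case less
  have "((\<lambda>_. 0) has_real_derivative 0) (at t)" by simp
  then have "(exp_tail n has_real_derivative 0) (at t)"
    by (rule has_field_derivative_transform_within_open[of _ _ _ "{..<0}"])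
      (use less in \<open>auto simp: exp_tail_def\<close>)
  then show ?thesis using less by (simp add: exp_tail_def)
next
  case equal
  \<comment> \<open>As \<open>exp_tail n 0 = 0\<close>, the difference quotient at \<open>0\<close>
    is \<open>exp_tail (n + 1)\<close> itself.\<close>
  have "((\<lambda>h. (exp_tail n (0 + h) - exp_tail n 0) / h) \<longlongrightarrow> 0) (at 0)"
    by (rule Lim_transform_eventually[OF exp_tail_limit[of "n + 1"]])
      (auto simp: exp_tail_def eventually_at_filter field_simps)
  then show ?thesis unfolding equal by (simp add: DERIV_def exp_tail_def)
next
  case greater
  have p: "((\<lambda>t. inverse t ^ n) has_real_derivative - real n * inverse t ^ (n + 1)) (at t)" for n
  proof (induction n)
    case (Suc n)
    have "((\<lambda>t. inverse t * inverse t ^ n) has_real_derivative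
        inverse t * (- real n * inverse t ^ (n + 1)) + - (inverse t * 1 * inverse t) * inverse t ^ n) (at t)"
      using greater by (intro DERIV_mult' DERIV_inverse' Suc.IH DERIV_ident) auto
    then show ?case by (simp add: algebra_simps)
  qed simp
  have "((\<lambda>t. exp (- inverse t)) has_real_derivative exp (- inverse t) * (inverse t * inverse t)) (at t)"
    using greater by (auto intro!: derivative_eq_intros simp: field_simps power2_eq_square)
  from DERIV_mult'[OF this p[of n]]
  have "((\<lambda>t. exp (- inverse t) * inverse t ^ n) has_real_derivative
      exp_tail (n + 2) t - real n * exp_tail (n + 1) t) (at t)"
    by (rule DERIV_cong) (use greater in \<open>simp add: exp_tail_def algebra_simps\<close>)
  then show ?thesis
    by (rule has_field_derivative_transform_within_open[of _ _ _ "{0<..}"])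
      (use greater in \<open>auto simp: exp_tail_def\<close>)
qed

lemma smooth_exp_tail: "smooth (exp_tail n)"
  unfolding smooth_def
proof
  fix k show "C_diff k (exp_tail n)"
  proof (induction k arbitrary: n)
    case 0
    show ?case
      using exp_tail_derivative[of n]
      by (auto intro!: continuous_at_imp_continuous_on intro: DERIV_isCont)
  next
    case (Suc k)
    let ?d = "\<lambda>t. exp_tail (n + 2) t + (- real n) *\<^sub>R exp_tail (n + 1) t"
    show ?case
    proof (rule C_diff_SucI)
      fix t show "(exp_tail n has_derivative (\<lambda>h. h *\<^sub>R ?d t)) (at t)"
        using exp_tail_derivative[of n t] unfolding has_field_derivative_def
        by (rule has_derivative_eq_rhs) (simp add: fun_eq_iff)
      fix h :: real show "C_diff k (\<lambda>t. h *\<^sub>R ?d t)"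
        by (intro C_diff_scaleR C_diff_const C_diff_add Suc.IH)
    qed
  qed
qed

text \<open>The usual smooth transition from 0 to 1 on the unit interval; the two summands of the
  denominator never vanish together.\<close>

definition sstep :: "real \<Rightarrow> real" where
  "sstep t = exp_tail 0 t * inverse (exp_tail 0 t + exp_tail 0 (1 - t))"

lemma exp_tail_pos: "t > 0 \<Longrightarrow> exp_tail n t > 0" and exp_tail_nonneg: "exp_tail n t \<ge> 0"
  by (auto simp: exp_tail_def)

lemma sstep_denominator: "exp_tail 0 t + exp_tail 0 (1 - t) > 0"
proof (cases "t > 0")
  case True then show ?thesis using exp_tail_pos[of t 0] exp_tail_nonneg[of 0 "1 - t"] by linarith
next
  case False then show ?thesis using exp_tail_pos[of "1 - t" 0] exp_tail_nonneg[of 0 t] by linarith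
qed

lemma smooth_sstep: "smooth sstep"
proof -
  have "smooth (\<lambda>t. 1 + (-1) *\<^sub>R t :: real)" by (intro smooth_intros)
  from smooth_real_compose[OF smooth_exp_tail[of 0] this]
  have "smooth (\<lambda>t. exp_tail 0 (1 - t))" by simp
  then have "smooth (\<lambda>t. exp_tail 0 t * inverse (exp_tail 0 t + exp_tail 0 (1 - t)))"
    by (intro smooth_mult smooth_inverse smooth_add smooth_exp_tail less_imp_neq[OF sstep_denominator, symmetric])
  then show ?thesis unfolding sstep_def[abs_def] .
qed

lemma sstep_eq_0: "t \<le> 0 \<Longrightarrow> sstep t = 0"
  and sstep_eq_1: "t \<ge> 1 \<Longrightarrow> sstep t = 1"
  and sstep_nonneg: "sstep t \<ge> 0"
  and sstep_le_1: "sstep t \<le> 1"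
  using sstep_denominator[of t] exp_tail_nonneg[of 0 t] exp_tail_nonneg[of 0 "1 - t"]
    exp_tail_pos[of t 0]
  by (auto simp: sstep_def exp_tail_def field_simps split: if_splits)

lemma smooth_plateau:
  fixes p :: "'a::euclidean_space"
  assumes "r > 0"
  obtains \<eta> :: "'a \<Rightarrow> real" where "smooth \<eta>" "\<And>x. 0 \<le> \<eta> x" "\<And>x. \<eta> x \<le> 1"
    "\<And>x. dist p x \<le> r / 2 \<Longrightarrow> \<eta> x = 1" "\<And>x. x \<notin> cball p r \<Longrightarrow> \<eta> x = 0"
proof
  \<comment> \<open>The squared distance, unlike the distance, is smooth. The factor is normalised
    to give 1 at distance \<open>r / 2\<close>, because
    \<open>r\<^sup>2 - (r / 2)\<^sup>2 = 3 / 4 * r\<^sup>2\<close>; at distance \<open>r\<close> the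
    value is 0.\<close>
  let ?t = "\<lambda>x. (4 / (3 * r\<^sup>2)) * (r\<^sup>2 - (x - p) \<bullet> (x - p))"
  show "smooth (\<lambda>x. sstep (?t x))"
    by (rule smooth_real_compose[OF smooth_sstep]) (intro smooth_intros)
  show "0 \<le> sstep (?t x)" "sstep (?t x) \<le> 1" for x
    by (rule sstep_nonneg, rule sstep_le_1)
  have d: "(x - p) \<bullet> (x - p) = (dist p x)\<^sup>2" for x
    unfolding dist_norm norm_minus_commute[of p] power2_norm_eq_inner ..
  show "sstep (?t x) = 1" if "dist p x \<le> r / 2" for x
  proof (rule sstep_eq_1)
    have "(dist p x)\<^sup>2 \<le> (r / 2)\<^sup>2" using that by (intro power_mono) auto
    then have "(4 / (3 * r\<^sup>2)) * (3 / 4 * r\<^sup>2) \<le> ?t x"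
      unfolding d by (intro mult_left_mono) (auto simp: power_divide)
    moreover have "(4 / (3 * r\<^sup>2)) * (3 / 4 * r\<^sup>2) = 1" using \<open>r > 0\<close> by simp
    ultimately show "1 \<le> ?t x" by linarith
  qed
  show "sstep (?t x) = 0" if "x \<notin> cball p r" for x
  proof (rule sstep_eq_0)
    have "r\<^sup>2 \<le> (dist p x)\<^sup>2" using that \<open>r > 0\<close> by (intro power_mono) auto
    then show "?t x \<le> 0" unfolding d by (intro mult_nonneg_nonpos) auto
  qed
qed

lemma smooth_prod: 
  fixes f :: "'i \<Rightarrow> 'a::euclidean_space \<Rightarrow> real"
  shows "(\<And>i. i \<in> I \<Longrightarrow> smooth (f i)) \<Longrightarrow> smooth (\<lambda>x. \<Prod>i\<in>I. f i x)"
  by (induction I rule: infinite_finite_induct) (auto intro: smooth_const smooth_mult)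

text \<open>Approximates the indicator of the open box from inside: the transition layers at the
  faces have width \<open>1 / n\<close>, and the function vanishes outside the box for every
  \<open>n\<close>.\<close>

definition box_bump :: "'a::euclidean_space \<Rightarrow> 'a \<Rightarrow> nat \<Rightarrow> 'a \<Rightarrow> real" where
  "box_bump a c n x = (\<Prod>b\<in>Basis. sstep (real n * (x \<bullet> b - a \<bullet> b)) * sstep (real n * (c \<bullet> b - x \<bullet> b)))"

lemma smooth_box_bump: "smooth (box_bump a c n)"
  unfolding box_bump_def[abs_def]
  by (rule smooth_prod, rule smooth_mult; rule smooth_real_compose[OF smooth_sstep])
    (intro smooth_mult smooth_diff smooth_const smooth_inner_const smooth_ident)+

lemma box_bump_eq_0:
  assumes "x \<notin> box a c"
  shows "box_bump a c n x = 0"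
proof -
  obtain b where b: "b \<in> Basis" "x \<bullet> b \<le> a \<bullet> b \<or> c \<bullet> b \<le> x \<bullet> b"
    using assms by (auto simp: mem_box not_less)
  then have "sstep (real n * (x \<bullet> b - a \<bullet> b)) * sstep (real n * (c \<bullet> b - x \<bullet> b)) = 0"
    by (auto intro!: sstep_eq_0 simp: mult_le_0_iff)
  then show ?thesis unfolding box_bump_def using b(1) by (intro prod_zero) auto
qed

lemma box_bump_bounds: "0 \<le> box_bump a c n x" "box_bump a c n x \<le> 1"
  unfolding box_bump_def
  by (intro prod_nonneg mult_nonneg_nonneg sstep_nonneg ballI)
    (intro prod_le_1 conjI mult_nonneg_nonneg sstep_nonneg mult_le_one sstep_le_1)

lemma box_bump_tendsto: "(\<lambda>n. box_bump a c n x) \<longlonglongrightarrow> indicator (box a c) x"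
proof (cases "x \<in> box a c")
  case True
  have s: "(\<lambda>n. sstep (real n * t)) \<longlonglongrightarrow> 1" if t: "t > 0" for t
  proof (rule tendsto_eventually)
    obtain N where N: "1 < real N * t" using reals_Archimedean3[OF t] by metis
    have "sstep (real n * t) = 1" if "n \<ge> N" for n
    proof (rule sstep_eq_1)
      have "real N * t \<le> real n * t" using that \<open>t > 0\<close> by simp
      then show "1 \<le> real n * t" using N by linarith
    qed
    then show "\<forall>\<^sub>F n in sequentially. sstep (real n * t) = 1"
      unfolding eventually_sequentially by blast
  qed
  have "(\<lambda>n. box_bump a c n x) \<longlonglongrightarrow> (\<Prod>b\<in>(Basis :: 'a set). 1 * 1)"
    unfolding box_bump_def using True by (intro tendsto_prod tendsto_mult s) (auto simp: mem_box)
  then show ?thesis using True by simp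
next
  case False then show ?thesis by (simp add: box_bump_eq_0)
qed

section \<open>Integration by parts\<close>

lemma test_integrable:
  assumes "\<phi> \<in> test_functions \<omega>"
  shows "integrable lborel \<phi>"
proof -
  obtain K where K: "smooth \<phi>" "compact K" "\<forall>x. x \<notin> K \<longrightarrow> \<phi> x = 0"
    using assms by (auto elim: test_functionsE)
  have "integrable lborel (\<lambda>x. indicator K x *\<^sub>R \<phi> x)"
    by (rule borel_integrable_compact[OF K(2) smooth_continuous[OF K(1)]])
  moreover have "(\<lambda>x. indicator K x *\<^sub>R \<phi> x) = \<phi>"
    using K(3) by (auto simp: indicator_def fun_eq_iff)
  ultimately show ?thesis by simp
qed

lemma test_bounded:
  assumes "\<phi> \<in> test_functions \<omega>"
  obtains B where "B \<ge> 0" "\<And>x. norm (\<phi> x) \<le> B"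
proof -
  obtain K where K: "smooth \<phi>" "compact K" "\<forall>x. x \<notin> K \<longrightarrow> \<phi> x = 0"
    using assms by (auto elim: test_functionsE)
  have "bounded (\<phi> ` K)"
    by (rule compact_imp_bounded[OF compact_continuous_image[OF smooth_continuous[OF K(1)] K(2)]])
  then obtain B where B: "B > 0" "\<And>y. y \<in> \<phi> ` K \<Longrightarrow> norm y \<le> B" by (auto simp: bounded_pos)
  have "norm (\<phi> x) \<le> B" for x using B K(3) by (cases "x \<in> K") auto
  with B(1) show thesis using that[of B] by auto
qed

lemma smooth_lebesgue_measurable: "smooth f \<Longrightarrow> f \<in> borel_measurable (lebesgue_on \<omega>)"
  by (intro measurable_restrict_space1 measurable_completion) (simp add: smooth_measurable)

lemma test_in_L2:
  fixes \<phi> :: "'a::euclidean_space \<Rightarrow> 'b::euclidean_space"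
  assumes "\<phi> \<in> test_functions \<omega>'" "\<omega> \<in> sets lebesgue"
  shows "\<phi> \<in> L2_space \<omega>"
proof -
  have s: "smooth \<phi>" using assms by (simp add: test_smooth)
  have "(\<lambda>x. \<phi> x \<bullet> \<phi> x) \<in> test_functions \<omega>'"
    using assms(1) by (elim test_functionsE, intro test_functionsI) (auto intro: smooth_inner)
  then have "integrable lebesgue (\<lambda>x. (norm (\<phi> x))\<^sup>2)"
    using test_integrable by (auto simp: power2_norm_eq_inner intro!: integrable_completion[THEN iffD2]
        borel_measurable_integrable)
  then have "integrable (lebesgue_on \<omega>) (\<lambda>x. (norm (\<phi> x))\<^sup>2)"
    using assms(2) by (subst integrable_restrict_space) (simp, rule integrable_mult_indicator)
  then show ?thesis
    using smooth_lebesgue_measurable[OF s] by (simp add: L2_space_def)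
qed

lemma L2_inner_UNIV:
  fixes f g :: "'a::euclidean_space \<Rightarrow> 'b::euclidean_space"
  assumes "\<omega> \<in> sets lebesgue" "\<And>x. x \<notin> \<omega> \<Longrightarrow> f x \<bullet> g x = 0"
  shows "L2_inner \<omega> f g = (\<integral>x. f x \<bullet> g x \<partial>lebesgue)"
proof -
  have "(\<lambda>x. indicator \<omega> x *\<^sub>R (f x \<bullet> g x)) = (\<lambda>x. f x \<bullet> g x)"
    using assms(2) by (auto simp: indicator_def fun_eq_iff)
  then show ?thesis
    unfolding L2_inner_def using assms(1) by (subst integral_restrict_space) simp_all
qed

lemma lborel_translate:
  fixes f :: "'a::euclidean_space \<Rightarrow> 'b::euclidean_space"
  assumes "f \<in> borel_measurable borel"
  shows "integrable lborel (\<lambda>x. f (x + c)) \<longleftrightarrow> integrable lborel f"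
    and "(\<integral>x. f (x + c) \<partial>lborel) = (\<integral>x. f x \<partial>lborel)"
proof -
  have "distr lborel borel (\<lambda>x. x + c) = lborel"
    using lborel_distr_plus[of c] by (simp only: add.commute[of _ c])
  moreover have "integrable (distr lborel borel (\<lambda>x. x + c)) f \<longleftrightarrow> integrable lborel (\<lambda>x. f (x + c))"
    by (rule integrable_distr_eq) (use assms in auto)
  moreover have "(\<integral>x. f x \<partial>distr lborel borel (\<lambda>x. x + c)) = (\<integral>x. f (x + c) \<partial>lborel)"
    by (rule integral_distr) (use assms in auto)
  ultimately show "integrable lborel (\<lambda>x. f (x + c)) \<longleftrightarrow> integrable lborel f"
    and "(\<integral>x. f (x + c) \<partial>lborel) = (\<integral>x. f x \<partial>lborel)" by simp_all
qed

text \<open>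
  The integral of a translate of \<open>F\<close> does not depend on the translation; differentiate under the
  integral.
\<close>

lemma integral_dird_zero:
  fixes F :: "'a::euclidean_space \<Rightarrow> real"
  assumes "F \<in> test_functions \<omega>"
  shows "(\<integral>x. dird v F x \<partial>lborel) = 0"
proof -
  obtain K where K: "smooth F" "compact K" "\<forall>x. x \<notin> K \<longrightarrow> F x = 0"
    using assms by (auto elim: test_functionsE)
  obtain B where B: "B \<ge> 0" "\<And>x. norm (dird v F x) \<le> B"
    using test_bounded[OF dird_test[OF assms]] by metis
  obtain R where R: "R > 0" "K \<subseteq> ball 0 R" using compact_imp_bounded[OF K(2)] bounded_subset_ballD by blast
  let ?q = "\<lambda>n x. real (Suc n) * (F (x + (1 / real (Suc n)) *\<^sub>R v) - F x)"
  have line: "((\<lambda>t. F (x + t *\<^sub>R v)) has_real_derivative dird v F (x + t *\<^sub>R v)) (at t)" for x t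
  proof -
    have "((\<lambda>t. x + t *\<^sub>R v) has_derivative (\<lambda>h. h *\<^sub>R v)) (at t)"
      by (auto intro!: derivative_eq_intros)
    from has_derivative_compose[OF this smooth_derivative(1)[OF K(1)]]
    have "((\<lambda>t. F (x + t *\<^sub>R v)) has_derivative (\<lambda>h. dird (h *\<^sub>R v) F (x + t *\<^sub>R v))) (at t)" .
    then show ?thesis
      unfolding has_field_derivative_def
      by (rule has_derivative_eq_rhs) (simp add: fun_eq_iff linear_cmul[OF dird_linear[OF K(1)]])
  qed
  have lim: "(\<lambda>n. ?q n x) \<longlonglongrightarrow> dird v F x" for x
  proof -
    have "((\<lambda>h. (F (x + h *\<^sub>R v) - F x) / h) \<longlongrightarrow> dird v F x) (at 0)"
      using line[of x 0] by (simp add: DERIV_def)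
    moreover have "filterlim (\<lambda>n. 1 / real (Suc n)) (at 0) sequentially"
      using LIMSEQ_Suc[OF lim_inverse_n'] by (auto simp: filterlim_at simp del: of_nat_Suc)
    ultimately have "((\<lambda>n. (F (x + (1 / real (Suc n)) *\<^sub>R v) - F x) / (1 / real (Suc n))) \<longlongrightarrow> dird v F x) sequentially"
      by (rule filterlim_compose)
    then show ?thesis by (simp add: mult.commute)
  qed
  \<comment> \<open>Domination: the mean value theorem bounds the quotient by \<open>B\<close>, and
    since the step lengths are at most 1 it vanishes off the ball enlarged by
    \<open>norm v\<close>.\<close>
  have bound: "norm (?q n x) \<le> B * indicator (cball 0 (R + norm v)) x" for n x
  proof (cases "x \<in> cball 0 (R + norm v)")
    case True
    have "\<exists>z. 0 < z \<and> z < 1 / real (Suc n) \<and> F (x + (1 / real (Suc n)) *\<^sub>R v) - F (x + 0 *\<^sub>R v)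
       = (1 / real (Suc n) - 0) * dird v F (x + z *\<^sub>R v)"
      by (rule MVT2[of 0 "1 / real (Suc n)" "\<lambda>t. F (x + t *\<^sub>R v)" "\<lambda>z. dird v F (x + z *\<^sub>R v)"])
        (auto intro: line)
    then obtain z where "F (x + (1 / real (Suc n)) *\<^sub>R v) - F x = (1 / real (Suc n)) * dird v F (x + z *\<^sub>R v)"
      by auto
    then have "?q n x = dird v F (x + z *\<^sub>R v)" by simp
    then show ?thesis using B(2)[of "x + z *\<^sub>R v"] True by simp
  next
    case False
    have "1 / real (Suc n) * norm v \<le> 1 * norm v" by (rule mult_right_mono) auto
    then have "norm ((1 / real (Suc n)) *\<^sub>R v) \<le> norm v" by simp
    then have "norm (x + (1 / real (Suc n)) *\<^sub>R v) > R"
      using False norm_triangle_ineq2[of x "- ((1 / real (Suc n)) *\<^sub>R v)"] by (simp add: not_le)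
    moreover have "norm x > R + norm v" using False by (simp add: not_le)
    then have "norm x > R" using norm_ge_zero[of v] by linarith
    ultimately have "x + (1 / real (Suc n)) *\<^sub>R v \<notin> K" "x \<notin> K" using R(2) by auto
    then have "?q n x = 0" using K(3) by simp
    then show ?thesis using B(1) by (simp add: indicator_def)
  qed
  have [measurable]: "F \<in> borel_measurable borel" "dird v F \<in> borel_measurable borel"
    using K(1) by (auto intro: smooth_measurable smooth_derivative)
  have "(\<lambda>n. \<integral>x. ?q n x \<partial>lborel) \<longlonglongrightarrow> (\<integral>x. dird v F x \<partial>lborel)"
  proof (rule integral_dominated_convergence)
    show "integrable lborel (\<lambda>x. B * indicator (cball 0 (R + norm v)) x)"
      by (intro integrable_mult_right integrable_real_indicator) (auto intro: emeasure_lborel_cball_finite[unfolded infinity_ennreal_def])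
  qed (use lim bound in auto)
  moreover have "(\<integral>x. ?q n x \<partial>lborel) = 0" for n
  proof -
    have i: "integrable lborel F" by (rule test_integrable[OF assms])
    then show ?thesis using lborel_translate[of F "(1 / real (Suc n)) *\<^sub>R v"] by simp
  qed
  ultimately show ?thesis by (simp only: LIMSEQ_const_iff)
qed


lemma integral_lborel_lebesgue:
  fixes f :: "'a::euclidean_space \<Rightarrow> 'b::euclidean_space"
  assumes "f \<in> borel_measurable borel"
  shows "(\<integral>x. f x \<partial>lebesgue) = (\<integral>x. f x \<partial>lborel)"
  by (rule integral_completion) (use assms in simp)

lemma integral_divg_zero:
  assumes "F \<in> test_functions \<omega>"
  shows "(\<integral>x. divg F x \<partial>lborel) = 0"
proof -
  have t: "(\<lambda>x. F x \<bullet> b) \<in> test_functions \<omega>" for b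
    by (rule test_linear_compose[OF bounded_linear_inner_left assms])
  have "dird b F x \<bullet> b = dird b (\<lambda>x. F x \<bullet> b) x" for b x
    by (rule dird_bounded_linear[OF bounded_linear_inner_left test_smooth[OF assms], symmetric])
  then have "(\<integral>x. divg F x \<partial>lborel) = (\<integral>x. (\<Sum>b\<in>Basis. dird b (\<lambda>x. F x \<bullet> b) x) \<partial>lborel)"
    by (simp add: divg_eq)
  also have "\<dots> = (\<Sum>b\<in>Basis. (\<integral>x. dird b (\<lambda>x. F x \<bullet> b) x \<partial>lborel))"
    by (rule Bochner_Integration.integral_sum) (rule test_integrable[OF dird_test[OF t]])
  also have "\<dots> = 0" using integral_dird_zero[OF t] by simp
  finally show ?thesis .
qed

lemma divg_scaleR:
  assumes "smooth \<psi>" "smooth \<phi>"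
  shows "divg (\<lambda>x. \<psi> x *\<^sub>R \<phi> x) x = \<psi> x * divg \<phi> x + grad \<psi> x \<bullet> \<phi> x"
proof -
  have "divg (\<lambda>x. \<psi> x *\<^sub>R \<phi> x) x = (\<Sum>b\<in>Basis. \<psi> x * (dird b \<phi> x \<bullet> b) + dird b \<psi> x * (\<phi> x \<bullet> b))"
    by (simp add: divg_eq dird_scaleR[OF assms] inner_add_left)
  also have "\<dots> = \<psi> x * divg \<phi> x + grad \<psi> x \<bullet> \<phi> x"
    by (simp add: divg_eq grad_eq sum.distrib sum_distrib_left inner_sum_left inner_commute[of "\<phi> x"])
  finally show ?thesis .
qed

text \<open>The divergence of the product integrates to zero. Compact support of either factor is
  enough, because off the compact set that factor vanishes together with its derivatives.\<close>

lemma integral_by_parts_test: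
  fixes \<phi> :: "'a::euclidean_space \<Rightarrow> 'a"
  assumes \<omega>: "\<omega> \<in> sets lebesgue" and s: "smooth \<phi>" "smooth \<psi>"
    and t: "\<phi> \<in> test_functions \<omega> \<or> \<psi> \<in> test_functions \<omega>"
  shows "L2_inner \<omega> \<phi> (grad \<psi>) = - L2_inner \<omega> (divg \<phi>) \<psi>"
proof -
  obtain K where K: "compact K" "K \<subseteq> \<omega>" and z: "(\<forall>x. x \<notin> K \<longrightarrow> \<phi> x = 0) \<or> (\<forall>x. x \<notin> K \<longrightarrow> \<psi> x = 0)"
    using t by (metis test_functionsE)
  have z': "\<phi> x = 0 \<and> divg \<phi> x = 0 \<or> \<psi> x = 0 \<and> grad \<psi> x = 0" if "x \<notin> K" for x
    using z
  proof
    assume a: "\<forall>x. x \<notin> K \<longrightarrow> \<phi> x = 0"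
    then have "dird v \<phi> x = 0" for v by (intro dird_zero_off_support[OF K(1) _ that]) auto
    with a that show ?thesis by (simp add: divg_eq)
  next
    assume a: "\<forall>x. x \<notin> K \<longrightarrow> \<psi> x = 0"
    then have "dird v \<psi> x = 0" for v by (intro dird_zero_off_support[OF K(1) _ that]) auto
    with a that show ?thesis by (simp add: grad_eq)
  qed
  have z'': "\<psi> x * divg \<phi> x = 0" "grad \<psi> x \<bullet> \<phi> x = 0" "\<psi> x *\<^sub>R \<phi> x = 0" if "x \<notin> K" for x
    using z'[OF that] by auto
  have i1: "(\<lambda>x. \<psi> x * divg \<phi> x) \<in> test_functions \<omega>"
    by (rule test_functionsI[OF _ K]) (use s z'' in \<open>auto intro!: smooth_mult smooth_divg\<close>)
  have i2: "(\<lambda>x. grad \<psi> x \<bullet> \<phi> x) \<in> test_functions \<omega>"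
    by (rule test_functionsI[OF _ K]) (use s z'' in \<open>auto intro!: smooth_inner smooth_grad\<close>)
  have F: "(\<lambda>x. \<psi> x *\<^sub>R \<phi> x) \<in> test_functions \<omega>"
    by (rule test_functionsI[OF _ K]) (use s z'' in \<open>auto intro!: smooth_scaleR\<close>)
  have "0 = (\<integral>x. \<psi> x * divg \<phi> x + grad \<psi> x \<bullet> \<phi> x \<partial>lborel)"
    using integral_divg_zero[OF F] by (simp add: divg_scaleR[OF s(2,1)])
  also have "\<dots> = (\<integral>x. \<psi> x * divg \<phi> x \<partial>lborel) + (\<integral>x. grad \<psi> x \<bullet> \<phi> x \<partial>lborel)"
    by (rule Bochner_Integration.integral_add) (intro test_integrable[OF i1] test_integrable[OF i2])+
  finally have e: "(\<integral>x. grad \<psi> x \<bullet> \<phi> x \<partial>lborel) = - (\<integral>x. \<psi> x * divg \<phi> x \<partial>lborel)" by simp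
  have "L2_inner \<omega> \<phi> (grad \<psi>) = (\<integral>x. grad \<psi> x \<bullet> \<phi> x \<partial>lebesgue)"
    using z'' K(2) by (subst L2_inner_UNIV[OF \<omega>]) (auto simp: inner_commute)
  moreover have "L2_inner \<omega> (divg \<phi>) \<psi> = (\<integral>x. \<psi> x * divg \<phi> x \<partial>lebesgue)"
    using z'' K(2) by (subst L2_inner_UNIV[OF \<omega>]) (auto simp: mult.commute)
  ultimately show ?thesis
    using e integral_lborel_lebesgue[OF smooth_measurable[OF test_smooth[OF i1]]]
      integral_lborel_lebesgue[OF smooth_measurable[OF test_smooth[OF i2]]] by simp
qed

section \<open>The fundamental lemma of the calculus of variations\<close>

lemma box_bump_test:
  assumes "cbox a c \<subseteq> \<omega>"
  shows "box_bump a c n \<in> test_functions \<omega>"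
proof (rule test_functionsI[OF smooth_box_bump compact_cbox assms])
  fix x assume "x \<notin> cbox a c"
  then have "x \<notin> box a c" using box_subset_cbox by blast
  then show "box_bump a c n x = 0" by (rule box_bump_eq_0)
qed

lemma const_in_L2:
  assumes "S \<in> lmeasurable"
  shows "(\<lambda>x. e) \<in> L2_space S"
proof -
  interpret finite_measure "lebesgue_on S" using assms by (rule finite_measure_lebesgue_on)
  show ?thesis by (simp add: L2_space_def)
qed

text \<open>Bumps times a constant vector are test functions, and dominated convergence replaces
  them by the indicator of the box.\<close>

lemma integral_box_zero:
  fixes g :: "'a::euclidean_space \<Rightarrow> 'b::euclidean_space"
  assumes \<omega>: "\<omega> \<in> sets lebesgue" and sub: "cbox a c \<subseteq> \<omega>" and g: "g \<in> L2_space \<omega>"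
    and z: "\<And>\<phi>. \<phi> \<in> test_functions \<omega> \<Longrightarrow> L2_inner \<omega> g \<phi> = 0"
  shows "(\<integral>x. indicator (box a c) x * (g x \<bullet> e) \<partial>lebesgue) = 0"
proof -
  have gQ: "g \<in> L2_space (cbox a c)" using L2_space_subset[OF g sub] \<omega> by simp
  have eQ: "(\<lambda>x. e) \<in> L2_space (cbox a c)"
    by (rule const_in_L2) simp
  have iQ: "integrable lebesgue (\<lambda>x. indicator (cbox a c) x * (g x \<bullet> e))"
    using integrable_L2_inner[OF gQ eQ] by (simp add: integrable_restrict_space)
  note mQ = borel_measurable_integrable[OF iQ]
  \<comment> \<open>The bump vanishes off the box, so the indicator of the closed box can be
    inserted freely; it provides an integrable majorant on the whole space.\<close>
  have eq: "box_bump a c n x * (indicator (cbox a c) x * (g x \<bullet> e)) = g x \<bullet> (box_bump a c n x *\<^sub>R e)" for n x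
    using box_bump_eq_0[of x a c n] box_subset_cbox[of a c] by (auto simp: indicator_def)
  have "(\<lambda>n. \<integral>x. box_bump a c n x * (indicator (cbox a c) x * (g x \<bullet> e)) \<partial>lebesgue)
    \<longlonglongrightarrow> (\<integral>x. indicator (box a c) x * (indicator (cbox a c) x * (g x \<bullet> e)) \<partial>lebesgue)"
  proof (rule integral_dominated_convergence[OF _ _ iQ[THEN integrable_norm]])
    show "(\<lambda>x. indicator (box a c) x * (indicator (cbox a c) x * (g x \<bullet> e))) \<in> borel_measurable lebesgue"
      by (intro borel_measurable_times[OF _ mQ] borel_measurable_indicator) simp
    show "(\<lambda>x. box_bump a c n x * (indicator (cbox a c) x * (g x \<bullet> e))) \<in> borel_measurable lebesgue" for n
      using smooth_measurable[OF smooth_box_bump[of a c n]]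
      by (intro borel_measurable_times[OF _ mQ] measurable_completion) simp
    show "AE x in lebesgue. (\<lambda>n. box_bump a c n x * (indicator (cbox a c) x * (g x \<bullet> e)))
      \<longlonglongrightarrow> indicator (box a c) x * (indicator (cbox a c) x * (g x \<bullet> e))"
      by (intro AE_I2 tendsto_mult box_bump_tendsto tendsto_const)
    show "AE x in lebesgue. norm (box_bump a c n x * (indicator (cbox a c) x * (g x \<bullet> e)))
      \<le> norm (indicator (cbox a c) x * (g x \<bullet> e))" for n
      using box_bump_bounds[of a c n] by (intro AE_I2) (simp add: abs_mult mult_left_le_one_le)
  qed
  moreover have "(\<integral>x. box_bump a c n x * (indicator (cbox a c) x * (g x \<bullet> e)) \<partial>lebesgue) = 0" for n
  proof -
    have t: "(\<lambda>x. box_bump a c n x *\<^sub>R e) \<in> test_functions \<omega>"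
      by (rule test_scaleR_left[OF box_bump_test[OF sub] smooth_const])
    have "L2_inner \<omega> g (\<lambda>x. box_bump a c n x *\<^sub>R e) = (\<integral>x. g x \<bullet> (box_bump a c n x *\<^sub>R e) \<partial>lebesgue)"
    proof (rule L2_inner_UNIV[OF \<omega>])
      fix x assume "x \<notin> \<omega>"
      then have "x \<notin> box a c" using sub box_subset_cbox by blast
      then show "g x \<bullet> (box_bump a c n x *\<^sub>R e) = 0" by (simp add: box_bump_eq_0)
    qed
    then show ?thesis using z[OF t] by (simp only: eq)
  qed
  moreover have "indicator (box a c) x * (indicator (cbox a c) x * (g x \<bullet> e)) = indicator (box a c) x * (g x \<bullet> e)" for x
    using box_subset_cbox[of a c] by (auto simp: indicator_def)
  ultimately show ?thesis by (simp only: LIMSEQ_const_iff)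
qed

text \<open>By the Lebesgue differentiation theorem almost every value is a limit of averages over
  shrinking cubes, and these vanish. The argument is localised because integrability is assumed only
  on closed boxes inside \<open>\<omega>\<close>.\<close>

lemma AE_zero_if_box_integrals_zero:
  fixes f :: "'a::euclidean_space \<Rightarrow> real"
  assumes "open \<omega>" and i: "\<And>a c. cbox a c \<subseteq> \<omega> \<Longrightarrow> integrable lebesgue (\<lambda>x. indicator (cbox a c) x * f x)"
    and z: "\<And>a c. cbox a c \<subseteq> \<omega> \<Longrightarrow> (\<integral>x. indicator (box a c) x * f x \<partial>lebesgue) = 0"
  shows "negligible {x \<in> \<omega>. f x \<noteq> 0}"
proof (subst locally_negligible_alt, rule ballI)
  fix p assume p: "p \<in> {x \<in> \<omega>. f x \<noteq> 0}"
  from p have "p \<in> \<omega>" by simp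
  obtain a c where Q: "p \<in> box a c" "cbox a c \<subseteq> \<omega>"
    using open_contains_cbox[OF \<open>open \<omega>\<close> \<open>p \<in> \<omega>\<close>] by metis
  define h where "h x = indicator (cbox a c) x * f x" for x
  have hi: "h absolutely_integrable_on UNIV"
    using i[OF Q(2)] by (simp add: h_def[abs_def] set_integrable_def)
  have "h integrable_on cbox s t" for s t
    by (rule integrable_on_subcbox[OF set_lebesgue_integral_eq_integral(1)[OF hi]]) simp
  then obtain N where N: "negligible N" and
    L: "\<And>x e. \<lbrakk>x \<notin> N; 0 < e\<rbrakk> \<Longrightarrow> \<exists>d>0. \<forall>s. 0 < s \<and> s < d \<longrightarrow>
        norm (integral (cbox x (x + s *\<^sub>R One)) h /\<^sub>R s ^ DIM('a) - h x) < e"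
    using integrable_ccontinuous_explicit[of h] by metis
  have "f x = 0" if x: "x \<in> box a c" "x \<notin> N" for x
  proof (rule ccontr)
    assume "f x \<noteq> 0"
    have hx: "h x = f x" using x box_subset_cbox[of a c] by (auto simp: h_def)
    obtain d where d: "d > 0" "\<And>s. 0 < s \<Longrightarrow> s < d \<Longrightarrow>
        norm (integral (cbox x (x + s *\<^sub>R One)) h /\<^sub>R s ^ DIM('a) - f x) < \<bar>f x\<bar>"
      using L[OF x(2), of "\<bar>f x\<bar>"] \<open>f x \<noteq> 0\<close> hx by auto
    obtain r where r: "r > 0" "ball x r \<subseteq> box a c"
      using x(1) open_box[of a c] by (meson openE)
    \<comment> \<open>The first bound serves the differentiation theorem. The second keeps the cube
      in the ball, since its points are at most \<open>DIM('a) * s\<close> away from the corner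
      \<open>x\<close>.\<close>
    define s where "s = min (d / 2) (r / (2 * DIM('a)))"
    have s: "s > 0" "s < d" using d(1) r(1) by (auto simp: s_def min_def)
    have cs: "cbox x (x + s *\<^sub>R One) \<subseteq> box a c"
    proof
      fix y assume y: "y \<in> cbox x (x + s *\<^sub>R One)"
      have "norm (y - x) \<le> (\<Sum>b\<in>Basis. \<bar>(y - x) \<bullet> b\<bar>)" by (rule norm_le_l1)
      also have "\<dots> \<le> (\<Sum>b\<in>(Basis::'a set). s)"
        using y by (intro sum_mono) (auto simp: mem_box inner_diff_left inner_add_left)
      also have "\<dots> = DIM('a) * s" by simp
      also have "\<dots> \<le> r / 2" using r(1) by (simp add: s_def min_def field_simps)
      also have "\<dots> < r" using r(1) by simp
      finally have "y \<in> ball x r" by (simp add: dist_norm norm_minus_commute)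
      then show "y \<in> box a c" using r(2) by blast
    qed
    have csQ: "cbox x (x + s *\<^sub>R One) \<subseteq> cbox a c" using cs box_subset_cbox by blast
    have "integral (cbox x (x + s *\<^sub>R One)) h = (\<integral>y. indicator (cbox x (x + s *\<^sub>R One)) y *\<^sub>R h y \<partial>lebesgue)"
      using set_lebesgue_integral_eq_integral(2)[OF set_integrable_subset[OF hi, of "cbox x (x + s *\<^sub>R One)"]]
      by (simp add: set_lebesgue_integral_def)
    \<comment> \<open>The differentiation theorem speaks of closed cubes, the hypothesis of open
      ones; the faces form a null set.\<close>
    also have "\<dots> = (\<integral>y. indicator (box x (x + s *\<^sub>R One)) y * f y \<partial>lebesgue)"
    proof (rule integral_cong_AE)
      have "h \<in> borel_measurable lebesgue" using i[OF Q(2)] by (simp add: h_def[abs_def])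
      then show "(\<lambda>y. indicator (cbox x (x + s *\<^sub>R One)) y *\<^sub>R h y) \<in> borel_measurable lebesgue"
        by (intro borel_measurable_scaleR borel_measurable_indicator) auto
      have "(\<lambda>y. indicator (box x (x + s *\<^sub>R One)) y * h y) \<in> borel_measurable lebesgue"
        using \<open>h \<in> borel_measurable lebesgue\<close> by (intro borel_measurable_times borel_measurable_indicator) auto
      moreover have "indicator (box x (x + s *\<^sub>R One)) y * h y = indicator (box x (x + s *\<^sub>R One)) y * f y" for y
        using csQ box_subset_cbox[of x "x + s *\<^sub>R One"] by (auto simp: h_def indicator_def)
      ultimately show "(\<lambda>y. indicator (box x (x + s *\<^sub>R One)) y * f y) \<in> borel_measurable lebesgue"
        by simp
      have "negligible (cbox x (x + s *\<^sub>R One) - box x (x + s *\<^sub>R One))"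
        by (rule negligible_frontier_interval)
      then have "AE y in lebesgue. y \<notin> cbox x (x + s *\<^sub>R One) - box x (x + s *\<^sub>R One)"
        unfolding negligible_iff_null_sets by (rule AE_not_in)
      then show "AE y in lebesgue. indicator (cbox x (x + s *\<^sub>R One)) y *\<^sub>R h y
          = indicator (box x (x + s *\<^sub>R One)) y * f y"
        by (rule AE_mp, intro AE_I2)
          (use csQ box_subset_cbox[of x "x + s *\<^sub>R One"] in \<open>auto simp: h_def indicator_def\<close>)
    qed
    also have "\<dots> = 0" using csQ Q(2) by (intro z) blast
    finally show False using d(2)[OF s] by simp
  qed
  then have "{x \<in> \<omega>. f x \<noteq> 0} \<inter> box a c \<subseteq> N" by blast
  then have "negligible ({x \<in> \<omega>. f x \<noteq> 0} \<inter> box a c)" using N negligible_subset by blast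
  then show "\<exists>U. openin (top_of_set {x \<in> \<omega>. f x \<noteq> 0}) U \<and> p \<in> U \<and> negligible U"
    using Q(1) p by (intro exI[of _ "{x \<in> \<omega>. f x \<noteq> 0} \<inter> box a c"]) (auto simp: openin_open)
qed

lemma fundamental_lemma:
  fixes g :: "'a::euclidean_space \<Rightarrow> 'b::euclidean_space"
  assumes \<omega>: "open \<omega>" and g: "g \<in> L2_space \<omega>"
    and z: "\<And>\<phi>. \<phi> \<in> test_functions \<omega> \<Longrightarrow> L2_inner \<omega> g \<phi> = 0"
  shows "AE x in lebesgue_on \<omega>. g x = 0"
proof -
  have \<omega>s: "\<omega> \<in> sets lebesgue" using \<omega> by (auto intro: sets_completionI_sets)
  have "negligible {x \<in> \<omega>. g x \<bullet> e \<noteq> 0}" for e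
  proof (rule AE_zero_if_box_integrals_zero[OF \<omega>])
    fix a c :: 'a assume sub: "cbox a c \<subseteq> \<omega>"
    show "(\<integral>x. indicator (box a c) x * (g x \<bullet> e) \<partial>lebesgue) = 0"
      by (rule integral_box_zero[OF \<omega>s sub g z])
    have gQ: "g \<in> L2_space (cbox a c)" using L2_space_subset[OF g sub] \<omega>s by simp
    have eQ: "(\<lambda>x. e) \<in> L2_space (cbox a c)"
      by (rule const_in_L2) simp
    show "integrable lebesgue (\<lambda>x. indicator (cbox a c) x * (g x \<bullet> e))"
      using integrable_L2_inner[OF gQ eQ] by (simp add: integrable_restrict_space)
  qed
  then have "negligible (\<Union>e\<in>Basis. {x \<in> \<omega>. g x \<bullet> e \<noteq> 0})" by (intro negligible_Union) auto
  moreover have "(\<Union>e\<in>Basis. {x \<in> \<omega>. g x \<bullet> e \<noteq> 0}) = {x \<in> \<omega>. g x \<noteq> 0}"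
    using euclidean_all_zero_iff[of "g _"] by blast
  ultimately have N: "{x \<in> \<omega>. g x \<noteq> 0} \<in> null_sets lebesgue"
    by (simp only: negligible_iff_null_sets)
  have "AE x in lebesgue. x \<in> \<omega> \<longrightarrow> g x = 0"
    by (rule AE_mp[OF AE_not_in[OF N]]) (intro AE_I2, simp)
  then show ?thesis using \<omega>s by (simp add: AE_restrict_space_iff)
qed

section \<open>Weak derivatives\<close>

lemma open_lebesgue: "open \<omega> \<Longrightarrow> \<omega> \<in> sets lebesgue"
  by (auto intro: sets_completionI_sets)

lemma L2_eq_AE:
  fixes g h :: "'a::euclidean_space \<Rightarrow> 'b::euclidean_space"
  assumes \<omega>: "open \<omega>" and g: "g \<in> L2_space \<omega>" and h: "h \<in> L2_space \<omega>"
    and eq: "\<And>\<phi>. \<phi> \<in> test_functions \<omega> \<Longrightarrow> L2_inner \<omega> g \<phi> = L2_inner \<omega> h \<phi>"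
  shows "AE x in lebesgue_on \<omega>. g x = h x"
proof -
  have "AE x in lebesgue_on \<omega>. g x - h x = 0"
  proof (rule fundamental_lemma[OF \<omega> diff_in_L2[OF g h]])
    fix \<phi> :: "'a \<Rightarrow> 'b" assume t: "\<phi> \<in> test_functions \<omega>"
    show "L2_inner \<omega> (\<lambda>x. g x - h x) \<phi> = 0"
      using L2_inner_diff_left[OF g h test_in_L2[OF t open_lebesgue[OF \<omega>]]] eq[OF t] by simp
  qed
  then show ?thesis by simp
qed

lemma weak_divD:
  assumes "weak_div \<omega> v q"
  shows "q \<in> L2_space \<omega>"
    and "\<phi> \<in> test_functions \<omega> \<Longrightarrow> L2_inner \<omega> v (grad \<phi>) = - L2_inner \<omega> q \<phi>"
  using assms unfolding weak_div_def by blast+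

lemma weak_gradD:
  assumes "weak_grad \<omega> p g"
  shows "g \<in> L2_space \<omega>"
    and "\<phi> \<in> test_functions \<omega> \<Longrightarrow> L2_inner \<omega> p (divg \<phi>) = - L2_inner \<omega> g \<phi>"
  using assms unfolding weak_grad_def by blast+

lemma weak_graddivD:
  assumes "weak_graddiv \<omega> v g"
  shows "g \<in> L2_space \<omega>"
    and "\<phi> \<in> test_functions \<omega> \<Longrightarrow> L2_inner \<omega> v (grad (divg \<phi>)) = L2_inner \<omega> g \<phi>"
  using assms unfolding weak_graddiv_def by blast+

lemma weak_div_unique:
  assumes "open \<omega>" "weak_div \<omega> v q" "weak_div \<omega> v q'"
  shows "AE x in lebesgue_on \<omega>. q x = q' x"
  by (rule L2_eq_AE[OF assms(1) weak_divD(1)[OF assms(2)] weak_divD(1)[OF assms(3)]])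
    (use weak_divD(2)[OF assms(2)] weak_divD(2)[OF assms(3)] in fastforce)

lemma weak_grad_unique:
  assumes "open \<omega>" "weak_grad \<omega> p g" "weak_grad \<omega> p g'"
  shows "AE x in lebesgue_on \<omega>. g x = g' x"
  by (rule L2_eq_AE[OF assms(1) weak_gradD(1)[OF assms(2)] weak_gradD(1)[OF assms(3)]])
    (use weak_gradD(2)[OF assms(2)] weak_gradD(2)[OF assms(3)] in fastforce)

lemma weak_graddiv_unique:
  assumes "open \<omega>" "weak_graddiv \<omega> v g" "weak_graddiv \<omega> v g'"
  shows "AE x in lebesgue_on \<omega>. g x = g' x"
  by (rule L2_eq_AE[OF assms(1) weak_graddivD(1)[OF assms(2)] weak_graddivD(1)[OF assms(3)]])
    (use weak_graddivD(2)[OF assms(2)] weak_graddivD(2)[OF assms(3)] in fastforce)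

lemma weak_div_wdiv: "weak_div \<omega> v q \<Longrightarrow> weak_div \<omega> v (wdiv \<omega> v)"
  unfolding wdiv_def by (rule someI[of "weak_div \<omega> v"])

lemma weak_grad_wgrad: "weak_grad \<omega> p g \<Longrightarrow> weak_grad \<omega> p (wgrad \<omega> p)"
  unfolding wgrad_def by (rule someI[of "weak_grad \<omega> p"])

lemma weak_graddiv_wgraddiv: "weak_graddiv \<omega> v g \<Longrightarrow> weak_graddiv \<omega> v (wgraddiv \<omega> v)"
  unfolding wgraddiv_def by (rule someI[of "weak_graddiv \<omega> v"])

lemma L2_inner_AE_eq:
  assumes "AE x in lebesgue_on \<omega>. f x = f' x" "f \<in> L2_space \<omega>" "f' \<in> L2_space \<omega>" "h \<in> L2_space \<omega>"
  shows "L2_inner \<omega> f h = L2_inner \<omega> f' h"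
  using assms L2_spaceD(1) by (intro L2_inner_cong_AE) auto

text \<open>\<open>wdiv\<close> is a Hilbert choice, determined only up to null sets. Scalar
  products do not see the choice, so the chosen operators are handled through them.\<close>

lemma wdiv_inner:
  assumes "open \<omega>" "weak_div \<omega> v q" "h \<in> L2_space \<omega>"
  shows "L2_inner \<omega> (wdiv \<omega> v) h = L2_inner \<omega> q h"
  by (rule L2_inner_AE_eq[OF weak_div_unique[OF assms(1) weak_div_wdiv[OF assms(2)] assms(2)]
      weak_divD(1)[OF weak_div_wdiv[OF assms(2)]] weak_divD(1)[OF assms(2)] assms(3)])

lemma wgrad_inner:
  assumes "open \<omega>" "weak_grad \<omega> p g" "h \<in> L2_space \<omega>"
  shows "L2_inner \<omega> (wgrad \<omega> p) h = L2_inner \<omega> g h"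
  by (rule L2_inner_AE_eq[OF weak_grad_unique[OF assms(1) weak_grad_wgrad[OF assms(2)] assms(2)]
      weak_gradD(1)[OF weak_grad_wgrad[OF assms(2)]] weak_gradD(1)[OF assms(2)] assms(3)])

lemma wgraddiv_inner:
  assumes "open \<omega>" "weak_graddiv \<omega> v g" "h \<in> L2_space \<omega>"
  shows "L2_inner \<omega> (wgraddiv \<omega> v) h = L2_inner \<omega> g h"
  by (rule L2_inner_AE_eq[OF weak_graddiv_unique[OF assms(1) weak_graddiv_wgraddiv[OF assms(2)] assms(2)]
      weak_graddivD(1)[OF weak_graddiv_wgraddiv[OF assms(2)]] weak_graddivD(1)[OF assms(2)] assms(3)])

lemma wgraddiv_norm:
  assumes "open \<omega>" "weak_graddiv \<omega> v g"
  shows "L2_norm \<omega> (wgraddiv \<omega> v) = L2_norm \<omega> g"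
  by (rule L2_norm_cong_AE[OF weak_graddiv_unique[OF assms(1) weak_graddiv_wgraddiv[OF assms(2)] assms(2)]
      L2_spaceD(1)[OF weak_graddivD(1)[OF weak_graddiv_wgraddiv[OF assms(2)]]]
      L2_spaceD(1)[OF weak_graddivD(1)[OF assms(2)]]])

lemma L2_inner_lincomb:
  fixes f g h :: "'a::euclidean_space \<Rightarrow> 'b::euclidean_space"
  assumes "f \<in> L2_space \<omega>" "g \<in> L2_space \<omega>" "h \<in> L2_space \<omega>"
  shows "L2_inner \<omega> (\<lambda>x. f x + c *\<^sub>R g x) h = L2_inner \<omega> f h + c * L2_inner \<omega> g h"
  using assms by (simp add: L2_inner_add_left L2_inner_scaleR_left scaleR_in_L2)

lemma weak_div_lincomb:
  assumes \<omega>: "open \<omega>" and "v \<in> L2_space \<omega>" "v' \<in> L2_space \<omega>" "weak_div \<omega> v q" "weak_div \<omega> v' q'"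
  shows "weak_div \<omega> (\<lambda>x. v x + c *\<^sub>R v' x) (\<lambda>x. q x + c *\<^sub>R q' x)"
proof -
  have q: "q \<in> L2_space \<omega>" "q' \<in> L2_space \<omega>" by (rule weak_divD(1)[OF assms(4)], rule weak_divD(1)[OF assms(5)])
  have "L2_inner \<omega> (\<lambda>x. v x + c *\<^sub>R v' x) (grad \<phi>) = - L2_inner \<omega> (\<lambda>x. q x + c *\<^sub>R q' x) \<phi>"
    if t: "\<phi> \<in> test_functions \<omega>" for \<phi>
    using L2_inner_lincomb[OF q test_in_L2[OF t open_lebesgue[OF \<omega>]]]
      L2_inner_lincomb[OF assms(2,3) test_in_L2[OF grad_test[OF t] open_lebesgue[OF \<omega>]]]
      weak_divD(2)[OF assms(4) t] weak_divD(2)[OF assms(5) t] by simp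
  then show ?thesis using q by (simp only: weak_div_def) (intro conjI ballI add_in_L2 scaleR_in_L2; simp)
qed

lemma weak_grad_lincomb:
  assumes \<omega>: "open \<omega>" and "p \<in> L2_space \<omega>" "p' \<in> L2_space \<omega>" "weak_grad \<omega> p q" "weak_grad \<omega> p' q'"
  shows "weak_grad \<omega> (\<lambda>x. p x + c *\<^sub>R p' x) (\<lambda>x. q x + c *\<^sub>R q' x)"
proof -
  have q: "q \<in> L2_space \<omega>" "q' \<in> L2_space \<omega>" by (rule weak_gradD(1)[OF assms(4)], rule weak_gradD(1)[OF assms(5)])
  have "L2_inner \<omega> (\<lambda>x. p x + c *\<^sub>R p' x) (divg \<phi>) = - L2_inner \<omega> (\<lambda>x. q x + c *\<^sub>R q' x) \<phi>"
    if t: "\<phi> \<in> test_functions \<omega>" for \<phi>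
    using L2_inner_lincomb[OF q test_in_L2[OF t open_lebesgue[OF \<omega>]]]
      L2_inner_lincomb[OF assms(2,3) test_in_L2[OF divg_test[OF t] open_lebesgue[OF \<omega>]]]
      weak_gradD(2)[OF assms(4) t] weak_gradD(2)[OF assms(5) t] by simp
  then show ?thesis using q by (simp only: weak_grad_def) (intro conjI ballI add_in_L2 scaleR_in_L2; simp)
qed

lemma weak_graddiv_lincomb:
  assumes \<omega>: "open \<omega>" and "v \<in> L2_space \<omega>" "v' \<in> L2_space \<omega>" "weak_graddiv \<omega> v q" "weak_graddiv \<omega> v' q'"
  shows "weak_graddiv \<omega> (\<lambda>x. v x + c *\<^sub>R v' x) (\<lambda>x. q x + c *\<^sub>R q' x)"
proof -
  have q: "q \<in> L2_space \<omega>" "q' \<in> L2_space \<omega>" by (rule weak_graddivD(1)[OF assms(4)], rule weak_graddivD(1)[OF assms(5)])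
  have "L2_inner \<omega> (\<lambda>x. v x + c *\<^sub>R v' x) (grad (divg \<phi>)) = L2_inner \<omega> (\<lambda>x. q x + c *\<^sub>R q' x) \<phi>"
    if t: "\<phi> \<in> test_functions \<omega>" for \<phi>
    using L2_inner_lincomb[OF q test_in_L2[OF t open_lebesgue[OF \<omega>]]]
      L2_inner_lincomb[OF assms(2,3) test_in_L2[OF grad_test[OF divg_test[OF t]] open_lebesgue[OF \<omega>]]]
      weak_graddivD(2)[OF assms(4) t] weak_graddivD(2)[OF assms(5) t] by simp
  then show ?thesis using q by (simp only: weak_graddiv_def) (intro conjI ballI add_in_L2 scaleR_in_L2; simp)
qed

lemma weak_graddivI:
  assumes "weak_div \<omega> v q" "weak_grad \<omega> q h"
  shows "weak_graddiv \<omega> v h"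
  unfolding weak_graddiv_def
  using weak_divD(2)[OF assms(1) divg_test] weak_gradD[OF assms(2)] by simp

text \<open>The set \<open>\<omega>'\<close> is unrelated to \<open>\<omega>\<close>: the compact
  support that integration by parts asks for is that of the functions tested against.\<close>

lemma test_weak_div:
  assumes "\<omega> \<in> sets lebesgue" "\<phi> \<in> test_functions \<omega>'"
  shows "weak_div \<omega> \<phi> (divg \<phi>)"
  using assms test_in_L2[OF divg_test[OF assms(2)] assms(1)]
  by (auto simp: weak_div_def intro!: integral_by_parts_test intro: test_smooth)

lemma test_weak_grad:
  assumes "\<omega> \<in> sets lebesgue" "\<phi> \<in> test_functions \<omega>'"
  shows "weak_grad \<omega> \<phi> (grad \<phi>)"
  using assms test_in_L2[OF grad_test[OF assms(2)] assms(1)]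
    integral_by_parts_test[OF assms(1) test_smooth test_smooth[OF assms(2)]]
  by (auto simp: weak_grad_def L2_inner_commute[of \<omega> \<phi>] L2_inner_commute[of \<omega> "grad \<phi>"])

lemma test_weak_graddiv:
  assumes "\<omega> \<in> sets lebesgue" "\<phi> \<in> test_functions \<omega>'"
  shows "weak_graddiv \<omega> \<phi> (grad (divg \<phi>))"
  by (rule weak_graddivI[OF test_weak_div[OF assms] test_weak_grad[OF assms(1) divg_test[OF assms(2)]]])

lemma L2_inner_test_subset:
  fixes f \<phi> :: "'a::euclidean_space \<Rightarrow> 'b::euclidean_space"
  assumes "open T" "open \<omega>" "T \<subseteq> \<omega>" "\<phi> \<in> test_functions T"
  shows "L2_inner T f \<phi> = L2_inner \<omega> f \<phi>"
proof -
  obtain K where K: "K \<subseteq> T" "\<forall>x. x \<notin> K \<longrightarrow> \<phi> x = 0" using assms(4) by (auto elim: test_functionsE)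
  have "f x \<bullet> \<phi> x = 0" if "x \<notin> T" for x using K that by auto
  then show ?thesis
    using assms(3) by (subst (1 2) L2_inner_UNIV) (auto intro!: open_lebesgue assms)
qed

lemma weak_graddiv_subset:
  fixes T \<omega> :: "'a::euclidean_space set"
  assumes "open T" "open \<omega>" "T \<subseteq> \<omega>" "weak_graddiv \<omega> v g"
  shows "weak_graddiv T v g"
  unfolding weak_graddiv_def
proof (intro conjI ballI)
  show "g \<in> L2_space T"
    by (rule L2_space_subset[OF weak_graddivD(1)[OF assms(4)] assms(3)])
      (intro open_lebesgue assms)+
  fix \<phi> :: "'a \<Rightarrow> 'a" assume t: "\<phi> \<in> test_functions T"
  have t': "\<phi> \<in> test_functions \<omega>" using t test_functions_mono[OF assms(3)] by blast
  show "L2_inner T v (grad (divg \<phi>)) = L2_inner T g \<phi>"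
    using L2_inner_test_subset[OF assms(1-3) t] L2_inner_test_subset[OF assms(1-3) grad_test[OF divg_test[OF t]]]
      weak_graddivD(2)[OF assms(4) t'] by simp
qed

section \<open>The space with vanishing traces\<close>

text \<open>
  \<open>H0_rep \<omega> v q h\<close> states that \<open>v \<in> H\<^sub>0(\<nabla>div, \<omega>)\<close> with \<open>q = div v\<close> and \<open>h = \<nabla>div v\<close>, freed from the
  choice of representatives in \<open>wdiv\<close>, \<open>wgrad\<close> and \<open>wgraddiv\<close>.
\<close>

definition H0_rep :: "'a::euclidean_space set \<Rightarrow> ('a \<Rightarrow> 'a) \<Rightarrow> ('a \<Rightarrow> real) \<Rightarrow> ('a \<Rightarrow> 'a) \<Rightarrow> bool" where
  "H0_rep \<omega> v q h \<longleftrightarrow> v \<in> L2_space \<omega> \<and> weak_div \<omega> v q \<and> weak_grad \<omega> q h \<and>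
    (\<forall>\<phi> g. \<phi> \<in> L2_space \<omega> \<longrightarrow> weak_grad \<omega> \<phi> g \<longrightarrow> L2_inner \<omega> v g + L2_inner \<omega> q \<phi> = 0) \<and>
    (\<forall>\<tau> s. \<tau> \<in> L2_space \<omega> \<longrightarrow> weak_div \<omega> \<tau> s \<longrightarrow> L2_inner \<omega> h \<tau> + L2_inner \<omega> q s = 0)"

lemma H0_repD:
  assumes "H0_rep \<omega> v q h"
  shows "v \<in> L2_space \<omega>" "weak_div \<omega> v q" "weak_grad \<omega> q h" "q \<in> L2_space \<omega>" "h \<in> L2_space \<omega>"
    "weak_graddiv \<omega> v h"
    "\<phi> \<in> L2_space \<omega> \<Longrightarrow> weak_grad \<omega> \<phi> g \<Longrightarrow> L2_inner \<omega> v g + L2_inner \<omega> q \<phi> = 0"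
    "\<tau> \<in> L2_space \<omega> \<Longrightarrow> weak_div \<omega> \<tau> s \<Longrightarrow> L2_inner \<omega> h \<tau> + L2_inner \<omega> q s = 0"
proof -
  show "v \<in> L2_space \<omega>" and d: "weak_div \<omega> v q" and g: "weak_grad \<omega> q h"
    using assms by (auto simp: H0_rep_def)
  from weak_divD(1)[OF d] weak_gradD(1)[OF g] show "q \<in> L2_space \<omega>" "h \<in> L2_space \<omega>" .
  show "weak_graddiv \<omega> v h" by (rule weak_graddivI[OF d g])
qed (use assms in \<open>auto simp: H0_rep_def\<close>)

lemma H0_rep_imp_H0graddiv:
  assumes \<omega>: "open \<omega>" and r: "H0_rep \<omega> v q h"
  shows "v \<in> H0graddiv \<omega>"
proof -
  note H = H0_repD[OF r]
  have dq: "weak_div \<omega> v (wdiv \<omega> v)" by (rule weak_div_wdiv[OF H(2)])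
  then have wq: "wdiv \<omega> v \<in> L2_space \<omega>" by (simp add: weak_div_def)
  have ae: "AE x in lebesgue_on \<omega>. wdiv \<omega> v x = q x"
    by (rule weak_div_unique[OF \<omega> dq H(2)])
  have wg: "weak_grad \<omega> (wdiv \<omega> v) h"
    using H(3) wdiv_inner[OF \<omega> H(2) test_in_L2[OF divg_test open_lebesgue[OF \<omega>]]]
    by (simp add: weak_grad_def)
  have "normal_trace \<omega> v = (\<lambda>\<phi>\<in>H1 \<omega>. 0)"
    unfolding normal_trace_def
  proof (rule restrict_ext)
    fix \<phi> assume "\<phi> \<in> H1 \<omega>"
    then obtain g where g: "\<phi> \<in> L2_space \<omega>" "weak_grad \<omega> \<phi> g" by (auto simp: H1_def)
    show "L2_inner \<omega> v (wgrad \<omega> \<phi>) + L2_inner \<omega> (wdiv \<omega> v) \<phi> = 0"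
      using H(7)[OF g(1) weak_grad_wgrad[OF g(2)]] wdiv_inner[OF \<omega> H(2) g(1)] by simp
  qed
  moreover have "scalar_trace \<omega> (wdiv \<omega> v) = (\<lambda>\<tau>\<in>Hdiv \<omega>. 0)"
    unfolding scalar_trace_def
  proof (rule restrict_ext)
    fix \<tau> assume "\<tau> \<in> Hdiv \<omega>"
    then obtain s where s: "\<tau> \<in> L2_space \<omega>" "weak_div \<omega> \<tau> s" by (auto simp: Hdiv_def)
    note s' = weak_div_wdiv[OF s(2)]
    have "L2_inner \<omega> (wdiv \<omega> v) (wdiv \<omega> \<tau>) = L2_inner \<omega> q (wdiv \<omega> \<tau>)"
      using s' by (intro wdiv_inner[OF \<omega> H(2)]) (simp add: weak_div_def)
    then show "L2_inner \<omega> (wgrad \<omega> (wdiv \<omega> v)) \<tau> + L2_inner \<omega> (wdiv \<omega> v) (wdiv \<omega> \<tau>) = 0"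
      using H(8)[OF s(1) s'] wgrad_inner[OF \<omega> wg s(1)] by simp
  qed
  ultimately show ?thesis
    using H(1,2,6) wq wg
    by (auto simp: H0graddiv_def Hgraddiv_def vanishing_traces_def Hdiv_def H1_def)
qed

lemma H0graddiv_imp_H0_rep:
  assumes \<omega>: "open \<omega>" and v: "v \<in> H0graddiv \<omega>"
  shows "H0_rep \<omega> v (wdiv \<omega> v) (wgrad \<omega> (wdiv \<omega> v))"
proof -
  have vL: "v \<in> L2_space \<omega>" and d: "weak_div \<omega> v (wdiv \<omega> v)" 
    and g: "weak_grad \<omega> (wdiv \<omega> v) (wgrad \<omega> (wdiv \<omega> v))"
    and nt: "normal_trace \<omega> v = (\<lambda>\<phi>\<in>H1 \<omega>. 0)"
    and st: "scalar_trace \<omega> (wdiv \<omega> v) = (\<lambda>\<tau>\<in>Hdiv \<omega>. 0)"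
    using v weak_div_wdiv weak_grad_wgrad
    by (auto simp: H0graddiv_def Hgraddiv_def vanishing_traces_def Hdiv_def H1_def)
  have qL: "wdiv \<omega> v \<in> L2_space \<omega>" using d by (simp add: weak_div_def)
  have "L2_inner \<omega> v g + L2_inner \<omega> (wdiv \<omega> v) \<phi> = 0" if "\<phi> \<in> L2_space \<omega>" "weak_grad \<omega> \<phi> g" for \<phi> g
  proof -
    have "L2_inner \<omega> v (wgrad \<omega> \<phi>) + L2_inner \<omega> (wdiv \<omega> v) \<phi> = 0"
    proof -
      have "\<phi> \<in> H1 \<omega>" using that by (auto simp: H1_def)
      then show ?thesis using fun_cong[OF nt, of \<phi>] by (simp add: normal_trace_def)
    qed
    then show ?thesis
      using wgrad_inner[OF \<omega> that(2) vL] by (simp add: L2_inner_commute[of \<omega> v])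
  qed
  moreover have "L2_inner \<omega> (wgrad \<omega> (wdiv \<omega> v)) \<tau> + L2_inner \<omega> (wdiv \<omega> v) s = 0"
    if "\<tau> \<in> L2_space \<omega>" "weak_div \<omega> \<tau> s" for \<tau> s
  proof -
    have "L2_inner \<omega> (wgrad \<omega> (wdiv \<omega> v)) \<tau> + L2_inner \<omega> (wdiv \<omega> v) (wdiv \<omega> \<tau>) = 0"
    proof -
      have "\<tau> \<in> Hdiv \<omega>" using that by (auto simp: Hdiv_def)
      then show ?thesis using fun_cong[OF st, of \<tau>] by (simp add: scalar_trace_def)
    qed
    then show ?thesis
      using wdiv_inner[OF \<omega> that(2) qL] by (simp add: L2_inner_commute[of \<omega> "wdiv \<omega> v"])
  qed
  ultimately show ?thesis using vL d g by (auto simp: H0_rep_def)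
qed

lemma H0_rep_lincomb:
  assumes \<omega>: "open \<omega>" and r: "H0_rep \<omega> v q h" and r': "H0_rep \<omega> v' q' h'"
  shows "H0_rep \<omega> (\<lambda>x. v x + c *\<^sub>R v' x) (\<lambda>x. q x + c *\<^sub>R q' x) (\<lambda>x. h x + c *\<^sub>R h' x)"
proof -
  note H = H0_repD[OF r] and H' = H0_repD[OF r']
  have "L2_inner \<omega> (\<lambda>x. v x + c *\<^sub>R v' x) g + L2_inner \<omega> (\<lambda>x. q x + c *\<^sub>R q' x) \<phi> = 0"
    if "\<phi> \<in> L2_space \<omega>" "weak_grad \<omega> \<phi> g" for \<phi> g
  proof -
    have "g \<in> L2_space \<omega>" using that by (simp add: weak_grad_def)
    moreover have "c * (L2_inner \<omega> v' g + L2_inner \<omega> q' \<phi>) = 0" using H'(7)[OF that] by simp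
    ultimately show ?thesis
      using L2_inner_lincomb[OF H(1) H'(1), of g c] L2_inner_lincomb[OF H(4) H'(4) that(1), of c] H(7)[OF that]
      by (simp add: algebra_simps)
  qed
  moreover have "L2_inner \<omega> (\<lambda>x. h x + c *\<^sub>R h' x) \<tau> + L2_inner \<omega> (\<lambda>x. q x + c *\<^sub>R q' x) s = 0"
    if "\<tau> \<in> L2_space \<omega>" "weak_div \<omega> \<tau> s" for \<tau> s
  proof -
    have "s \<in> L2_space \<omega>" using that by (simp add: weak_div_def)
    moreover have "c * (L2_inner \<omega> h' \<tau> + L2_inner \<omega> q' s) = 0" using H'(8)[OF that] by simp
    ultimately show ?thesis
      using L2_inner_lincomb[OF H(5) H'(5) that(1), of c] L2_inner_lincomb[OF H(4) H'(4), of s c] H(8)[OF that]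
      by (simp add: algebra_simps)
  qed
  ultimately show ?thesis
    unfolding H0_rep_def
    using add_in_L2[OF H(1) scaleR_in_L2[OF H'(1)]] weak_div_lincomb[OF \<omega> H(1) H'(1) H(2) H'(2)]
      weak_grad_lincomb[OF \<omega> H(4) H'(4) H(3) H'(3)] by blast
qed

lemma H0_rep_test:
  assumes \<omega>: "open \<omega>" and t: "\<phi> \<in> test_functions \<omega>"
  shows "H0_rep \<omega> \<phi> (divg \<phi>) (grad (divg \<phi>))"
proof -
  note s = open_lebesgue[OF \<omega>]
  have "L2_inner \<omega> \<phi> g + L2_inner \<omega> (divg \<phi>) p = 0" if "weak_grad \<omega> p g" for p g
    using that t by (simp add: weak_grad_def L2_inner_commute[of \<omega> \<phi>] L2_inner_commute[of \<omega> "divg \<phi>"])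
  moreover have "L2_inner \<omega> (grad (divg \<phi>)) \<tau> + L2_inner \<omega> (divg \<phi>) r = 0" if "weak_div \<omega> \<tau> r" for \<tau> r
    using that divg_test[OF t]
    by (simp add: weak_div_def L2_inner_commute[of \<omega> "grad (divg \<phi>)"] L2_inner_commute[of \<omega> "divg \<phi>"])
  ultimately show ?thesis
    unfolding H0_rep_def
    using test_in_L2[OF t s] test_weak_div[OF s t] test_weak_grad[OF s divg_test[OF t]] by blast
qed

text \<open>
  Since the graph norm controls \<open>div v\<close> on \<open>H\<^sub>0(\<nabla>div, \<omega>)\<close>, this space is complete on any open set.
\<close>

lemma H0_rep_div_norm:
  assumes "H0_rep \<omega> v q h"
  shows "(L2_norm \<omega> q)\<^sup>2 \<le> L2_norm \<omega> v * L2_norm \<omega> h"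
proof -
  note H = H0_repD[OF assms]
  \<comment> \<open>The normal trace condition, tested with \<open>q\<close> itself, whose gradient
    is \<open>h\<close>.\<close>
  have "L2_inner \<omega> q q = - L2_inner \<omega> v h" using H(7)[OF H(4) H(3)] by simp
  then show ?thesis using L2_Cauchy_Schwarz[OF H(1) H(5)] by (simp add: L2_norm_sq)
qed

section \<open>Closedness and the variational problem\<close>

lemma L2_inner_Pair:
  fixes a c :: "'a::euclidean_space \<Rightarrow> 'b::euclidean_space" and b d :: "'a \<Rightarrow> 'c::euclidean_space"
  assumes "a \<in> L2_space \<omega>" "b \<in> L2_space \<omega>" "c \<in> L2_space \<omega>" "d \<in> L2_space \<omega>"
  shows "L2_inner \<omega> (\<lambda>x. (a x, b x)) (\<lambda>x. (c x, d x)) = L2_inner \<omega> a c + L2_inner \<omega> b d"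
  using integrable_L2_inner[OF assms(1,3)] integrable_L2_inner[OF assms(2,4)]
  by (simp add: L2_inner_def inner_Pair)

lemma L2_norm_Pair:
  fixes a :: "'a::euclidean_space \<Rightarrow> 'b::euclidean_space" and b :: "'a \<Rightarrow> 'c::euclidean_space"
  assumes "a \<in> L2_space \<omega>" "b \<in> L2_space \<omega>"
  shows "L2_norm \<omega> a \<le> L2_norm \<omega> (\<lambda>x. (a x, b x))" "L2_norm \<omega> b \<le> L2_norm \<omega> (\<lambda>x. (a x, b x))"
proof -
  have e: "(L2_norm \<omega> (\<lambda>x. (a x, b x)))\<^sup>2 = (L2_norm \<omega> a)\<^sup>2 + (L2_norm \<omega> b)\<^sup>2"
    using L2_inner_Pair[OF assms assms] by (simp add: L2_norm_sq)
  show "L2_norm \<omega> a \<le> L2_norm \<omega> (\<lambda>x. (a x, b x))" "L2_norm \<omega> b \<le> L2_norm \<omega> (\<lambda>x. (a x, b x))"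
    by (rule power2_le_imp_le; simp add: e)+
qed

text \<open>Convergence of the divergences is not assumed: their differences are controlled by those
  of \<open>v\<close> and \<open>h\<close>. The trace conditions are scalar identities and survive
  L2 limits; tested with smooth functions they also yield the weak derivatives of the limit.\<close>

lemma H0_rep_closed:
  assumes \<omega>: "open \<omega>" and r: "\<And>n. H0_rep \<omega> (v n) (q n) (h n)"
    and u: "u \<in> L2_space \<omega>" "(\<lambda>n. L2_norm \<omega> (\<lambda>x. v n x - u x)) \<longlonglongrightarrow> 0"
    and k: "k \<in> L2_space \<omega>" "(\<lambda>n. L2_norm \<omega> (\<lambda>x. h n x - k x)) \<longlonglongrightarrow> 0"
  obtains p where "H0_rep \<omega> u p k"
proof -
  note H = H0_repD[OF r]
  have qb: "L2_norm \<omega> (\<lambda>x. q m x - q n x) \<le> 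
      L2_norm \<omega> (\<lambda>x. v m x - v n x) + L2_norm \<omega> (\<lambda>x. h m x - h n x)" for m n
  proof (rule power2_le_imp_le)
    let ?a = "L2_norm \<omega> (\<lambda>x. v m x - v n x)" and ?b = "L2_norm \<omega> (\<lambda>x. h m x - h n x)"
    have "H0_rep \<omega> (\<lambda>x. v m x - v n x) (\<lambda>x. q m x - q n x) (\<lambda>x. h m x - h n x)"
      using H0_rep_lincomb[OF \<omega> r r, of m "-1" n] by simp
    then have "(L2_norm \<omega> (\<lambda>x. q m x - q n x))\<^sup>2 \<le> ?a * ?b"
      by (rule H0_rep_div_norm)
    also have "\<dots> \<le> (?a + ?b)\<^sup>2"
      by (simp add: power2_sum add_increasing2)
    finally show "(L2_norm \<omega> (\<lambda>x. q m x - q n x))\<^sup>2 \<le> (?a + ?b)\<^sup>2" .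
  qed simp
  have vb: "L2_norm \<omega> (\<lambda>x. v m x - v n x) \<le> L2_norm \<omega> (\<lambda>x. v m x - u x) + L2_norm \<omega> (\<lambda>x. v n x - u x)" for m n
    using L2_norm_triangle_diff[OF diff_in_L2[OF H(1) u(1)] diff_in_L2[OF H(1) u(1)], of m n] by simp
  have hb: "L2_norm \<omega> (\<lambda>x. h m x - h n x) \<le> L2_norm \<omega> (\<lambda>x. h m x - k x) + L2_norm \<omega> (\<lambda>x. h n x - k x)" for m n
    using L2_norm_triangle_diff[OF diff_in_L2[OF H(5) k(1)] diff_in_L2[OF H(5) k(1)], of m n] by simp
  have "\<exists>N. \<forall>m\<ge>N. \<forall>n\<ge>N. L2_norm \<omega> (\<lambda>x. q m x - q n x) < e" if "e > 0" for e
  proof -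
    have "\<forall>\<^sub>F n in sequentially. L2_norm \<omega> (\<lambda>x. v n x - u x) < e / 4"
      "\<forall>\<^sub>F n in sequentially. L2_norm \<omega> (\<lambda>x. h n x - k x) < e / 4"
      using order_tendstoD(2)[OF u(2), of "e / 4"] order_tendstoD(2)[OF k(2), of "e / 4"] that by auto
    then have "\<forall>\<^sub>F n in sequentially. L2_norm \<omega> (\<lambda>x. v n x - u x) < e / 4 \<and> L2_norm \<omega> (\<lambda>x. h n x - k x) < e / 4"
      by (rule eventually_conj)
    then obtain N where N: "\<And>n. n \<ge> N \<Longrightarrow> L2_norm \<omega> (\<lambda>x. v n x - u x) < e / 4"
      "\<And>n. n \<ge> N \<Longrightarrow> L2_norm \<omega> (\<lambda>x. h n x - k x) < e / 4"
      unfolding eventually_sequentially by blast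
    have "L2_norm \<omega> (\<lambda>x. q m x - q n x) < e" if "m \<ge> N" "n \<ge> N" for m n
      using qb[of m n] vb[of m n] hb[of m n] N[OF that(1)] N[OF that(2)] by argo
    then show ?thesis by blast
  qed
  then obtain p where p: "p \<in> L2_space \<omega>" "(\<lambda>n. L2_norm \<omega> (\<lambda>x. q n x - p x)) \<longlonglongrightarrow> 0"
    using L2_complete[of q \<omega>] H(4) by blast
  have lv: "(\<lambda>n. L2_inner \<omega> (v n) z) \<longlonglongrightarrow> L2_inner \<omega> u z" if "z \<in> L2_space \<omega>" for z
    by (rule L2_inner_tendsto[OF H(1) u(1) that u(2)])
  have lq: "(\<lambda>n. L2_inner \<omega> (q n) z) \<longlonglongrightarrow> L2_inner \<omega> p z" if "z \<in> L2_space \<omega>" for z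
    by (rule L2_inner_tendsto[OF H(4) p(1) that p(2)])
  have lh: "(\<lambda>n. L2_inner \<omega> (h n) z) \<longlonglongrightarrow> L2_inner \<omega> k z" if "z \<in> L2_space \<omega>" for z
    by (rule L2_inner_tendsto[OF H(5) k(1) that k(2)])
  have c1: "L2_inner \<omega> u g + L2_inner \<omega> p \<phi> = 0" if "\<phi> \<in> L2_space \<omega>" "weak_grad \<omega> \<phi> g" for \<phi> g
  proof (rule LIMSEQ_unique)
    show "(\<lambda>n. L2_inner \<omega> (v n) g + L2_inner \<omega> (q n) \<phi>) \<longlonglongrightarrow> L2_inner \<omega> u g + L2_inner \<omega> p \<phi>"
      using that by (intro tendsto_add lv lq) (auto simp: weak_grad_def)
    show "(\<lambda>n. L2_inner \<omega> (v n) g + L2_inner \<omega> (q n) \<phi>) \<longlonglongrightarrow> 0" using H(7)[OF that] by simp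
  qed
  have c2: "L2_inner \<omega> k \<tau> + L2_inner \<omega> p s = 0" if "\<tau> \<in> L2_space \<omega>" "weak_div \<omega> \<tau> s" for \<tau> s
  proof (rule LIMSEQ_unique)
    show "(\<lambda>n. L2_inner \<omega> (h n) \<tau> + L2_inner \<omega> (q n) s) \<longlonglongrightarrow> L2_inner \<omega> k \<tau> + L2_inner \<omega> p s"
      using that by (intro tendsto_add lh lq) (auto simp: weak_div_def)
    show "(\<lambda>n. L2_inner \<omega> (h n) \<tau> + L2_inner \<omega> (q n) s) \<longlonglongrightarrow> 0" using H(8)[OF that] by simp
  qed
  note s = open_lebesgue[OF \<omega>]
  have "L2_inner \<omega> u (grad \<phi>) = - L2_inner \<omega> p \<phi>" if "\<phi> \<in> test_functions \<omega>" for \<phi>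
    using c1[OF test_in_L2[OF that s] test_weak_grad[OF s that]] by simp
  moreover have "L2_inner \<omega> p (divg \<phi>) = - L2_inner \<omega> k \<phi>" if "\<phi> \<in> test_functions \<omega>" for \<phi>
    using c2[OF test_in_L2[OF that s] test_weak_div[OF s that]] by simp
  ultimately have "H0_rep \<omega> u p k"
    unfolding H0_rep_def weak_div_def[of \<omega> u p] weak_grad_def[of \<omega> p k] using u k p c1 c2 by blast
  then show thesis by (rule that)
qed

text \<open>Identifying \<open>v\<close> with the pair of \<open>v\<close> and its \<nabla>div turns
  the graph scalar product into that of L2 with values in a product space, so
  \<open>L2_Riesz\<close> applies as it stands. The last identity is the variational equation tested
  with the solution; it feeds the norm bound.\<close>

lemma bvp_exists:
  fixes f :: "'a::euclidean_space \<Rightarrow> 'a"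
  assumes \<omega>: "open \<omega>" and f: "f \<in> L2_space \<omega>"
  obtains u q g where "H0_rep \<omega> u q g" "weak_graddiv \<omega> g (\<lambda>x. f x - u x)"
    "L2_inner \<omega> u u + L2_inner \<omega> g g = L2_inner \<omega> f u"
proof -
  define D where "D = {\<lambda>x. (v x, h x) | v h. \<exists>q. H0_rep \<omega> v q h}"
  define F where "F p = L2_inner \<omega> f (\<lambda>x. fst (p x))" for p :: "'a \<Rightarrow> 'a \<times> 'a"
  have inD: "(\<lambda>x. (v x, h x)) \<in> D" if "H0_rep \<omega> v q h" for v q h
    using that unfolding D_def by blast
  have D_E: "\<exists>v h q. p = (\<lambda>x. (v x, h x)) \<and> H0_rep \<omega> v q h" if "p \<in> D" for p
    using that unfolding D_def by blast
  have DL: "D \<subseteq> L2_space \<omega>"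
    using D_E H0_repD(1,5) Pair_in_L2 by fastforce
  have D0: "(\<lambda>x. 0) \<in> D"
  proof -
    have z: "divg (\<lambda>x::'a. 0::'a) = (\<lambda>x. 0)" "grad (\<lambda>x::'a. 0) = (\<lambda>x. 0)"
      by (auto simp: grad_def divg_def)
    have "(\<lambda>x. (0, grad (divg (\<lambda>x::'a. 0::'a)) x)) \<in> D"
      by (rule inD[OF H0_rep_test[OF \<omega> test_zero]])
    then show ?thesis by (simp only: z zero_prod_def)
  qed
  have D_lin: "(\<lambda>x. p x + c *\<^sub>R r x) \<in> D" if pr: "p \<in> D" "r \<in> D" for p r c
  proof -
    obtain v h q where 1: "p = (\<lambda>x. (v x, h x))" "H0_rep \<omega> v q h" using D_E[OF pr(1)] by blast
    obtain v' h' q' where 2: "r = (\<lambda>x. (v' x, h' x))" "H0_rep \<omega> v' q' h'" using D_E[OF pr(2)] by blast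
    show ?thesis using inD[OF H0_rep_lincomb[OF \<omega> 1(2) 2(2), of c]] unfolding 1(1) 2(1) by simp
  qed
  have F_lin: "F (\<lambda>x. p x + c *\<^sub>R r x) = F p + c * F r" if pr: "p \<in> D" "r \<in> D" for p r c
  proof -
    have "(\<lambda>x. fst (p x)) \<in> L2_space \<omega>" "(\<lambda>x. fst (r x)) \<in> L2_space \<omega>"
      using pr DL by (auto intro: fst_in_L2)
    from L2_inner_lincomb[OF this f, of c] show ?thesis
      unfolding F_def by (simp add: L2_inner_commute[of \<omega> f])
  qed
  have F_bd: "\<bar>F p\<bar> \<le> L2_norm \<omega> f * L2_norm \<omega> p" if "p \<in> D" for p
  proof -
    have pL: "p \<in> L2_space \<omega>" using that DL by auto
    have "\<bar>F p\<bar> \<le> L2_norm \<omega> f * L2_norm \<omega> (\<lambda>x. fst (p x))"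
      unfolding F_def by (rule L2_Cauchy_Schwarz[OF f fst_in_L2[OF pL]])
    also have "\<dots> \<le> L2_norm \<omega> f * L2_norm \<omega> p"
      using L2_norm_Pair(1)[OF fst_in_L2[OF pL] snd_in_L2[OF pL]] by (simp add: mult_left_mono)
    finally show ?thesis .
  qed
  obtain U d where U: "U \<in> L2_space \<omega>" "\<And>p. p \<in> D \<Longrightarrow> L2_inner \<omega> U p = F p"
    and d: "\<And>n::nat. d n \<in> D" "(\<lambda>n. L2_norm \<omega> (\<lambda>x. d n x - U x)) \<longlonglongrightarrow> 0"
    using L2_Riesz[OF DL D0 D_lin F_lin F_bd] by blast
  define u where "u x = fst (U x)" for x
  define g where "g x = snd (U x)" for x
  have uL: "u \<in> L2_space \<omega>" and gL: "g \<in> L2_space \<omega>"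
    using fst_in_L2[OF U(1)] snd_in_L2[OF U(1)] by (auto simp: u_def[abs_def] g_def[abs_def])
  have Ueq: "U = (\<lambda>x. (u x, g x))" by (simp add: u_def g_def)
  have "\<forall>n. \<exists>v h q. d n = (\<lambda>x. (v x, h x)) \<and> H0_rep \<omega> v q h" using D_E[OF d(1)] by blast
  then obtain v h q where dn: "\<And>n. d n = (\<lambda>x. (v n x, h n x))" and r: "\<And>n. H0_rep \<omega> (v n) (q n) (h n)"
    by metis
  note H = H0_repD[OF r]
  have dU: "(\<lambda>x. d n x - U x) = (\<lambda>x. (v n x - u x, h n x - g x))" for n
    by (simp add: dn Ueq)
  have vl: "(\<lambda>n. L2_norm \<omega> (\<lambda>x. v n x - u x)) \<longlonglongrightarrow> 0"
    by (rule Lim_null_comparison[OF _ d(2)])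
      (use L2_norm_Pair(1)[OF diff_in_L2[OF H(1) uL] diff_in_L2[OF H(5) gL]] in \<open>simp add: dU\<close>)
  have hl: "(\<lambda>n. L2_norm \<omega> (\<lambda>x. h n x - g x)) \<longlonglongrightarrow> 0"
    by (rule Lim_null_comparison[OF _ d(2)])
      (use L2_norm_Pair(2)[OF diff_in_L2[OF H(1) uL] diff_in_L2[OF H(5) gL]] in \<open>simp add: dU\<close>)
  obtain p where p: "H0_rep \<omega> u p g"
    by (rule H0_rep_closed[OF \<omega> r uL vl gL hl])
  have var: "L2_inner \<omega> u v + L2_inner \<omega> g h = L2_inner \<omega> f v" if "H0_rep \<omega> v q h" for v q h
    using U(2)[OF inD[OF that]] L2_inner_Pair[OF uL gL H0_repD(1,5)[OF that]]
    by (simp add: Ueq F_def)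
  have "L2_inner \<omega> g (grad (divg \<phi>)) = L2_inner \<omega> (\<lambda>x. f x - u x) \<phi>" if t: "\<phi> \<in> test_functions \<omega>" for \<phi>
    using var[OF H0_rep_test[OF \<omega> t]] L2_inner_diff_left[OF f uL test_in_L2[OF t open_lebesgue[OF \<omega>]]]
    by simp
  then have "weak_graddiv \<omega> g (\<lambda>x. f x - u x)"
    unfolding weak_graddiv_def using diff_in_L2[OF f uL] by blast
  from that[OF p this var[OF p]] show thesis .
qed

section \<open>Averaging along a direction\<close>

text \<open>Two kernels occur: the constant 1 gives the average, and \<open>1 - s\<close> a function
  whose derivative along \<open>v\<close> is the difference between \<open>\<phi>\<close> and its
  average. Reading \<open>\<phi>\<close> at \<open>x - s *\<^sub>R v\<close> makes supports move in
  the direction of \<open>v\<close>.\<close>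

definition avg :: "(real \<Rightarrow> real) \<Rightarrow> 'a::euclidean_space \<Rightarrow> ('a \<Rightarrow> real) \<Rightarrow> 'a \<Rightarrow> real" where
  "avg k v \<phi> x = integral {0..1} (\<lambda>s. k s * \<phi> (x - s *\<^sub>R v))"

lemma avg_has_derivative:
  fixes \<phi> :: "'a::euclidean_space \<Rightarrow> real"
  assumes s: "smooth \<phi>" and k: "continuous_on {0..1} k"
  shows "(avg k v \<phi> has_derivative (\<lambda>h. avg k v (dird h \<phi>) x)) (at x)"
proof -
  \<comment> \<open>\<open>leibniz_rule\<close> expects the derivative as a continuous family of
    bounded linear maps.\<close>
  define D where "D x s = Blinfun (\<lambda>h. k s * dird h \<phi> (x - s *\<^sub>R v))" for x s
  have bl: "bounded_linear (\<lambda>h. k s * dird h \<phi> (x - s *\<^sub>R v))" for x s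
    using has_derivative_bounded_linear[OF smooth_derivative(1)[OF s]] bounded_linear_const_mult by blast
  have D: "blinfun_apply (D x s) = (\<lambda>h. k s * dird h \<phi> (x - s *\<^sub>R v))" for x s
    unfolding D_def by (rule bounded_linear_Blinfun_apply[OF bl])
  have shift: "continuous_on T (\<lambda>z. \<psi> (fst z - snd z *\<^sub>R v))" if "smooth \<psi>" for \<psi> :: "'a \<Rightarrow> real" and T
    by (rule continuous_on_compose2[OF smooth_continuous[OF that, of UNIV]]) (auto intro!: continuous_intros)
  have contk: "continuous_on (UNIV \<times> {0..1}) (\<lambda>z::'a \<times> real. k (snd z))"
    by (rule continuous_on_compose2[OF k]) (auto intro!: continuous_intros)
  have "((\<lambda>x. integral (cbox 0 1) (\<lambda>s. k s * \<phi> (x - s *\<^sub>R v))) has_derivative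
      blinfun_apply (integral (cbox 0 1) (D x))) (at x within UNIV)"
  proof (rule leibniz_rule)
    fix y :: 'a and t :: real
    have "((\<lambda>y. y - t *\<^sub>R v) has_derivative (\<lambda>h. h)) (at y)"
      by (auto intro!: derivative_eq_intros)
    from has_derivative_compose[OF this smooth_derivative(1)[OF s]]
    have "((\<lambda>y. \<phi> (y - t *\<^sub>R v)) has_derivative (\<lambda>h. dird h \<phi> (y - t *\<^sub>R v))) (at y)" .
    then show "((\<lambda>y. k t * \<phi> (y - t *\<^sub>R v)) has_derivative blinfun_apply (D y t)) (at y within UNIV)"
      unfolding D by (rule has_derivative_mult_right)
  next
    fix y :: 'a
    have "continuous_on {0..1} (\<lambda>t. k t * \<phi> (y - t *\<^sub>R v))"
      by (intro continuous_on_mult k continuous_on_compose2[OF smooth_continuous[OF s, of UNIV]])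
        (auto intro!: continuous_intros)
    then show "(\<lambda>t. k t * \<phi> (y - t *\<^sub>R v)) integrable_on cbox 0 1"
      by (simp add: integrable_continuous_real)
  next
    show "continuous_on (UNIV \<times> cbox 0 1) (\<lambda>(y, t). D y t)"
    proof (rule continuous_on_blinfun_componentwise)
      fix i :: 'a assume "i \<in> Basis"
      have "continuous_on (UNIV \<times> {0..1}) (\<lambda>z. k (snd z) * dird i \<phi> (fst z - snd z *\<^sub>R v))"
        by (intro continuous_on_mult contk shift smooth_derivative(2)[OF s])
      then show "continuous_on (UNIV \<times> cbox 0 1) (\<lambda>z. blinfun_apply (case z of (y, t) \<Rightarrow> D y t) i)"
        by (simp add: D split_def)
    qed
  qed auto
  moreover have "blinfun_apply (integral (cbox 0 1) (D x)) h = avg k v (dird h \<phi>) x" for h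
  proof -
    have "continuous_on (cbox 0 1) (D x)"
    proof (rule continuous_on_blinfun_componentwise)
      fix i :: 'a assume "i \<in> Basis"
      have "continuous_on {0..1} (\<lambda>t. k t * dird i \<phi> (x - t *\<^sub>R v))"
        by (intro continuous_on_mult k continuous_on_compose2[OF smooth_continuous[OF smooth_derivative(2)[OF s], of UNIV]])
          (auto intro!: continuous_intros)
      then show "continuous_on (cbox 0 1) (\<lambda>t. blinfun_apply (D x t) i)" by (simp add: D)
    qed
    then have "D x integrable_on cbox 0 1" by (rule integrable_continuous)
    from integral_linear[OF this blinfun.bounded_linear_left[of h]]
    show ?thesis by (simp add: avg_def o_def D)
  qed
  then have "blinfun_apply (integral (cbox 0 1) (D x)) = (\<lambda>h. avg k v (dird h \<phi>) x)" by (rule ext)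
  ultimately show ?thesis by (simp add: avg_def[abs_def])
qed

lemma dird_avg: "smooth \<phi> \<Longrightarrow> continuous_on {0..1} k \<Longrightarrow> dird h (avg k v \<phi>) = avg k v (dird h \<phi>)"
  by (rule ext, rule dird_eq, rule avg_has_derivative)

lemma smooth_avg:
  assumes "smooth \<phi>" and k: "continuous_on {0..1} k"
  shows "smooth (avg k v \<phi>)"
  unfolding smooth_def
proof
  fix n show "C_diff n (avg k v \<phi>)"
    using assms(1)
  proof (induction n arbitrary: \<phi>)
    case 0
    show ?case unfolding C_diff.simps(1)
      by (intro continuous_at_imp_continuous_on ballI has_derivative_continuous[OF avg_has_derivative[OF 0 k]])
  next
    case (Suc n)
    show ?case
      by (rule C_diff_SucI[OF avg_has_derivative[OF Suc.prems k]])
        (rule Suc.IH[OF smooth_derivative(2)[OF Suc.prems]])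
  qed
qed

abbreviation avg1 :: "'a::euclidean_space \<Rightarrow> ('a \<Rightarrow> real) \<Rightarrow> 'a \<Rightarrow> real" where
  "avg1 \<equiv> avg (\<lambda>_. 1)"

lemma line_derivative:
  assumes "smooth (\<phi> :: 'a::euclidean_space \<Rightarrow> real)"
  shows "((\<lambda>s. \<phi> (x - s *\<^sub>R v)) has_real_derivative - dird v \<phi> (x - s *\<^sub>R v)) (at s within S)"
proof -
  have "((\<lambda>s. x - s *\<^sub>R v) has_derivative (\<lambda>h. - h *\<^sub>R v)) (at s within S)"
    by (auto intro!: derivative_eq_intros)
  from has_derivative_compose[OF this smooth_derivative(1)[OF assms]]
  show ?thesis unfolding has_field_derivative_def
    by (rule has_derivative_eq_rhs)
      (simp add: fun_eq_iff linear_cmul[OF dird_linear[OF assms]] linear_neg[OF dird_linear[OF assms]])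
qed

text \<open>The fundamental theorem of calculus along the segment. This is where averaging gains
  regularity: no derivative of \<open>\<phi>\<close> is left on the right.\<close>

lemma dird_avg1:
  assumes s: "smooth \<phi>"
  shows "dird v (avg1 v \<phi>) x = \<phi> x - \<phi> (x - v)"
proof -
  have "((\<lambda>s. - dird v \<phi> (x - s *\<^sub>R v)) has_integral (\<phi> (x - 1 *\<^sub>R v) - \<phi> (x - 0 *\<^sub>R v))) {0..1}"
    by (rule fundamental_theorem_of_calculus)
      (auto simp: has_real_derivative_iff_has_vector_derivative[symmetric] intro: line_derivative[OF s])
  from has_integral_neg[OF this] have "avg1 v (dird v \<phi>) x = \<phi> x - \<phi> (x - v)"
    by (simp add: avg_def integral_unique)
  then show ?thesis by (simp add: dird_avg[OF s])
qed

text \<open>Integration by parts along the segment: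
  \<open>(1 - s) * \<phi> (x - s *\<^sub>R v)\<close> runs from \<open>\<phi> x\<close> to 0, and
  differentiating the factor \<open>1 - s\<close> produces the average.\<close>

lemma diff_avg1:
  assumes s: "smooth \<phi>"
  shows "dird v (avg (\<lambda>s. 1 - s) v \<phi>) x = \<phi> x - avg1 v \<phi> x"
proof -
  let ?G = "\<lambda>s. (1 - s) * \<phi> (x - s *\<^sub>R v)" and ?g = "\<lambda>s. - (1 - s) * dird v \<phi> (x - s *\<^sub>R v) - \<phi> (x - s *\<^sub>R v)"
  have "(?G has_real_derivative ?g t) (at t within {0..1})" for t
    by (rule derivative_eq_intros line_derivative[OF s] refl)+ (simp add: algebra_simps)
  then have "(?g has_integral (?G 1 - ?G 0)) {0..1}"
    by (intro fundamental_theorem_of_calculus) (auto simp: has_real_derivative_iff_has_vector_derivative[symmetric])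
  moreover have "continuous_on {0..1} (\<lambda>t. \<phi> (x - t *\<^sub>R v))"
    by (intro continuous_on_compose2[OF smooth_continuous[OF s, of UNIV]]) (auto intro!: continuous_intros)
  then have "((\<lambda>t. \<phi> (x - t *\<^sub>R v)) has_integral avg1 v \<phi> x) {0..1}"
    unfolding avg_def by (simp add: integrable_continuous_real integrable_integral)
  ultimately have "((\<lambda>t. ?g t + \<phi> (x - t *\<^sub>R v)) has_integral (?G 1 - ?G 0 + avg1 v \<phi> x)) {0..1}"
    by (rule has_integral_add)
  from has_integral_neg[OF this]
  have "avg (\<lambda>s. 1 - s) v (dird v \<phi>) x = \<phi> x - avg1 v \<phi> x"
    unfolding avg_def by (intro integral_unique) (simp add: algebra_simps)
  then show ?thesis by (simp add: dird_avg[OF s] continuous_intros)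
qed

lemma avg_support:
  assumes "compact K" "\<forall>x. x \<notin> K \<longrightarrow> \<phi> x = 0"
  shows "compact ((\<lambda>(x, s). x + s *\<^sub>R v) ` (K \<times> {0..1}))"
    and "x \<notin> (\<lambda>(x, s). x + s *\<^sub>R v) ` (K \<times> {0..1}) \<Longrightarrow> avg k v \<phi> x = 0"
proof -
  show "compact ((\<lambda>(x, s). x + s *\<^sub>R v) ` (K \<times> {0..1}))"
    unfolding split_def
    by (intro compact_continuous_image compact_Times assms compact_Icc continuous_intros)
  assume x: "x \<notin> (\<lambda>(x, s). x + s *\<^sub>R v) ` (K \<times> {0..1})"
  have "\<phi> (x - s *\<^sub>R v) = 0" if "s \<in> {0..1}" for s
  proof -
    have "x - s *\<^sub>R v \<notin> K"
    proof
      assume "x - s *\<^sub>R v \<in> K"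
      with that have "(x - s *\<^sub>R v, s) \<in> K \<times> {0..1}" by simp
      then have "(\<lambda>(x, s). x + s *\<^sub>R v) (x - s *\<^sub>R v, s) \<in> (\<lambda>(x, s). x + s *\<^sub>R v) ` (K \<times> {0..1})" by (rule imageI)
      with x show False by simp
    qed
    then show ?thesis using assms(2) by blast
  qed
  then have "avg k v \<phi> x = integral {0..1} (\<lambda>s::real. 0 :: real)"
    unfolding avg_def by (intro integral_cong) auto
  then show "avg k v \<phi> x = 0" by simp
qed

lemma avg_test_UNIV:
  assumes "\<phi> \<in> test_functions UNIV" "continuous_on {0..1} k"
  shows "avg k v \<phi> \<in> test_functions UNIV"
proof -
  obtain K where K: "smooth \<phi>" "compact K" "\<forall>x. x \<notin> K \<longrightarrow> \<phi> x = 0"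
    using assms(1) by (auto elim: test_functionsE)
  show ?thesis
    by (rule test_functionsI[OF smooth_avg[OF K(1) assms(2)] avg_support(1)[OF K(2,3), of v] subset_UNIV])
      (rule avg_support(2)[OF K(2,3)])
qed

text \<open>
  No Fubini theorem is needed: \<open>\<phi> - A\<phi>\<close> is a directional derivative of a test function.
\<close>

lemma integral_avg1:
  assumes "\<phi> \<in> test_functions UNIV"
  shows "(\<integral>x. avg1 v \<phi> x \<partial>lborel) = (\<integral>x. \<phi> x \<partial>lborel)"
proof -
  have B: "avg (\<lambda>s. 1 - s) v \<phi> \<in> test_functions UNIV"
    by (intro avg_test_UNIV assms continuous_intros)
  have A: "avg1 v \<phi> \<in> test_functions UNIV"
    by (intro avg_test_UNIV assms continuous_intros)
  have "0 = (\<integral>x. \<phi> x - avg1 v \<phi> x \<partial>lborel)"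
    using integral_dird_zero[OF B, of v] by (simp add: diff_avg1[OF test_smooth[OF assms]])
  also have "\<dots> = (\<integral>x. \<phi> x \<partial>lborel) - (\<integral>x. avg1 v \<phi> x \<partial>lborel)"
    by (rule Bochner_Integration.integral_diff[OF test_integrable[OF assms] test_integrable[OF A]])
  finally show ?thesis by simp
qed

text \<open>Jensen's inequality for the square: the integral of \<open>(?f t - m)\<^sup>2\<close>
  over the unit interval is nonnegative, and the weight is at most 1 in absolute value.\<close>

lemma avg_sq_le:
  assumes s: "smooth \<phi>" and k: "continuous_on {0..1} k" "\<And>s. s \<in> {0..1} \<Longrightarrow> \<bar>k s\<bar> \<le> 1"
  shows "(avg k v \<phi> x)\<^sup>2 \<le> avg1 v (\<lambda>y. (\<phi> y)\<^sup>2) x"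
proof -
  let ?f = "\<lambda>t. k t * \<phi> (x - t *\<^sub>R v)"
  have c\<phi>: "continuous_on {0..1} (\<lambda>t. \<phi> (x - t *\<^sub>R v))"
    by (intro continuous_on_compose2[OF smooth_continuous[OF s, of UNIV]]) (auto intro!: continuous_intros)
  have cf: "continuous_on {0..1} ?f" by (intro continuous_intros k c\<phi>)
  define m where "m = avg k v \<phi> x"
  have i1: "(?f has_integral m) {0..1}"
    unfolding m_def avg_def using cf by (simp add: integrable_continuous_real integrable_integral)
  have i2: "((\<lambda>t. (?f t)\<^sup>2) has_integral integral {0..1} (\<lambda>t. (?f t)\<^sup>2)) {0..1}"
    by (rule integrable_integral[OF integrable_continuous_real[OF continuous_on_power[OF cf]]])
  have i3: "((\<lambda>t. (\<phi> (x - t *\<^sub>R v))\<^sup>2) has_integral avg1 v (\<lambda>y. (\<phi> y)\<^sup>2) x) {0..1}"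
    unfolding avg_def using c\<phi> by (simp add: integrable_continuous_real integrable_integral continuous_intros)
  have i4: "((\<lambda>t::real. m\<^sup>2) has_integral m\<^sup>2) {0..1}"
    using has_integral_const_real[of "m\<^sup>2" 0 1] by simp
  have "((\<lambda>t. (?f t)\<^sup>2 - (2 * m) * ?f t + m\<^sup>2) has_integral
      integral {0..1} (\<lambda>t. (?f t)\<^sup>2) - (2 * m) * m + m\<^sup>2) {0..1}"
    by (intro has_integral_add has_integral_diff i2 i4 has_integral_mult_right i1)
  then have "0 \<le> integral {0..1} (\<lambda>t. (?f t)\<^sup>2) - (2 * m) * m + m\<^sup>2"
  proof (rule has_integral_nonneg)
    fix t :: real
    have "(?f t)\<^sup>2 - (2 * m) * ?f t + m\<^sup>2 = (?f t - m)\<^sup>2" by (simp add: power2_diff)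
    then show "0 \<le> (?f t)\<^sup>2 - (2 * m) * ?f t + m\<^sup>2" by simp
  qed
  moreover have "integral {0..1} (\<lambda>t. (?f t)\<^sup>2) \<le> avg1 v (\<lambda>y. (\<phi> y)\<^sup>2) x"
  proof (rule has_integral_le[OF i2 i3])
    fix t :: real assume "t \<in> {0..1}"
    then have "(k t)\<^sup>2 \<le> 1" using k(2) abs_square_le_1 by blast
    then show "(?f t)\<^sup>2 \<le> (\<phi> (x - t *\<^sub>R v))\<^sup>2"
      by (simp add: power_mult_distrib mult_left_le_one_le)
  qed
  ultimately show ?thesis by (simp add: m_def power2_eq_square)
qed

lemma L2_norm_sq_lborel:
  fixes \<phi> :: "'a::euclidean_space \<Rightarrow> real"
  assumes "smooth \<phi>"
  shows "(L2_norm UNIV \<phi>)\<^sup>2 = (\<integral>x. (\<phi> x)\<^sup>2 \<partial>lborel)"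
proof -
  have "(L2_norm UNIV \<phi>)\<^sup>2 = (\<integral>x. (\<phi> x)\<^sup>2 \<partial>lebesgue)"
    by (simp add: L2_norm_def lebesgue_on_UNIV_eq)
  also have "\<dots> = (\<integral>x. (\<phi> x)\<^sup>2 \<partial>lborel)"
    using smooth_measurable[OF assms] by (intro integral_lborel_lebesgue) auto
  finally show ?thesis .
qed

lemma sq_test: "\<phi> \<in> test_functions \<omega> \<Longrightarrow> (\<lambda>x. (\<phi> x)\<^sup>2 :: real) \<in> test_functions \<omega>"
  using test_scaleR_left[of \<phi> \<omega> \<phi>] by (simp add: power2_eq_square test_smooth)

text \<open>Averaging preserves integrals, so the pointwise bound for squares becomes a contraction
  estimate.\<close>

lemma avg_L2_norm:
  assumes t: "\<phi> \<in> test_functions UNIV" and k: "continuous_on {0..1} k" "\<And>s. s \<in> {0..1} \<Longrightarrow> \<bar>k s\<bar> \<le> 1"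
  shows "L2_norm UNIV (avg k v \<phi>) \<le> L2_norm UNIV \<phi>"
proof (rule power2_le_imp_le)
  note s = test_smooth[OF t]
  have "(L2_norm UNIV (avg k v \<phi>))\<^sup>2 = (\<integral>x. (avg k v \<phi> x)\<^sup>2 \<partial>lborel)"
    by (rule L2_norm_sq_lborel[OF smooth_avg[OF s k(1)]])
  also have "\<dots> \<le> (\<integral>x. avg1 v (\<lambda>y. (\<phi> y)\<^sup>2) x \<partial>lborel)"
    by (intro integral_mono test_integrable[where \<omega>=UNIV] sq_test avg_test_UNIV t k continuous_on_const avg_sq_le s)
  also have "\<dots> = (\<integral>x. (\<phi> x)\<^sup>2 \<partial>lborel)" by (rule integral_avg1[OF sq_test[OF t]])
  also have "\<dots> = (L2_norm UNIV \<phi>)\<^sup>2" by (rule L2_norm_sq_lborel[OF s, symmetric])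
  finally show "(L2_norm UNIV (avg k v \<phi>))\<^sup>2 \<le> (L2_norm UNIV \<phi>)\<^sup>2" .
qed simp

lemma L2_norm_translate:
  fixes \<phi> :: "'a::euclidean_space \<Rightarrow> real"
  assumes "smooth \<phi>"
  shows "L2_norm UNIV (\<lambda>x. \<phi> (x - v)) = L2_norm UNIV \<phi>"
proof -
  have s: "smooth (\<lambda>x. \<phi> (x - v))" using smooth_translate[OF assms, of "- v"] by simp
  have m: "(\<lambda>x. (\<phi> x)\<^sup>2) \<in> borel_measurable borel" using smooth_measurable[OF assms] by simp
  have "(L2_norm UNIV (\<lambda>x. \<phi> (x - v)))\<^sup>2 = (L2_norm UNIV \<phi>)\<^sup>2"
    using lborel_translate(2)[OF m, of "- v"] by (simp add: L2_norm_sq_lborel[OF s] L2_norm_sq_lborel[OF assms])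
  then show ?thesis by simp
qed

text \<open>
  \<open>seg_sum vs\<close> is the Minkowski sum of the segments from \<open>0\<close> to the vectors of \<open>vs\<close>; averaging over
  these segments enlarges supports by it.
\<close>

fun avgs :: "'a::euclidean_space list \<Rightarrow> ('a \<Rightarrow> real) \<Rightarrow> 'a \<Rightarrow> real" where
  "avgs [] \<phi> = \<phi>"
| "avgs (v # vs) \<phi> = avgs vs (avg1 v \<phi>)"

fun seg_sum :: "'a::euclidean_space list \<Rightarrow> 'a set" where
  "seg_sum [] = {0}"
| "seg_sum (v # vs) = {s *\<^sub>R v + y | s y. s \<in> {0..1} \<and> y \<in> seg_sum vs}"

lemma zero_in_seg_sum: "0 \<in> seg_sum vs"
  by (induction vs) (force intro: exI[of _ 0])+

lemma avgs_test_UNIV: "\<phi> \<in> test_functions UNIV \<Longrightarrow> avgs vs \<phi> \<in> test_functions UNIV"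
proof (induction vs arbitrary: \<phi>)
  case (Cons v vs)
  show ?case unfolding avgs.simps by (rule Cons.IH[OF avg_test_UNIV[OF Cons.prems continuous_on_const]])
qed simp

lemma dird_avgs: "smooth \<phi> \<Longrightarrow> dird u (avgs vs \<phi>) = avgs vs (dird u \<phi>)"
  by (induction vs arbitrary: \<phi>) (auto simp: dird_avg smooth_avg)

lemma avgs_L2_norm: "\<phi> \<in> test_functions UNIV \<Longrightarrow> L2_norm UNIV (avgs vs \<phi>) \<le> L2_norm UNIV \<phi>"
proof (induction vs arbitrary: \<phi>)
  case (Cons v vs)
  have "L2_norm UNIV (avgs vs (avg1 v \<phi>)) \<le> L2_norm UNIV (avg1 v \<phi>)"
    by (rule Cons.IH[OF avg_test_UNIV[OF Cons.prems]]) simp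
  also have "\<dots> \<le> L2_norm UNIV \<phi>" by (rule avg_L2_norm[OF Cons.prems]) auto
  finally show ?case by simp
qed simp

text \<open>Averages commute with derivatives, so the derivative can be moved onto the average along
  \<open>u\<close>, where it becomes the difference of a function and its translate; this is the
  factor 2. All other averages are contractions.\<close>

lemma L2_norm_dird_avgs:
  assumes "\<phi> \<in> test_functions UNIV" "u \<in> set vs"
  shows "L2_norm UNIV (dird u (avgs vs \<phi>)) \<le> 2 * L2_norm UNIV \<phi>"
  using assms
proof (induction vs arbitrary: \<phi>)
  case (Cons v vs)
  note t = avg_test_UNIV[OF Cons.prems(1), of "\<lambda>_. 1" v, simplified]
  show ?case
  proof (cases "u = v")
    case False
    then have "L2_norm UNIV (dird u (avgs vs (avg1 v \<phi>))) \<le> 2 * L2_norm UNIV (avg1 v \<phi>)"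
      using Cons.prems(2) by (intro Cons.IH t) auto
    also have "\<dots> \<le> 2 * L2_norm UNIV \<phi>"
      using avg_L2_norm[OF Cons.prems(1), of "\<lambda>_. 1" v] by simp
    finally show ?thesis by simp
  next
    case True
    note s = test_smooth[OF Cons.prems(1)]
    have sh: "(\<lambda>x. \<phi> (x - v)) \<in> L2_space UNIV"
    proof -
      obtain K where K: "compact K" "\<forall>x. x \<notin> K \<longrightarrow> \<phi> x = 0"
        using Cons.prems(1) by (auto elim: test_functionsE)
      have "(\<lambda>x. \<phi> (x - v)) \<in> test_functions UNIV"
      proof (rule test_functionsI)
        show "smooth (\<lambda>x. \<phi> (x - v))" using smooth_translate[OF s, of "- v"] by simp
        show "compact ((+) v ` K)" using K(1) by (rule compact_translation)
        show "\<phi> (x - v) = 0" if "x \<notin> (+) v ` K" for x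
        proof -
          have "x - v \<notin> K" using that by (metis add_diff_cancel_left' diff_add_cancel add.commute imageI)
          then show ?thesis using K(2) by blast
        qed
      qed simp
      then show ?thesis by (rule test_in_L2) simp
    qed
    have "L2_norm UNIV (dird u (avgs (v # vs) \<phi>)) = L2_norm UNIV (avgs vs (dird v (avg1 v \<phi>)))"
      using True by (simp add: dird_avgs smooth_avg s)
    also have "\<dots> \<le> L2_norm UNIV (dird v (avg1 v \<phi>))"
      by (intro avgs_L2_norm dird_test t)
    also have "dird v (avg1 v \<phi>) = (\<lambda>x. \<phi> x - \<phi> (x - v))" using dird_avg1[OF s] by blast
    also have "L2_norm UNIV (\<lambda>x. \<phi> x - \<phi> (x - v)) \<le> L2_norm UNIV \<phi> + L2_norm UNIV (\<lambda>x. \<phi> (x - v))"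
      using test_in_L2[OF Cons.prems(1)] by (intro L2_norm_triangle_diff sh) auto
    also have "\<dots> = 2 * L2_norm UNIV \<phi>" using L2_norm_translate[OF s] by simp
    finally show ?thesis .
  qed
qed simp

lemma L2_norm_scaleR_const:
  fixes \<phi> :: "'a::euclidean_space \<Rightarrow> real"
  shows "L2_norm \<omega> (\<lambda>x. \<phi> x *\<^sub>R v) = L2_norm \<omega> \<phi> * norm v"
  by (simp add: L2_norm_def power_mult_distrib real_sqrt_mult)

lemma divg_const_direction:
  assumes "smooth \<phi>"
  shows "divg (\<lambda>x. \<phi> x *\<^sub>R v) x = dird v \<phi> x"
  using divg_scaleR[OF assms smooth_const[of v]] grad_inner[OF assms]
  by (simp add: divg_def)

text \<open>Telescoping: every average differs from its argument by the divergence of a scalar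
  multiple of its direction, and \<open>\<psi>\<close> collects these multiples. Each step enlarges
  the support by one segment, which the induction moves from \<open>seg_sum\<close> into
  \<open>K\<close>.\<close>

lemma avgs_decomposition:
  fixes \<phi> :: "'a::euclidean_space \<Rightarrow> real"
  assumes "smooth \<phi>" "compact K" "\<forall>x. x \<notin> K \<longrightarrow> \<phi> x = 0"
    and "\<And>x y. x \<in> K \<Longrightarrow> y \<in> seg_sum vs \<Longrightarrow> x + y \<in> \<omega>"
  shows "avgs vs \<phi> \<in> test_functions \<omega> \<and>
    (\<exists>\<psi>\<in>test_functions \<omega>. (\<forall>x. \<phi> x = avgs vs \<phi> x + divg \<psi> x) \<and>
      L2_norm UNIV \<psi> \<le> (\<Sum>v\<leftarrow>vs. norm v) * L2_norm UNIV \<phi>)"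
  using assms
proof (induction vs arbitrary: \<phi> K)
  case Nil
  have "divg (\<lambda>x::'a. 0::'a) = (\<lambda>x. 0)" by (auto simp: divg_def)
  moreover have "\<phi> \<in> test_functions \<omega>"
    using Nil by (intro test_functionsI[of \<phi> K]) auto
  ultimately show ?case using test_zero[of \<omega>, where ?'b = 'a]
    by (intro conjI bexI[of _ "\<lambda>x. 0"]) (auto simp: L2_norm_def)
next
  case (Cons v vs)
  note s = Cons.prems(1) and K = Cons.prems(2,3)
  have tU: "\<phi> \<in> test_functions UNIV" using s K by (intro test_functionsI[of \<phi> K]) auto
  let ?K = "(\<lambda>(x, s). x + s *\<^sub>R v) ` (K \<times> {0..1})"
  have K'\<omega>: "x + y \<in> \<omega>" if x: "x \<in> ?K" and y: "y \<in> seg_sum vs" for x y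
  proof -
    obtain z t where z: "z \<in> K" "t \<in> {0..1}" "x = z + t *\<^sub>R v" using x by auto
    have "t *\<^sub>R v + y \<in> seg_sum (v # vs)" using z y by auto
    from Cons.prems(4)[OF z(1) this] show ?thesis by (simp add: z(3) add.assoc)
  qed
  have "avg1 v \<phi> x = 0" if "x \<notin> ?K" for x by (rule avg_support(2)[OF K that])
  then have IH: "avgs vs (avg1 v \<phi>) \<in> test_functions \<omega> \<and>
    (\<exists>\<psi>\<in>test_functions \<omega>. (\<forall>x. avg1 v \<phi> x = avgs vs (avg1 v \<phi>) x + divg \<psi> x) \<and>
      L2_norm UNIV \<psi> \<le> (\<Sum>v\<leftarrow>vs. norm v) * L2_norm UNIV (avg1 v \<phi>))"
    using K'\<omega> by (intro Cons.IH[of _ ?K] smooth_avg s avg_support(1)[OF K]) auto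
  then obtain \<psi> where \<psi>: "\<psi> \<in> test_functions \<omega>" "\<And>x. avg1 v \<phi> x = avgs vs (avg1 v \<phi>) x + divg \<psi> x"
    "L2_norm UNIV \<psi> \<le> (\<Sum>v\<leftarrow>vs. norm v) * L2_norm UNIV (avg1 v \<phi>)" by blast
  let ?B = "avg (\<lambda>s. 1 - s) v \<phi>"
  have cB: "continuous_on {0..1} (\<lambda>s::real. 1 - s)" by (intro continuous_intros)
  have B: "?B \<in> test_functions \<omega>"
  proof (rule test_functionsI[OF smooth_avg[OF s cB] avg_support(1)[OF K]])
    \<comment> \<open>Take the zero vector of \<open>seg_sum vs\<close>: \<open>?K\<close> alone
      already contains the support of \<open>?B\<close>.\<close>
    show "?K \<subseteq> \<omega>" using K'\<omega>[OF _ zero_in_seg_sum] by auto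
  qed (rule avg_support(2)[OF K])
  have sB: "smooth ?B" by (rule test_smooth[OF B])
  have Bv: "(\<lambda>x. ?B x *\<^sub>R v) \<in> test_functions \<omega>" by (rule test_scaleR_left[OF B smooth_const])
  let ?\<psi> = "\<lambda>x. \<psi> x + ?B x *\<^sub>R v"
  have "divg ?\<psi> x = divg \<psi> x + divg (\<lambda>x. ?B x *\<^sub>R v) x" for x
    using dird_add[OF test_smooth[OF \<psi>(1)] test_smooth[OF Bv]]
    by (simp add: divg_eq inner_add_left sum.distrib)
  then have "\<phi> x = avgs (v # vs) \<phi> x + divg ?\<psi> x" for x
    using divg_const_direction[OF sB] diff_avg1[OF s] \<psi>(2)[of x] by simp
  moreover have "L2_norm UNIV ?\<psi> \<le> (\<Sum>v\<leftarrow>v # vs. norm v) * L2_norm UNIV \<phi>"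
  proof -
    have "L2_norm UNIV ?\<psi> \<le> L2_norm UNIV \<psi> + L2_norm UNIV (\<lambda>x. ?B x *\<^sub>R v)"
      by (rule L2_norm_triangle; rule test_in_L2[OF \<psi>(1)] test_in_L2[OF Bv]; simp)
    also have "L2_norm UNIV (\<lambda>x. ?B x *\<^sub>R v) \<le> norm v * L2_norm UNIV \<phi>"
      using avg_L2_norm[OF tU cB, of v] by (simp add: L2_norm_scaleR_const mult.commute mult_left_mono)
    also have "L2_norm UNIV \<psi> \<le> (\<Sum>v\<leftarrow>vs. norm v) * L2_norm UNIV \<phi>"
      by (rule order_trans[OF \<psi>(3)], rule mult_left_mono[OF avg_L2_norm[OF tU]])
        (auto intro!: sum_list_nonneg)
    finally show ?thesis by (simp add: algebra_simps)
  qed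
  ultimately show ?case
    using conjunct1[OF IH] test_add[OF \<psi>(1) Bv] unfolding avgs.simps by blast
qed

section \<open>Square integrability of the divergence\<close>

lemma seg_sum_cone:
  assumes "0 \<in> C" "\<And>x y. x \<in> C \<Longrightarrow> y \<in> C \<Longrightarrow> x + y \<in> C" "\<And>s x. s \<in> {0..1} \<Longrightarrow> x \<in> C \<Longrightarrow> s *\<^sub>R x \<in> C"
    and "set vs \<subseteq> C"
  shows "seg_sum vs \<subseteq> C"
  using assms(4) by (induction vs) (auto intro!: assms(1-3))

lemma seg_sum_norm: "y \<in> seg_sum vs \<Longrightarrow> norm y \<le> (\<Sum>v\<leftarrow>vs. norm v)"
proof (induction vs arbitrary: y)
  case (Cons v vs)
  then obtain s z where z: "y = s *\<^sub>R v + z" "s \<in> {0..1}" "z \<in> seg_sum vs" by auto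
  have "norm y \<le> norm (s *\<^sub>R v) + norm z" unfolding z(1) by (rule norm_triangle_ineq)
  also have "norm (s *\<^sub>R v) \<le> norm v" using z(2) by (simp add: mult_left_le_one_le)
  also have "norm z \<le> (\<Sum>v\<leftarrow>vs. norm v)" by (rule Cons.IH[OF z(3)])
  finally show ?case by simp
qed simp

text \<open>Differences of these directions recover every \<open>\<kappa> *\<^sub>R b\<close>,
  although for small \<open>\<kappa>\<close> all of them stay close to \<open>v0\<close>. The total
  length matters because it bounds the vectors of \<open>seg_sum\<close>.\<close>

lemma direction_list:
  fixes v0 :: "'a::euclidean_space"
  assumes "\<kappa> > 0"
  obtains vs where "set vs = insert v0 ((\<lambda>b. v0 + \<kappa> *\<^sub>R b) ` Basis)"
    "(\<Sum>v\<leftarrow>vs. norm v) \<le> real (DIM('a) + 1) * (norm v0 + \<kappa>)"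
proof -
  obtain bs :: "'a list" where bs: "set bs = Basis" "distinct bs"
    using finite_distinct_list[OF finite_Basis] by blast
  have le: "norm (v0 + \<kappa> *\<^sub>R b) \<le> norm v0 + \<kappa>" if "b \<in> Basis" for b
    using norm_triangle_ineq[of v0 "\<kappa> *\<^sub>R b"] that assms by simp
  have "(\<Sum>b\<leftarrow>bs. norm (v0 + \<kappa> *\<^sub>R b)) = (\<Sum>b\<in>Basis. norm (v0 + \<kappa> *\<^sub>R b))"
    using bs by (metis sum_list_distinct_conv_sum_set)
  also have "\<dots> \<le> real DIM('a) * (norm v0 + \<kappa>)"
    using sum_bounded_above[of Basis "\<lambda>b. norm (v0 + \<kappa> *\<^sub>R b)", OF le] by simp
  finally have "(\<Sum>v\<leftarrow>v0 # map (\<lambda>b. v0 + \<kappa> *\<^sub>R b) bs. norm v) \<le> real (DIM('a) + 1) * (norm v0 + \<kappa>)"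
    using assms by (simp add: o_def algebra_simps)
  moreover have "set (v0 # map (\<lambda>b. v0 + \<kappa> *\<^sub>R b) bs) = insert v0 ((\<lambda>b. v0 + \<kappa> *\<^sub>R b) ` Basis)"
    using bs by simp
  ultimately show thesis using that by blast
qed

text \<open>
  At a boundary point, the directions are small perturbations of \<open>- e\<close> inside the convex cone
  \<open>{y. L \<parallel>y - (y \<bullet> e) e\<parallel> \<le> - (y \<bullet> e)}\<close>, and a translation by a vector of this cone cannot leave the
  subgraph of an \<open>L\<close>-Lipschitz function.
\<close>

lemma local_directions:
  fixes \<Omega> :: "'a::euclidean_space set"
  assumes lip: "lipschitz_domain \<Omega>" and p: "p \<in> closure \<Omega>"
  obtains r vs v0 \<kappa> where "r > 0" "\<kappa> > 0" "insert v0 ((\<lambda>b. v0 + \<kappa> *\<^sub>R b) ` Basis) \<subseteq> set vs"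
    "\<And>x y. x \<in> \<Omega> \<Longrightarrow> x \<in> cball p r \<Longrightarrow> y \<in> seg_sum vs \<Longrightarrow> x + y \<in> \<Omega>"
proof (cases "p \<in> \<Omega>")
  case True
  have "open \<Omega>" using lip by (simp add: lipschitz_domain_def)
  with True obtain \<rho> where \<rho>: "\<rho> > 0" "ball p \<rho> \<subseteq> \<Omega>" by (meson openE)
  define N where "N = real (DIM('a) + 1)"
  have N: "N > 0" by (simp add: N_def)
  \<comment> \<open>Here \<open>v0 = 0\<close>, so the total length is at most
    \<open>N * \<kappa> = \<rho> / 4\<close>; starting in \<open>cball p (\<rho> / 2)\<close>, the
    translates stay in \<open>ball p \<rho>\<close>.\<close>
  define \<kappa> where "\<kappa> = \<rho> / (4 * N)"
  have \<kappa>: "\<kappa> > 0" using \<rho>(1) N by (simp add: \<kappa>_def)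
  obtain vs :: "'a list" where vs: "set vs = insert 0 ((\<lambda>b. 0 + \<kappa> *\<^sub>R b) ` Basis)"
    "(\<Sum>v\<leftarrow>vs. norm v) \<le> real (DIM('a) + 1) * (norm (0::'a) + \<kappa>)"
    by (rule direction_list[OF \<kappa>])
  have "(\<Sum>v\<leftarrow>vs. norm v) \<le> \<rho> / 4" using vs(2) N unfolding N_def[symmetric] \<kappa>_def by simp
  show thesis
  proof (rule that[of "\<rho> / 2" \<kappa> 0 vs])
    fix x y assume "x \<in> cball p (\<rho> / 2)" "y \<in> seg_sum vs"
    then have "dist p (x + y) \<le> \<rho> / 2 + \<rho> / 4"
      using dist_triangle[of p "x + y" x] seg_sum_norm[of y vs] \<open>_ \<le> \<rho> / 4\<close> by (simp add: dist_norm)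
    then have "dist p (x + y) < \<rho>" using \<rho>(1) by simp
    then show "x + y \<in> \<Omega>" using \<rho>(2) by auto
  qed (use \<rho>(1) \<kappa> vs(1) in auto)
next
  case False
  have o: "open \<Omega>" using lip by (simp add: lipschitz_domain_def)
  then have "p \<in> frontier \<Omega>" using p False by (simp add: frontier_def interior_open)
  then obtain U e g L where U: "open U" "p \<in> U" and e: "norm e = 1"
    and g: "L-lipschitz_on {y. y \<bullet> e = 0} g" 
    and graph: "\<Omega> \<inter> U = {x \<in> U. x \<bullet> e < g (x - (x \<bullet> e) *\<^sub>R e)}"
    using lip unfolding lipschitz_domain_def by meson
  obtain \<rho> where \<rho>: "\<rho> > 0" "ball p \<rho> \<subseteq> U" using U by (meson openE)
  have L: "L \<ge> 0" using g by (rule lipschitz_on_nonneg)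
  \<comment> \<open>The solution of \<open>L * (2 * \<delta>) = 1 - \<delta>\<close>: the part of
    \<open>\<delta> *\<^sub>R b\<close> orthogonal to \<open>e\<close> is at most
    \<open>2 * \<delta>\<close> and its part along \<open>e\<close> at most \<open>\<delta>\<close>,
    so \<open>- e + \<delta> *\<^sub>R b\<close> satisfies the cone condition.\<close>
  define \<delta> where "\<delta> = 1 / (2 * L + 1)"
  define N where "N = real (DIM('a) + 1)"
  have N: "N > 0" by (simp add: N_def)
  \<comment> \<open>Each of the \<open>N\<close> directions has length at most
    \<open>2 * \<eta>\<close>, so together they measure at most \<open>\<rho> / 4\<close>.\<close>
  define \<eta> where "\<eta> = \<rho> / (8 * N)"
  have \<delta>: "\<delta> > 0" "\<delta> \<le> 1" "L * (2 * \<delta>) = 1 - \<delta>" using L by (auto simp: \<delta>_def field_simps)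
  have \<eta>: "\<eta> > 0" using \<rho>(1) N by (simp add: \<eta>_def)
  have ee: "e \<bullet> e = 1" using e by (simp add: norm_eq_1)
  define v0 where "v0 = - (\<eta> *\<^sub>R e)"
  have nv0: "norm v0 = \<eta>" using \<eta> e by (simp add: v0_def)
  have \<kappa>: "\<eta> * \<delta> > 0" using \<eta> \<delta> by simp
  obtain vs :: "'a list" where vs: "set vs = insert v0 ((\<lambda>b. v0 + (\<eta> * \<delta>) *\<^sub>R b) ` Basis)"
    "(\<Sum>v\<leftarrow>vs. norm v) \<le> real (DIM('a) + 1) * (norm v0 + \<eta> * \<delta>)"
    by (rule direction_list[OF \<kappa>])
  have "\<eta> * \<delta> \<le> \<eta>" using \<eta> \<delta> by simp
  then have "real (DIM('a) + 1) * (norm v0 + \<eta> * \<delta>) \<le> real (DIM('a) + 1) * (2 * \<eta>)"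
    unfolding nv0 by (intro mult_left_mono) auto
  also have "\<dots> = \<rho> / 4" using N unfolding N_def[symmetric] \<eta>_def by simp
  finally have sum: "(\<Sum>v\<leftarrow>vs. norm v) \<le> \<rho> / 4" using vs(2) by linarith
  define pr where "pr y = y - (y \<bullet> e) *\<^sub>R e" for y
  have pr_add: "pr (x + y) = pr x + pr y" and pr_scale: "pr (c *\<^sub>R y) = c *\<^sub>R pr y"
    and pr_orth: "pr y \<bullet> e = 0" for x y c
    by (simp_all add: pr_def inner_add_left inner_diff_left algebra_simps ee)
  define C where "C = {y. L * norm (pr y) \<le> - (y \<bullet> e)}"
  have C0: "0 \<in> C" by (simp add: C_def pr_def)
  have Cadd: "x + y \<in> C" if "x \<in> C" "y \<in> C" for x y
  proof -
    have "L * norm (pr x + pr y) \<le> L * (norm (pr x) + norm (pr y))"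
      by (rule mult_left_mono[OF norm_triangle_ineq L])
    then show ?thesis using that by (simp add: C_def pr_add inner_add_left algebra_simps)
  qed
  have Cscale: "s *\<^sub>R y \<in> C" if "s \<in> {0..1}" "y \<in> C" for s y
  proof -
    have "s * (L * norm (pr y)) \<le> s * (- (y \<bullet> e))"
      using that by (intro mult_left_mono) (auto simp: C_def)
    then show ?thesis using that by (simp add: C_def pr_scale mult.left_commute)
  qed
  have Cv0: "v0 \<in> C" using \<eta> by (simp add: C_def pr_def v0_def ee)
  have Cb: "v0 + (\<eta> * \<delta>) *\<^sub>R b \<in> C" if b: "b \<in> Basis" for b
  proof -
    have be: "\<bar>b \<bullet> e\<bar> \<le> 1" using Cauchy_Schwarz_ineq2[of b e] b e by simp
    have "norm (pr b) \<le> norm b + norm ((b \<bullet> e) *\<^sub>R e)" unfolding pr_def by (rule norm_triangle_ineq4)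
    then have "norm (pr b) \<le> 2" using be b e by simp
    then have "L * (\<eta> * \<delta> * norm (pr b)) \<le> L * (\<eta> * \<delta> * 2)"
      using L \<eta> \<delta> by (intro mult_left_mono) auto
    also have "\<dots> = \<eta> * (L * (2 * \<delta>))" by simp
    also have "\<dots> = \<eta> * (1 - \<delta>)" unfolding \<delta>(3) ..
    also have "\<dots> \<le> \<eta> * (1 - \<delta> * (b \<bullet> e))"
      using be \<delta> \<eta> by (intro mult_left_mono) (auto simp: mult_left_le)
    finally have "L * (\<eta> * \<delta> * norm (pr b)) \<le> \<eta> * (1 - \<delta> * (b \<bullet> e))" .
    moreover have "pr v0 = 0" by (simp add: v0_def pr_def ee)
    then have "pr (v0 + (\<eta> * \<delta>) *\<^sub>R b) = (\<eta> * \<delta>) *\<^sub>R pr b" by (simp add: pr_add pr_scale)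
    moreover have "(v0 + (\<eta> * \<delta>) *\<^sub>R b) \<bullet> e = \<eta> * \<delta> * (b \<bullet> e) - \<eta>"
      by (simp add: v0_def inner_diff_left inner_add_left ee)
    ultimately show ?thesis using \<eta> \<delta> by (simp add: C_def algebra_simps)
  qed
  have seg: "seg_sum vs \<subseteq> C"
    by (rule seg_sum_cone[OF C0 Cadd Cscale]) (use vs(1) Cv0 Cb in auto)
  show thesis
  proof (rule that[of "\<rho> / 2" "\<eta> * \<delta>" v0 vs])
    fix x y assume x: "x \<in> \<Omega>" "x \<in> cball p (\<rho> / 2)" and y: "y \<in> seg_sum vs"
    have "dist p (x + y) \<le> \<rho> / 2 + \<rho> / 4"
      using dist_triangle[of p "x + y" x] seg_sum_norm[OF y] sum x by (simp add: dist_norm)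
    then have "dist p (x + y) < \<rho>" using \<rho>(1) by simp
    then have xyU: "x + y \<in> U" using \<rho>(2) by auto
    have xU: "x \<in> U" using x(2) \<rho> by auto
    then have "x \<bullet> e < g (pr x)" using x(1) graph by (auto simp: pr_def)
    \<comment> \<open>Moving by \<open>y\<close> lowers the graph by at most
      \<open>L * norm (pr y)\<close>, whereas a vector of the cone lowers the height of the point by
      at least as much.\<close>
    moreover have "g (pr x) \<le> g (pr (x + y)) + L * norm (pr y)"
      using lipschitz_onD[OF g, of "pr x" "pr (x + y)"] pr_orth
      by (simp add: dist_norm pr_add inner_add_left abs_le_iff)
    moreover have "L * norm (pr y) \<le> - (y \<bullet> e)" using seg y by (auto simp: C_def)
    ultimately have "(x + y) \<bullet> e < g (pr (x + y))" by (simp add: inner_add_left)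
    then have "x + y \<in> \<Omega> \<inter> U" unfolding graph using xyU by (simp add: pr_def)
    then show "x + y \<in> \<Omega>" by simp
  qed (use \<rho>(1) \<kappa> vs(1) in auto)
qed

section \<open>Local bounds for the divergence\<close>

lemma test_L2_norm:
  fixes \<phi> :: "'a::euclidean_space \<Rightarrow> 'b::euclidean_space"
  assumes "open \<omega>" "\<phi> \<in> test_functions \<omega>"
  shows "L2_norm \<omega> \<phi> = L2_norm UNIV \<phi>"
proof -
  have "L2_inner \<omega> \<phi> \<phi> = L2_inner UNIV \<phi> \<phi>"
    by (rule L2_inner_test_subset) (use assms in auto)
  then have "(L2_norm \<omega> \<phi>)\<^sup>2 = (L2_norm UNIV \<phi>)\<^sup>2" by (simp only: L2_norm_sq)
  then show ?thesis by simp
qed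

lemma L2_norm_sum:
  fixes f :: "'i \<Rightarrow> 'a::euclidean_space \<Rightarrow> 'b::euclidean_space"
  assumes "finite I" "\<And>i. i \<in> I \<Longrightarrow> f i \<in> L2_space \<omega>"
  shows "(\<lambda>x. \<Sum>i\<in>I. f i x) \<in> L2_space \<omega> \<and> L2_norm \<omega> (\<lambda>x. \<Sum>i\<in>I. f i x) \<le> (\<Sum>i\<in>I. L2_norm \<omega> (f i))"
  using assms
proof (induction I rule: finite_induct)
  case empty
  then show ?case by (simp add: zero_in_L2 L2_norm_def)
next
  case (insert i I)
  then have IH: "(\<lambda>x. \<Sum>i\<in>I. f i x) \<in> L2_space \<omega>" "L2_norm \<omega> (\<lambda>x. \<Sum>i\<in>I. f i x) \<le> (\<Sum>i\<in>I. L2_norm \<omega> (f i))"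
    by auto
  have fi: "f i \<in> L2_space \<omega>" using insert.prems by simp
  show ?case
    using insert.hyps add_in_L2[OF fi IH(1)] L2_norm_triangle[OF fi IH(1)] IH(2) by simp
qed

text \<open>Every \<open>b\<close> is \<open>1 / \<kappa>\<close> times a difference of two averaged
  directions. The derivative along either costs a factor 2, whence \<open>4 / \<kappa>\<close> for
  each of the \<open>DIM('a)\<close> partial derivatives.\<close>

lemma grad_avgs_norm:
  fixes \<phi> :: "'a::euclidean_space \<Rightarrow> real"
  assumes t: "\<phi> \<in> test_functions UNIV" and "\<kappa> > 0"
    and vs: "insert v0 ((\<lambda>b. v0 + \<kappa> *\<^sub>R b) ` Basis) \<subseteq> set vs"
  shows "L2_norm UNIV (grad (avgs vs \<phi>)) \<le> real DIM('a) * (4 / \<kappa>) * L2_norm UNIV \<phi>"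
proof -
  let ?A = "avgs vs \<phi>"
  have tA: "?A \<in> test_functions UNIV" by (rule avgs_test_UNIV[OF t])
  have L2: "dird v ?A \<in> L2_space UNIV" for v by (rule test_in_L2[OF dird_test[OF tA]]) simp
  have b: "L2_norm UNIV (dird b ?A) \<le> 4 / \<kappa> * L2_norm UNIV \<phi>" if "b \<in> Basis" for b
  proof -
    have "dird b ?A x = (1 / \<kappa>) *\<^sub>R (dird (v0 + \<kappa> *\<^sub>R b) ?A x - dird v0 ?A x)" for x
      using \<open>\<kappa> > 0\<close> linear_add[OF dird_linear[OF test_smooth[OF tA]]] linear_cmul[OF dird_linear[OF test_smooth[OF tA]]]
      by simp
    then have "dird b ?A = (\<lambda>x. (1 / \<kappa>) *\<^sub>R (dird (v0 + \<kappa> *\<^sub>R b) ?A x - dird v0 ?A x))" by blast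
    then have "L2_norm UNIV (dird b ?A) = 1 / \<kappa> * L2_norm UNIV (\<lambda>x. dird (v0 + \<kappa> *\<^sub>R b) ?A x - dird v0 ?A x)"
      using L2_norm_scaleR[of UNIV "1 / \<kappa>" "\<lambda>x. dird (v0 + \<kappa> *\<^sub>R b) ?A x - dird v0 ?A x"] \<open>\<kappa> > 0\<close> by simp
    also have "\<dots> \<le> 1 / \<kappa> * (2 * L2_norm UNIV \<phi> + 2 * L2_norm UNIV \<phi>)"
    proof (rule mult_left_mono)
      show "L2_norm UNIV (\<lambda>x. dird (v0 + \<kappa> *\<^sub>R b) ?A x - dird v0 ?A x) \<le> 2 * L2_norm UNIV \<phi> + 2 * L2_norm UNIV \<phi>"
        by (rule order_trans[OF L2_norm_triangle_diff[OF L2 L2] add_mono[OF L2_norm_dird_avgs[OF t] L2_norm_dird_avgs[OF t]]])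
          (use vs that in auto)
    qed (use \<open>\<kappa> > 0\<close> in simp)
    finally show ?thesis by simp
  qed
  have e: "L2_norm UNIV (\<lambda>x. dird b ?A x *\<^sub>R b) = L2_norm UNIV (dird b ?A)" if "b \<in> Basis" for b
    using that by (simp add: L2_norm_scaleR_const)
  have "L2_norm UNIV (grad ?A) \<le> (\<Sum>b\<in>Basis. L2_norm UNIV (\<lambda>x. dird b ?A x *\<^sub>R b))"
    unfolding grad_eq
    by (rule conjunct2[OF L2_norm_sum]) (auto intro!: test_in_L2[OF test_scaleR_left[OF dird_test[OF tA] smooth_const]])
  also have "\<dots> \<le> (\<Sum>b\<in>(Basis::'a set). 4 / \<kappa> * L2_norm UNIV \<phi>)"
    by (intro sum_mono) (simp only: e b)
  finally show ?thesis by simp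
qed

lemma grad_add: "smooth f \<Longrightarrow> smooth g \<Longrightarrow> grad (\<lambda>x. f x + g x) = (\<lambda>x. grad f x + grad g x)"
  by (simp add: grad_eq dird_add scaleR_add_left sum.distrib)

lemma local_divergence_bound:
  fixes w :: "'a::euclidean_space \<Rightarrow> 'a"
  assumes \<omega>: "open \<omega>" and w: "w \<in> L2_space \<omega>" and g: "weak_graddiv \<omega> w g"
    and "\<kappa> > 0" and vs: "insert v0 ((\<lambda>b. v0 + \<kappa> *\<^sub>R b) ` Basis) \<subseteq> set vs"
    and seg: "\<And>x y. x \<in> \<omega> \<Longrightarrow> x \<in> cball p r \<Longrightarrow> y \<in> seg_sum vs \<Longrightarrow> x + y \<in> \<omega>"
  shows "\<exists>C\<ge>0. \<forall>\<phi>\<in>test_functions \<omega>. (\<forall>x. x \<notin> cball p r \<longrightarrow> \<phi> x = 0) \<longrightarrow>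
    \<bar>L2_inner \<omega> w (grad \<phi>)\<bar> \<le> C * L2_norm UNIV \<phi>"
proof (intro exI conjI ballI impI)
  \<comment> \<open>The first summand pays for the gradient of the average, the second for the part
    of \<open>\<phi>\<close> that is a divergence.\<close>
  let ?C = "L2_norm \<omega> w * (real DIM('a) * (4 / \<kappa>)) + L2_norm \<omega> g * (\<Sum>v\<leftarrow>vs. norm v)"
  show "0 \<le> ?C" using \<open>\<kappa> > 0\<close> by (auto intro!: add_nonneg_nonneg mult_nonneg_nonneg sum_list_nonneg)
  note \<omega>s = open_lebesgue[OF \<omega>]
  fix \<phi> :: "'a \<Rightarrow> real" assume t: "\<phi> \<in> test_functions \<omega>" and sp: "\<forall>x. x \<notin> cball p r \<longrightarrow> \<phi> x = 0"
  obtain K where K: "smooth \<phi>" "compact K" "K \<subseteq> \<omega>" "\<forall>x. x \<notin> K \<longrightarrow> \<phi> x = 0"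
    using t by (rule test_functionsE)
  have tU: "\<phi> \<in> test_functions UNIV" using t test_functions_mono by blast
  have "avgs vs \<phi> \<in> test_functions \<omega> \<and>
    (\<exists>\<psi>\<in>test_functions \<omega>. (\<forall>x. \<phi> x = avgs vs \<phi> x + divg \<psi> x) \<and>
      L2_norm UNIV \<psi> \<le> (\<Sum>v\<leftarrow>vs. norm v) * L2_norm UNIV \<phi>)"
  proof (rule avgs_decomposition[OF K(1), of "K \<inter> cball p r"])
    show "compact (K \<inter> cball p r)" using K(2) by (simp add: compact_Int)
  qed (use K(3,4) sp seg in auto)
  then obtain \<psi> where A: "avgs vs \<phi> \<in> test_functions \<omega>" and \<psi>: "\<psi> \<in> test_functions \<omega>"
    "\<And>x. \<phi> x = avgs vs \<phi> x + divg \<psi> x" "L2_norm UNIV \<psi> \<le> (\<Sum>v\<leftarrow>vs. norm v) * L2_norm UNIV \<phi>"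
    by blast
  have "grad \<phi> = grad (\<lambda>x. avgs vs \<phi> x + divg \<psi> x)" by (rule arg_cong[of _ _ grad]) (rule ext, rule \<psi>(2))
  also have "\<dots> = (\<lambda>x. grad (avgs vs \<phi>) x + grad (divg \<psi>) x)"
    by (rule grad_add[OF test_smooth[OF A] test_smooth[OF divg_test[OF \<psi>(1)]]])
  finally have "L2_inner \<omega> w (grad \<phi>) = L2_inner \<omega> w (grad (avgs vs \<phi>)) + L2_inner \<omega> w (grad (divg \<psi>))"
    using L2_inner_add_left[OF test_in_L2[OF grad_test[OF A] \<omega>s] test_in_L2[OF grad_test[OF divg_test[OF \<psi>(1)]] \<omega>s] w]
    by (simp add: L2_inner_commute[of \<omega> w])
  also have "L2_inner \<omega> w (grad (divg \<psi>)) = L2_inner \<omega> g \<psi>" by (rule weak_graddivD(2)[OF g \<psi>(1)])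
  finally have "\<bar>L2_inner \<omega> w (grad \<phi>)\<bar> \<le> \<bar>L2_inner \<omega> w (grad (avgs vs \<phi>))\<bar> + \<bar>L2_inner \<omega> g \<psi>\<bar>"
    by simp
  also have "\<bar>L2_inner \<omega> w (grad (avgs vs \<phi>))\<bar> \<le> L2_norm \<omega> w * L2_norm UNIV (grad (avgs vs \<phi>))"
    using L2_Cauchy_Schwarz[OF w test_in_L2[OF grad_test[OF A] \<omega>s]] by (simp add: test_L2_norm[OF \<omega> grad_test[OF A]])
  also have "\<dots> \<le> L2_norm \<omega> w * (real DIM('a) * (4 / \<kappa>) * L2_norm UNIV \<phi>)"
    by (intro mult_left_mono grad_avgs_norm[OF tU \<open>\<kappa> > 0\<close> vs]) simp
  also have "\<bar>L2_inner \<omega> g \<psi>\<bar> \<le> L2_norm \<omega> g * L2_norm UNIV \<psi>"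
    using L2_Cauchy_Schwarz[OF weak_graddivD(1)[OF g] test_in_L2[OF \<psi>(1) \<omega>s]] by (simp add: test_L2_norm[OF \<omega> \<psi>(1)])
  also have "\<dots> \<le> L2_norm \<omega> g * ((\<Sum>v\<leftarrow>vs. norm v) * L2_norm UNIV \<phi>)"
    by (intro mult_left_mono \<psi>(3)) simp
  finally show "\<bar>L2_inner \<omega> w (grad \<phi>)\<bar> \<le> ?C * L2_norm UNIV \<phi>"
    by (simp add: algebra_simps)
qed

section \<open>From local to global bounds\<close>

lemma L2_norm_mult_le:
  fixes \<phi> \<eta> :: "'a::euclidean_space \<Rightarrow> real"
  assumes "\<phi> \<in> L2_space \<omega>" "(\<lambda>x. \<eta> x * \<phi> x) \<in> L2_space \<omega>" "\<And>x. \<bar>\<eta> x\<bar> \<le> 1"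
  shows "L2_norm \<omega> (\<lambda>x. \<eta> x * \<phi> x) \<le> L2_norm \<omega> \<phi>"
  unfolding L2_norm_def
proof (intro real_sqrt_le_mono integral_mono)
  fix x
  have "\<bar>\<eta> x\<bar> * \<bar>\<phi> x\<bar> \<le> 1 * \<bar>\<phi> x\<bar>" using assms(3) by (intro mult_right_mono) auto
  then have "norm (\<eta> x * \<phi> x) \<le> norm (\<phi> x)" by (simp add: abs_mult)
  then show "(norm (\<eta> x * \<phi> x))\<^sup>2 \<le> (norm (\<phi> x))\<^sup>2" by (intro power_mono) auto
qed (use L2_spaceD(2)[OF assms(1)] L2_spaceD(2)[OF assms(2)] in auto)

text \<open>A partition of unity built one point at a time. The plateau function at \<open>p\<close>
  splits off a part handled by the bound at \<open>p\<close>; the rest vanishes on the ball of half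
  the radius, so it is covered by the remaining points. Neither cut increases the L2 norm, and no
  derivative of the cut-off enters the bound.\<close>

lemma glue_divergence_bounds:
  assumes \<omega>: "open \<omega>" and w: "w \<in> L2_space \<omega>" and "finite P"
    and r: "\<And>p. p \<in> P \<Longrightarrow> r p > 0"
    and C: "\<And>p. p \<in> P \<Longrightarrow> \<exists>C\<ge>0. \<forall>\<phi>\<in>test_functions \<omega>. (\<forall>x. x \<notin> cball p (r p) \<longrightarrow> \<phi> x = 0) \<longrightarrow>
      \<bar>L2_inner \<omega> w (grad \<phi>)\<bar> \<le> C * L2_norm UNIV \<phi>"
  shows "\<exists>C\<ge>0. \<forall>\<phi>\<in>test_functions \<omega>. (\<forall>x. \<phi> x \<noteq> 0 \<longrightarrow> (\<exists>p\<in>P. dist p x < r p / 2)) \<longrightarrow>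
      \<bar>L2_inner \<omega> w (grad \<phi>)\<bar> \<le> C * L2_norm UNIV \<phi>"
  using \<open>finite P\<close> r C
proof (induction P rule: finite_induct)
  case empty
  have "grad \<phi> = (\<lambda>x. 0)" if "\<forall>x. \<phi> x = 0" for \<phi> :: "'a \<Rightarrow> real"
  proof -
    have "\<phi> = (\<lambda>x. 0)" using that by blast
    then show ?thesis by (auto simp: grad_def)
  qed
  then show ?case by (auto simp: L2_inner_def intro!: exI[of _ 0])
next
  case (insert p P)
  obtain C1 where C1: "C1 \<ge> 0" "\<And>\<phi>. \<phi> \<in> test_functions \<omega> \<Longrightarrow> (\<forall>x. x \<notin> cball p (r p) \<longrightarrow> \<phi> x = 0) \<Longrightarrow>
      \<bar>L2_inner \<omega> w (grad \<phi>)\<bar> \<le> C1 * L2_norm UNIV \<phi>"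
    using insert.prems(2)[of p] by blast
  have "\<exists>C\<ge>0. \<forall>\<phi>\<in>test_functions \<omega>. (\<forall>x. \<phi> x \<noteq> 0 \<longrightarrow> (\<exists>p\<in>P. dist p x < r p / 2)) \<longrightarrow>
      \<bar>L2_inner \<omega> w (grad \<phi>)\<bar> \<le> C * L2_norm UNIV \<phi>"
    by (rule insert.IH) (use insert.prems in auto)
  then obtain C2 where C2: "C2 \<ge> 0" "\<And>\<phi>. \<phi> \<in> test_functions \<omega> \<Longrightarrow>
      (\<forall>x. \<phi> x \<noteq> 0 \<longrightarrow> (\<exists>p\<in>P. dist p x < r p / 2)) \<Longrightarrow>
      \<bar>L2_inner \<omega> w (grad \<phi>)\<bar> \<le> C2 * L2_norm UNIV \<phi>" by blast
  have "r p > 0" using insert.prems(1) by simp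
  then obtain \<eta> :: "'a \<Rightarrow> real" where \<eta>: "smooth \<eta>" "\<And>x. 0 \<le> \<eta> x" "\<And>x. \<eta> x \<le> 1"
    "\<And>x. dist p x \<le> r p / 2 \<Longrightarrow> \<eta> x = 1" "\<And>x. x \<notin> cball p (r p) \<Longrightarrow> \<eta> x = 0"
    using smooth_plateau by metis
  note \<omega>s = open_lebesgue[OF \<omega>]
  show ?case
  proof (intro exI[of _ "C1 + C2"] conjI ballI impI)
    show "0 \<le> C1 + C2" using C1(1) C2(1) by simp
    fix \<phi> :: "'a \<Rightarrow> real"
    assume t: "\<phi> \<in> test_functions \<omega>" and cov: "\<forall>x. \<phi> x \<noteq> 0 \<longrightarrow> (\<exists>p\<in>insert p P. dist p x < r p / 2)"
    let ?a = "\<lambda>x. \<eta> x * \<phi> x" and ?b = "\<lambda>x. (1 - \<eta> x) * \<phi> x"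
    have ta: "?a \<in> test_functions \<omega>" using test_scaleR_right[OF \<eta>(1) t] by simp
    have "smooth (\<lambda>x. 1 - \<eta> x)" by (intro smooth_intros \<eta>(1))
    from test_scaleR_right[OF this t] have tb: "?b \<in> test_functions \<omega>" by simp
    have "\<phi> = (\<lambda>x. ?a x + ?b x)" by (auto simp: algebra_simps)
    then have "grad \<phi> = (\<lambda>x. grad ?a x + grad ?b x)"
      using grad_add[OF test_smooth[OF ta] test_smooth[OF tb]] by simp
    then have "L2_inner \<omega> w (grad \<phi>) = L2_inner \<omega> w (grad ?a) + L2_inner \<omega> w (grad ?b)"
      using L2_inner_add_left[OF test_in_L2[OF grad_test[OF ta] \<omega>s] test_in_L2[OF grad_test[OF tb] \<omega>s] w]
      by (simp add: L2_inner_commute[of \<omega> w])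
    then have "\<bar>L2_inner \<omega> w (grad \<phi>)\<bar> \<le> \<bar>L2_inner \<omega> w (grad ?a)\<bar> + \<bar>L2_inner \<omega> w (grad ?b)\<bar>" by simp
    moreover have "\<bar>L2_inner \<omega> w (grad ?a)\<bar> \<le> C1 * L2_norm UNIV ?a"
      by (rule C1(2)[OF ta]) (use \<eta>(5) in simp)
    moreover have "\<bar>L2_inner \<omega> w (grad ?b)\<bar> \<le> C2 * L2_norm UNIV ?b"
    proof (rule C2(2)[OF tb], intro allI impI)
      fix x assume "?b x \<noteq> 0"
      then have "\<eta> x \<noteq> 1" "\<phi> x \<noteq> 0" by auto
      then have "\<not> dist p x \<le> r p / 2" using \<eta>(4) by blast
      then show "\<exists>p\<in>P. dist p x < r p / 2" using cov \<open>\<phi> x \<noteq> 0\<close> by force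
    qed
    moreover have "L2_norm UNIV ?a \<le> L2_norm UNIV \<phi>"
      by (rule L2_norm_mult_le) (use \<eta>(2,3) in \<open>auto intro: test_in_L2[OF t] test_in_L2[OF ta]\<close>)
    then have "C1 * L2_norm UNIV ?a \<le> C1 * L2_norm UNIV \<phi>" using C1(1) by (rule mult_left_mono)
    moreover have "L2_norm UNIV ?b \<le> L2_norm UNIV \<phi>"
      by (rule L2_norm_mult_le) (use \<eta>(2,3) in \<open>auto intro: test_in_L2[OF t] test_in_L2[OF tb]\<close>)
    then have "C2 * L2_norm UNIV ?b \<le> C2 * L2_norm UNIV \<phi>" using C2(1) by (rule mult_left_mono)
    ultimately show "\<bar>L2_inner \<omega> w (grad \<phi>)\<bar> \<le> (C1 + C2) * L2_norm UNIV \<phi>"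
      unfolding distrib_right by linarith
  qed
qed

text \<open>Compactness of the closure reduces the claim to finitely many local bounds. Minus the
  pairing of \<open>w\<close> with gradients is then an L2-bounded functional on test functions, and
  its representer is \<open>q\<close>. The gradient of \<open>q\<close> costs no further estimate:
  testing with a divergence gives back the hypothesis on \<open>w\<close>.\<close>

lemma divergence_regularity:
  fixes \<Omega> :: "'a::euclidean_space set"
  assumes bdd: "bounded \<Omega>" and lip: "lipschitz_domain \<Omega>" and w: "w \<in> L2_space \<Omega>" and g: "weak_graddiv \<Omega> w g"
  obtains q where "weak_div \<Omega> w q" "weak_grad \<Omega> q g"
proof -
  have \<Omega>: "open \<Omega>" using lip by (simp add: lipschitz_domain_def)
  note \<Omega>s = open_lebesgue[OF \<Omega>]
  have "\<exists>r>0. \<exists>C\<ge>0. \<forall>\<phi>\<in>test_functions \<Omega>. (\<forall>x. x \<notin> cball p r \<longrightarrow> \<phi> x = 0) \<longrightarrow>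
      \<bar>L2_inner \<Omega> w (grad \<phi>)\<bar> \<le> C * L2_norm UNIV \<phi>" if p: "p \<in> closure \<Omega>" for p
  proof -
    obtain r vs v0 \<kappa> where "r > 0" "\<kappa> > 0" "insert v0 ((\<lambda>b. v0 + \<kappa> *\<^sub>R b) ` Basis) \<subseteq> set vs"
      "\<And>x y. x \<in> \<Omega> \<Longrightarrow> x \<in> cball p r \<Longrightarrow> y \<in> seg_sum vs \<Longrightarrow> x + y \<in> \<Omega>"
      using local_directions[OF lip p] by metis
    then show ?thesis using local_divergence_bound[OF \<Omega> w g, of \<kappa> v0 vs p r] by blast
  qed
  then obtain r where r: "\<And>p. p \<in> closure \<Omega> \<Longrightarrow> r p > 0 \<and> (\<exists>C\<ge>0. \<forall>\<phi>\<in>test_functions \<Omega>.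
      (\<forall>x. x \<notin> cball p (r p) \<longrightarrow> \<phi> x = 0) \<longrightarrow> \<bar>L2_inner \<Omega> w (grad \<phi>)\<bar> \<le> C * L2_norm UNIV \<phi>)"
    by metis
  have comp: "compact (closure \<Omega>)" using bdd by (simp add: compact_closure)
  have "closure \<Omega> \<subseteq> (\<Union>p\<in>closure \<Omega>. ball p (r p / 2))"
    using r by force
  then obtain P where P: "P \<subseteq> closure \<Omega>" "finite P" "closure \<Omega> \<subseteq> (\<Union>p\<in>P. ball p (r p / 2))"
    using compactE_image[OF comp, of "closure \<Omega>" "\<lambda>p. ball p (r p / 2)"] open_ball by metis
  obtain C where C: "\<And>\<phi>. \<phi> \<in> test_functions \<Omega> \<Longrightarrow> (\<forall>x. \<phi> x \<noteq> 0 \<longrightarrow> (\<exists>p\<in>P. dist p x < r p / 2)) \<Longrightarrow>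
      \<bar>L2_inner \<Omega> w (grad \<phi>)\<bar> \<le> C * L2_norm UNIV \<phi>"
    using glue_divergence_bounds[OF \<Omega> w P(2), of r] r P(1) by blast
  have bound: "\<bar>- L2_inner \<Omega> w (grad \<phi>)\<bar> \<le> C * L2_norm \<Omega> \<phi>" if t: "\<phi> \<in> test_functions \<Omega>" for \<phi>
  proof -
    have "\<exists>p\<in>P. dist p x < r p / 2" if "\<phi> x \<noteq> 0" for x
    proof -
      have "x \<in> \<Omega>" using t \<open>\<phi> x \<noteq> 0\<close> by (auto elim: test_functionsE)
      then have "x \<in> closure \<Omega>" using closure_subset by blast
      then obtain p where "p \<in> P" "x \<in> ball p (r p / 2)" using P(3) by blast
      then show ?thesis by (intro bexI[of _ p]) simp_all
    qed
    then show ?thesis using C[OF t] by (simp add: test_L2_norm[OF \<Omega> t])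
  qed
  have lin: "- L2_inner \<Omega> w (grad (\<lambda>x. \<phi> x + c *\<^sub>R \<psi> x)) = - L2_inner \<Omega> w (grad \<phi>) + c * - L2_inner \<Omega> w (grad \<psi>)"
    if t: "\<phi> \<in> test_functions \<Omega>" "\<psi> \<in> test_functions \<Omega>" for \<phi> \<psi> and c :: real
  proof -
    have "grad (\<lambda>x. c *\<^sub>R \<psi> x) = (\<lambda>x. c *\<^sub>R grad \<psi> x)"
      by (rule ext) (simp add: grad_eq dird_bounded_linear[OF bounded_linear_mult_right test_smooth[OF t(2)]] scaleR_sum_right)
    then have "grad (\<lambda>x. \<phi> x + c *\<^sub>R \<psi> x) = (\<lambda>x. grad \<phi> x + c *\<^sub>R grad \<psi> x)"
      using grad_add[OF test_smooth[OF t(1)] test_smooth[OF test_cmul[OF t(2), of c]]] by simp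
    then show ?thesis
      using L2_inner_lincomb[OF test_in_L2[OF grad_test[OF t(1)] \<Omega>s] test_in_L2[OF grad_test[OF t(2)] \<Omega>s] w, of c]
      by (simp add: L2_inner_commute[of \<Omega> w])
  qed
  have tL: "test_functions \<Omega> \<subseteq> (L2_space \<Omega> :: ('a \<Rightarrow> real) set)" using test_in_L2[OF _ \<Omega>s] by blast
  have tlin: "(\<lambda>x. \<phi> x + c *\<^sub>R \<psi> x) \<in> test_functions \<Omega>" if "\<phi> \<in> test_functions \<Omega>" "\<psi> \<in> test_functions \<Omega>"
    for \<phi> \<psi> :: "'a \<Rightarrow> real" and c
    using that by (intro test_add test_cmul)
  obtain q where q: "q \<in> L2_space \<Omega>" "\<And>\<phi>. \<phi> \<in> test_functions \<Omega> \<Longrightarrow> L2_inner \<Omega> q \<phi> = - L2_inner \<Omega> w (grad \<phi>)"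
    using L2_Riesz[OF tL test_zero tlin lin bound] by blast
  have "weak_div \<Omega> w q" using q by (simp add: weak_div_def)
  moreover have "weak_grad \<Omega> q g"
    unfolding weak_grad_def
  proof (intro conjI ballI weak_graddivD(1)[OF g])
    fix \<phi> :: "'a \<Rightarrow> 'a" assume t: "\<phi> \<in> test_functions \<Omega>"
    show "L2_inner \<Omega> q (divg \<phi>) = - L2_inner \<Omega> g \<phi>"
      using q(2)[OF divg_test[OF t]] weak_graddivD(2)[OF g t] by simp
  qed
  ultimately show thesis by (rule that)
qed

text \<open>With \<open>q = div w\<close>, both sides equal minus the scalar product of
  \<open>s\<close> and \<open>q\<close>: the normal trace of \<open>a\<close> is tested with
  \<open>q\<close>, the trace of \<open>s = div a\<close> with the normal trace of
  \<open>w\<close>.\<close>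

lemma Green_formula:
  assumes "bounded \<Omega>" "lipschitz_domain \<Omega>" and a: "H0_rep \<Omega> a s h" 
    and w: "w \<in> L2_space \<Omega>" "weak_graddiv \<Omega> w g"
  shows "L2_inner \<Omega> a g = L2_inner \<Omega> h w"
proof -
  obtain q where q: "weak_div \<Omega> w q" "weak_grad \<Omega> q g"
    by (rule divergence_regularity[OF assms(1,2) w])
  show ?thesis
    using H0_repD(7)[OF a weak_divD(1)[OF q(1)] q(2)] H0_repD(8)[OF a w(1) q(1)] by simp
qed

section \<open>Meshes\<close>

text \<open>Near each of its points the frontier lies in the graph of a Lipschitz function, which is
  the Lipschitz image of a hyperplane.\<close>

lemma negligible_frontier_lipschitz_domain:
  fixes T :: "'a::euclidean_space set"
  assumes "lipschitz_domain T"
  shows "negligible (frontier T)"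
proof (subst locally_negligible_alt, rule ballI)
  fix p assume p: "p \<in> frontier T"
  have o: "open T" using assms by (simp add: lipschitz_domain_def)
  obtain V e g L where V: "open V" "p \<in> V" and e: "norm e = 1"
    and g: "L-lipschitz_on {y. y \<bullet> e = 0} g" 
    and graph: "T \<inter> V = {x \<in> V. x \<bullet> e < g (x - (x \<bullet> e) *\<^sub>R e)}"
    using assms p unfolding lipschitz_domain_def by meson
  have ee: "e \<bullet> e = 1" using e by (simp add: norm_eq_1)
  have e0: "e \<noteq> 0" using e by auto
  let ?pr = "\<lambda>x. x - (x \<bullet> e) *\<^sub>R e"
  let ?H = "{y. y \<bullet> e = 0}"
  let ?G = "\<lambda>y. y + g y *\<^sub>R e"
  have prH: "?pr x \<in> ?H" for x by (simp add: inner_diff_left ee)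
  have cg: "continuous_on UNIV (\<lambda>x. g (?pr x))"
    by (rule continuous_on_compose2[OF lipschitz_on_continuous_on[OF g]])
      (auto intro!: continuous_intros simp: inner_diff_left ee)
  have "frontier T \<inter> V \<subseteq> ?G ` ?H"
  proof
    fix x assume x: "x \<in> frontier T \<inter> V"
    then have "x \<notin> T" using o by (simp add: frontier_def interior_open)
    then have ge: "g (?pr x) \<le> x \<bullet> e" using x graph by (auto simp: not_less[symmetric])
    \<comment> \<open>A point strictly above the graph has a neighbourhood free of \<open>T\<close>,
      by continuity of \<open>g\<close>, and so is not in the closure of \<open>T\<close>.\<close>
    have "\<not> g (?pr x) < x \<bullet> e"
    proof
      assume gt: "g (?pr x) < x \<bullet> e"
      let ?W = "{x. g (?pr x) < x \<bullet> e} \<inter> V"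
      have "open ?W" using V(1)
        by (intro open_Int open_Collect_less cg continuous_intros)
      moreover have "x \<in> ?W" using gt x by simp
      moreover have "x \<in> closure T" using x by (simp add: frontier_def)
      ultimately have "?W \<inter> T \<noteq> {}" using open_Int_closure_eq_empty[of ?W T] by blast
      then obtain z where z: "z \<in> V" "z \<in> T" "g (?pr z) < z \<bullet> e" by blast
      then have "z \<bullet> e < g (?pr z)" using graph by blast
      with z(3) show False by simp
    qed
    then have "x \<bullet> e = g (?pr x)" using ge by simp
    then have "x = ?G (?pr x)" by simp
    then show "x \<in> ?G ` ?H" using prH[of x] by blast
  qed
  moreover have "negligible (?G ` ?H)"
  proof (rule negligible_locally_Lipschitz_image)
    show "negligible ?H" using negligible_hyperplane[of e 0] e0 by (simp add: inner_commute)
    fix x assume x: "x \<in> ?H"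
    have "norm (?G y - ?G x) \<le> (1 + L) * norm (y - x)" if y: "y \<in> ?H" for y
    proof -
      have "norm (?G y - ?G x) = norm ((y - x) + (g y - g x) *\<^sub>R e)" by (simp add: algebra_simps)
      also have "\<dots> \<le> norm (y - x) + norm ((g y - g x) *\<^sub>R e)" by (rule norm_triangle_ineq)
      also have "norm ((g y - g x) *\<^sub>R e) = dist (g y) (g x)" using e by (simp add: dist_norm)
      also have "\<dots> \<le> L * norm (y - x)" using lipschitz_onD[OF g y x] by (simp add: dist_norm)
      finally show ?thesis by (simp add: algebra_simps)
    qed
    then show "\<exists>T B. open T \<and> x \<in> T \<and> (\<forall>y\<in>?H \<inter> T. norm (?G y - ?G x) \<le> B * norm (y - x))"
      by (intro exI[of _ UNIV] exI[of _ "1 + L"]) auto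
  qed simp
  ultimately have "negligible (frontier T \<inter> V)" by (rule negligible_subset[rotated])
  then show "\<exists>U. openin (top_of_set (frontier T)) U \<and> p \<in> U \<and> negligible U"
    using V p by (intro exI[of _ "frontier T \<inter> V"]) (auto simp: openin_open)
qed

lemma mesh_element:
  assumes "mesh \<Omega> \<T>" "T \<in> \<T>"
  shows "open T" "T \<subseteq> \<Omega>" "lipschitz_domain T"
  using assms by (auto simp: mesh_def lipschitz_domain_def)

text \<open>The closures of the elements cover the domain, so a point in no element lies on one of
  finitely many frontiers.\<close>

lemma mesh_complement_negligible:
  assumes "mesh \<Omega> \<T>"
  shows "negligible (\<Omega> - \<Union>\<T>)"
proof (rule negligible_subset)
  show "negligible (\<Union>T\<in>\<T>. frontier T)"
    using assms mesh_element[OF assms]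
    by (intro negligible_Union) (auto simp: mesh_def intro: negligible_frontier_lipschitz_domain)
  show "\<Omega> - \<Union>\<T> \<subseteq> (\<Union>T\<in>\<T>. frontier T)"
  proof
    fix x assume x: "x \<in> \<Omega> - \<Union>\<T>"
    then have "x \<in> closure \<Omega>" using closure_subset by blast
    then obtain T where T: "T \<in> \<T>" "x \<in> closure T" using assms by (auto simp: mesh_def)
    then have "x \<in> frontier T" using x mesh_element(1)[OF assms T(1)] by (auto simp: frontier_def interior_open)
    then show "x \<in> (\<Union>T\<in>\<T>. frontier T)" using T(1) by blast
  qed
qed

text \<open>Square integrability is asked only on the elements, because the broken test function in
  \<open>load\<close> is controlled only there.\<close>

lemma mesh_L2_inner:
  fixes \<Omega> :: "'a::euclidean_space set" and f h :: "'a \<Rightarrow> 'b::euclidean_space"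
  assumes m: "mesh \<Omega> \<T>" and \<Omega>: "open \<Omega>"
    and f: "\<And>T. T \<in> \<T> \<Longrightarrow> f \<in> L2_space T" and h: "\<And>T. T \<in> \<T> \<Longrightarrow> h \<in> L2_space T"
  shows "L2_inner \<Omega> f h = (\<Sum>T\<in>\<T>. L2_inner T f h)"
proof -
  let ?F = "\<lambda>x. f x \<bullet> h x"
  have Ts: "T \<in> sets lebesgue" if "T \<in> \<T>" for T
    using mesh_element(1)[OF m that] by (rule open_lebesgue)
  have fin: "finite \<T>" and disj: "disjoint \<T>" using m by (auto simp: mesh_def)
  have i: "integrable lebesgue (\<lambda>x. indicator T x *\<^sub>R ?F x)" if "T \<in> \<T>" for T
    using integrable_L2_inner[OF f[OF that] h[OF that]] Ts[OF that] by (simp add: integrable_restrict_space)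
  have isum: "integrable lebesgue (\<lambda>x. \<Sum>T\<in>\<T>. indicator T x *\<^sub>R ?F x)"
    by (rule Bochner_Integration.integrable_sum[OF i])
  have pt: "(\<Sum>T\<in>\<T>. indicator T x *\<^sub>R ?F x) = indicator \<Omega> x *\<^sub>R ?F x" if "x \<notin> \<Omega> - \<Union>\<T>" for x
  proof (cases "x \<in> \<Union>\<T>")
    case True
    then obtain S where S: "S \<in> \<T>" "x \<in> S" by blast
    have other: "x \<notin> T" if "T \<in> \<T>" "T \<noteq> S" for T
      using disj S that unfolding disjoint_def by blast
    have "(\<Sum>T\<in>\<T>. indicator T x *\<^sub>R ?F x) = (\<Sum>T\<in>\<T>. if T = S then ?F x else 0)"
      by (rule sum.cong) (use S other in auto)
    also have "\<dots> = ?F x" using fin S(1) by simp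
    finally show ?thesis using S mesh_element(2)[OF m S(1)] by (auto simp: indicator_def)
  next
    case False
    then have "(\<Sum>T\<in>\<T>. indicator T x *\<^sub>R ?F x) = (\<Sum>T\<in>\<T>. 0)" by (intro sum.cong) auto
    moreover have "x \<notin> \<Omega>" using that False by blast
    ultimately show ?thesis by simp
  qed
  have N: "\<Omega> - \<Union>\<T> \<in> null_sets lebesgue"
    using mesh_complement_negligible[OF m] by (simp only: negligible_iff_null_sets)
  have ae: "AE x in lebesgue. (\<Sum>T\<in>\<T>. indicator T x *\<^sub>R ?F x) = indicator \<Omega> x *\<^sub>R ?F x"
    by (rule AE_mp[OF AE_not_in[OF N]]) (intro AE_I2 impI pt)
  have msum: "(\<lambda>x. \<Sum>T\<in>\<T>. indicator T x *\<^sub>R ?F x) \<in> borel_measurable lebesgue"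
    by (rule borel_measurable_integrable[OF isum])
  have "L2_inner \<Omega> f h = (\<integral>x. indicator \<Omega> x *\<^sub>R ?F x \<partial>lebesgue)"
    unfolding L2_inner_def using open_lebesgue[OF \<Omega>] by (subst integral_restrict_space) auto
  \<comment> \<open>Between the elements \<open>f\<close> and \<open>h\<close> are arbitrary;
    measurability of the product on \<Omega> is inherited from the sum through almost everywhere
    equality.\<close>
  also have "\<dots> = (\<integral>x. (\<Sum>T\<in>\<T>. indicator T x *\<^sub>R ?F x) \<partial>lebesgue)"
    by (rule integral_cong_AE[symmetric, OF msum borel_measurable_AE[OF msum ae] ae])
  also have "\<dots> = (\<Sum>T\<in>\<T>. (\<integral>x. indicator T x *\<^sub>R ?F x \<partial>lebesgue))"
    by (rule Bochner_Integration.integral_sum[OF i])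
  also have "\<dots> = (\<Sum>T\<in>\<T>. L2_inner T f h)"
    unfolding L2_inner_def using Ts by (intro sum.cong refl, subst integral_restrict_space) auto
  finally show ?thesis .
qed

lemma L2_space_mesh:
  assumes "mesh \<Omega> \<T>" "open \<Omega>" "f \<in> L2_space \<Omega>" "T \<in> \<T>"
  shows "f \<in> L2_space T"
  using L2_space_subset[OF assms(3) mesh_element(2)[OF assms(1,4)]] mesh_element(1)[OF assms(1,4)]
    open_lebesgue assms(2) by blast

lemma weak_graddiv_mesh:
  assumes "mesh \<Omega> \<T>" "open \<Omega>" "weak_graddiv \<Omega> v g" "T \<in> \<T>"
  shows "weak_graddiv T v g"
  using weak_graddiv_subset[OF mesh_element(1)[OF assms(1,4)] assms(2) mesh_element(2)[OF assms(1,4)] assms(3)] .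

lemma broken_HgraddivD:
  assumes "\<tau> \<in> broken_Hgraddiv \<T>" "T \<in> \<T>"
  shows "\<tau> \<in> L2_space T" "weak_graddiv T \<tau> (wgraddiv T \<tau>)" "wgraddiv T \<tau> \<in> L2_space T"
proof -
  show "\<tau> \<in> L2_space T" and w: "weak_graddiv T \<tau> (wgraddiv T \<tau>)"
    using assms by (auto simp: broken_Hgraddiv_def Hgraddiv_def intro: weak_graddiv_wgraddiv)
  show "wgraddiv T \<tau> \<in> L2_space T" by (rule weak_graddivD(1)[OF w])
qed

lemma in_broken_Hgraddiv:
  assumes "mesh \<Omega> \<T>" "open \<Omega>" "v \<in> L2_space \<Omega>" "weak_graddiv \<Omega> v g"
  shows "v \<in> broken_Hgraddiv \<T>"
  using L2_space_mesh[OF assms(1-3)] weak_graddiv_mesh[OF assms(1,2,4)]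
  by (auto simp: broken_Hgraddiv_def Hgraddiv_def)

section \<open>Skeleton traces and the bilinear form\<close>

lemma tr_graddiv_apply:
  assumes m: "mesh \<Omega> \<T>" and \<Omega>: "open \<Omega>" and v: "weak_graddiv \<Omega> v g" and \<tau>: "\<tau> \<in> broken_Hgraddiv \<T>"
  shows "tr_graddiv \<T> v \<tau> = (\<Sum>T\<in>\<T>. L2_inner T v (wgraddiv T \<tau>)) - (\<Sum>T\<in>\<T>. L2_inner T g \<tau>)"
proof -
  have "(\<Sum>T\<in>\<T>. L2_inner T (wgraddiv T v) \<tau>) = (\<Sum>T\<in>\<T>. L2_inner T g \<tau>)"
    by (intro sum.cong refl wgraddiv_inner mesh_element(1)[OF m] weak_graddiv_mesh[OF m \<Omega> v]
        broken_HgraddivD(1)[OF \<tau>])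
  then show ?thesis using \<tau> by (simp add: tr_graddiv_def)
qed

text \<open>On arguments without jumps the element sums collapse to \<Omega>. This one formula
  serves both for smooth test functions and, in the uniqueness proof, for the difference of two
  solutions.\<close>

lemma tr_graddiv_conforming:
  assumes m: "mesh \<Omega> \<T>" and \<Omega>: "open \<Omega>" 
    and v: "v \<in> L2_space \<Omega>" "weak_graddiv \<Omega> v g" and w: "w \<in> L2_space \<Omega>" "weak_graddiv \<Omega> w k"
  shows "tr_graddiv \<T> v w = L2_inner \<Omega> v k - L2_inner \<Omega> g w"
proof -
  have br: "w \<in> broken_Hgraddiv \<T>" by (rule in_broken_Hgraddiv[OF m \<Omega> w])
  have "L2_inner T v (wgraddiv T w) = L2_inner T v k" if T: "T \<in> \<T>" for T
    using wgraddiv_inner[OF mesh_element(1)[OF m T] weak_graddiv_mesh[OF m \<Omega> w(2) T] L2_space_mesh[OF m \<Omega> v(1) T]]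
    by (simp add: L2_inner_commute[of T v])
  then have "(\<Sum>T\<in>\<T>. L2_inner T v (wgraddiv T w)) = (\<Sum>T\<in>\<T>. L2_inner T v k)" by (intro sum.cong) auto
  also have "\<dots> = L2_inner \<Omega> v k"
    by (rule mesh_L2_inner[symmetric, OF m \<Omega> L2_space_mesh[OF m \<Omega> v(1)]
        L2_space_mesh[OF m \<Omega> weak_graddivD(1)[OF w(2)]]])
  moreover have "(\<Sum>T\<in>\<T>. L2_inner T g w) = L2_inner \<Omega> g w"
    by (rule mesh_L2_inner[symmetric, OF m \<Omega> L2_space_mesh[OF m \<Omega> weak_graddivD(1)[OF v(2)]]
        L2_space_mesh[OF m \<Omega> w(1)]])
  ultimately show ?thesis using tr_graddiv_apply[OF m \<Omega> v(2) br] by simp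
qed

lemma bform_expand:
  assumes m: "mesh \<Omega> \<T>" and \<Omega>: "open \<Omega>" and u: "u \<in> L2_space \<Omega>" and w: "w \<in> L2_space \<Omega>"
    and v: "v \<in> broken_Hgraddiv \<T>" and \<tau>: "\<tau> \<in> broken_Hgraddiv \<T>"
  shows "bform \<T> (u, w, uh, wh) (v, \<tau>) =
    (\<Sum>T\<in>\<T>. L2_inner T u v) - (\<Sum>T\<in>\<T>. L2_inner T u (wgraddiv T \<tau>))
    - (\<Sum>T\<in>\<T>. L2_inner T w \<tau>) - (\<Sum>T\<in>\<T>. L2_inner T w (wgraddiv T v)) + uh \<tau> + wh v"
proof -
  have 1: "L2_inner T u (\<lambda>x. v x - wgraddiv T \<tau> x) = L2_inner T u v - L2_inner T u (wgraddiv T \<tau>)"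
    if T: "T \<in> \<T>" for T
    using L2_inner_diff_left[OF broken_HgraddivD(1)[OF v T] broken_HgraddivD(3)[OF \<tau> T] L2_space_mesh[OF m \<Omega> u T]]
    by (simp add: L2_inner_commute[of T u])
  have 2: "L2_inner T w (\<lambda>x. \<tau> x + wgraddiv T v x) = L2_inner T w \<tau> + L2_inner T w (wgraddiv T v)"
    if T: "T \<in> \<T>" for T
    using L2_inner_add_left[OF broken_HgraddivD(1)[OF \<tau> T] broken_HgraddivD(3)[OF v T] L2_space_mesh[OF m \<Omega> w T]]
    by (simp add: L2_inner_commute[of T w])
  show ?thesis by (simp add: bform_def 1 2 sum.distrib sum_subtractf)
qed

lemma load_mesh:
  assumes m: "mesh \<Omega> \<T>" and \<Omega>: "open \<Omega>" and f: "f \<in> L2_space \<Omega>" and v: "v \<in> broken_Hgraddiv \<T>"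
  shows "load \<Omega> f (v, \<tau>) = (\<Sum>T\<in>\<T>. L2_inner T f v)"
  using mesh_L2_inner[OF m \<Omega> L2_space_mesh[OF m \<Omega> f] broken_HgraddivD(1)[OF v]] by (simp add: load_def)

lemma weak_graddiv_zero: "weak_graddiv \<omega> (\<lambda>x. 0) (\<lambda>x. 0)"
  by (simp add: weak_graddiv_def zero_in_L2 L2_inner_zero_left)

lemma zero_broken:
  assumes m: "mesh \<Omega> \<T>"
  shows "(\<lambda>x. 0) \<in> broken_Hgraddiv \<T>"
  using weak_graddiv_zero zero_in_L2 by (auto simp: broken_Hgraddiv_def Hgraddiv_def)

lemma L2_inner_zero_right: "L2_inner \<omega> f (\<lambda>x. 0) = 0"
  by (simp add: L2_inner_def)

text \<open>The chosen representative \<open>wgraddiv T (\<lambda>x. 0)\<close> is zero only almost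
  everywhere, so the term cannot simply be rewritten away.\<close>

lemma L2_inner_wgraddiv_zero:
  assumes "mesh \<Omega> \<T>" "open \<Omega>" "f \<in> L2_space \<Omega>" "T \<in> \<T>"
  shows "L2_inner T f (wgraddiv T (\<lambda>x. 0)) = 0"
  using wgraddiv_inner[OF mesh_element(1)[OF assms(1,4)] weak_graddiv_zero L2_space_mesh[OF assms]]
  by (simp add: L2_inner_commute[of T f] L2_inner_zero_left)

lemma tr_graddiv_zero:
  assumes "mesh \<Omega> \<T>" "open \<Omega>" "a \<in> L2_space \<Omega>" "weak_graddiv \<Omega> a h"
  shows "tr_graddiv \<T> a (\<lambda>x. 0) = 0"
  using tr_graddiv_conforming[OF assms zero_in_L2 weak_graddiv_zero] by (simp add: L2_inner_zero_right)

lemma skel_spaceE: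
  assumes "vh \<in> skel_space \<Omega> \<T>"
  obtains b k where "vh = tr_graddiv \<T> b" "b \<in> L2_space \<Omega>" "weak_graddiv \<Omega> b k"
  using assms by (auto simp: skel_space_def Hgraddiv_def)

lemma skel_space0E:
  assumes "open \<Omega>" "vh \<in> skel_space0 \<Omega> \<T>"
  obtains a s h where "vh = tr_graddiv \<T> a" "H0_rep \<Omega> a s h"
  using assms(2) H0graddiv_imp_H0_rep[OF assms(1)] by (auto simp: skel_space0_def)

section \<open>Well-posedness\<close>

text \<open>Skeleton traces are defined as the defect of elementwise integration by parts; inserting
  the weak derivatives of \<open>u\<close> and \<open>w\<close> makes everything but the load
  cancel.\<close>

lemma exact_solution:
  assumes m: "mesh \<Omega> \<T>" and \<Omega>: "open \<Omega>" and f: "f \<in> L2_space \<Omega>"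
    and u: "u \<in> L2_space \<Omega>" "weak_graddiv \<Omega> u (\<lambda>x. - w x)"
    and w: "w \<in> L2_space \<Omega>" "weak_graddiv \<Omega> w (\<lambda>x. u x - f x)"
    and V: "V \<in> test_space \<T>"
  shows "bform \<T> (u, w, tr_graddiv \<T> u, tr_graddiv \<T> w) V = load \<Omega> f V"
proof -
  obtain v \<tau> where V': "V = (v, \<tau>)" "v \<in> broken_Hgraddiv \<T>" "\<tau> \<in> broken_Hgraddiv \<T>"
    using V by (auto simp: test_space_def)
  have "(\<Sum>T\<in>\<T>. L2_inner T (\<lambda>x. u x - f x) v) = (\<Sum>T\<in>\<T>. L2_inner T u v - L2_inner T f v)"
    by (rule sum.cong[OF refl], rule L2_inner_diff_left[OF L2_space_mesh[OF m \<Omega> u(1)]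
        L2_space_mesh[OF m \<Omega> f] broken_HgraddivD(1)[OF V'(2)]])
  then show ?thesis
    unfolding V'(1) bform_expand[OF m \<Omega> u(1) w(1) V'(2,3)] load_mesh[OF m \<Omega> f V'(2)]
      tr_graddiv_apply[OF m \<Omega> u(2) V'(3)] tr_graddiv_apply[OF m \<Omega> w(2) V'(2)]
    by (simp add: L2_inner_uminus_left sum_negf sum_subtractf)
qed

lemma solution_structure:
  assumes m: "mesh \<Omega> \<T>" and \<Omega>: "open \<Omega>" and f: "f \<in> L2_space \<Omega>"
    and U: "(u, w, uh, wh) \<in> trial_space \<Omega> \<T>"
    and sol: "\<forall>V\<in>test_space \<T>. bform \<T> (u, w, uh, wh) V = load \<Omega> f V"
  shows "weak_graddiv \<Omega> u (\<lambda>x. - w x)" "weak_graddiv \<Omega> w (\<lambda>x. u x - f x)"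
    "uh = tr_graddiv \<T> u" "wh = tr_graddiv \<T> w"
proof -
  have u: "u \<in> L2_space \<Omega>" and w: "w \<in> L2_space \<Omega>"
    and uh: "uh \<in> skel_space0 \<Omega> \<T>" and wh: "wh \<in> skel_space \<Omega> \<T>"
    using U by (auto simp: trial_space_def)
  obtain a s h where a: "uh = tr_graddiv \<T> a" "H0_rep \<Omega> a s h" by (rule skel_space0E[OF \<Omega> uh])
  note aL = H0_repD(1)[OF a(2)] and ah = H0_repD(6)[OF a(2)]
  obtain b k where b: "wh = tr_graddiv \<T> b" "b \<in> L2_space \<Omega>" "weak_graddiv \<Omega> b k"
    by (rule skel_spaceE[OF wh])
  note \<Omega>s = open_lebesgue[OF \<Omega>]
  note z = zero_broken[OF m]
  have uh0: "uh (\<lambda>x. 0) = 0" unfolding a(1) by (rule tr_graddiv_zero[OF m \<Omega> aL ah])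
  have wh0: "wh (\<lambda>x. 0) = 0" unfolding b(1) by (rule tr_graddiv_zero[OF m \<Omega> b(2,3)])
  \<comment> \<open>Setting one component of the test pair to zero isolates one skeleton
    functional.\<close>
  have eq\<tau>: "uh \<tau> = (\<Sum>T\<in>\<T>. L2_inner T u (wgraddiv T \<tau>)) + (\<Sum>T\<in>\<T>. L2_inner T w \<tau>)"
    if \<tau>: "\<tau> \<in> broken_Hgraddiv \<T>" for \<tau>
  proof -
    have "bform \<T> (u, w, uh, wh) (\<lambda>x. 0, \<tau>) = 0"
      using bspec[OF sol, of "(\<lambda>x. 0, \<tau>)"] z \<tau> by (simp add: test_space_def load_def L2_inner_zero_right)
    then show ?thesis
      unfolding bform_expand[OF m \<Omega> u w z \<tau>]
      by (simp add: L2_inner_zero_right L2_inner_wgraddiv_zero[OF m \<Omega> w] wh0)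
  qed
  have eqv: "wh v = (\<Sum>T\<in>\<T>. L2_inner T w (wgraddiv T v)) - (\<Sum>T\<in>\<T>. L2_inner T u v) + (\<Sum>T\<in>\<T>. L2_inner T f v)"
    if v: "v \<in> broken_Hgraddiv \<T>" for v
  proof -
    have "bform \<T> (u, w, uh, wh) (v, \<lambda>x. 0) = (\<Sum>T\<in>\<T>. L2_inner T f v)"
      using bspec[OF sol, of "(v, \<lambda>x. 0)"] z v load_mesh[OF m \<Omega> f v] by (simp add: test_space_def)
    then show ?thesis
      unfolding bform_expand[OF m \<Omega> u w v z]
      by (simp add: L2_inner_zero_right L2_inner_wgraddiv_zero[OF m \<Omega> u] uh0)
  qed
  have conf: "(\<Sum>T\<in>\<T>. L2_inner T p \<phi>) = L2_inner \<Omega> p \<phi>"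
    "(\<Sum>T\<in>\<T>. L2_inner T p (wgraddiv T \<phi>)) = L2_inner \<Omega> p (grad (divg \<phi>))"
    if t: "\<phi> \<in> test_functions \<Omega>" and p: "p \<in> L2_space \<Omega>" for p \<phi>
  proof -
    show "(\<Sum>T\<in>\<T>. L2_inner T p \<phi>) = L2_inner \<Omega> p \<phi>"
      by (rule mesh_L2_inner[symmetric, OF m \<Omega> L2_space_mesh[OF m \<Omega> p]
          L2_space_mesh[OF m \<Omega> test_in_L2[OF t \<Omega>s]]])
    have "(\<Sum>T\<in>\<T>. L2_inner T p (wgraddiv T \<phi>)) = (\<Sum>T\<in>\<T>. L2_inner T p (grad (divg \<phi>)))"
    proof (rule sum.cong[OF refl])
      fix T assume T: "T \<in> \<T>"
      show "L2_inner T p (wgraddiv T \<phi>) = L2_inner T p (grad (divg \<phi>))"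
        using wgraddiv_inner[OF mesh_element(1)[OF m T] weak_graddiv_mesh[OF m \<Omega> test_weak_graddiv[OF \<Omega>s t] T]
            L2_space_mesh[OF m \<Omega> p T]]
        by (simp add: L2_inner_commute[of T p])
    qed
    also have "\<dots> = L2_inner \<Omega> p (grad (divg \<phi>))"
      by (rule mesh_L2_inner[symmetric, OF m \<Omega> L2_space_mesh[OF m \<Omega> p]
          L2_space_mesh[OF m \<Omega> test_in_L2[OF grad_test[OF divg_test[OF t]] \<Omega>s]]])
    finally show "(\<Sum>T\<in>\<T>. L2_inner T p (wgraddiv T \<phi>)) = L2_inner \<Omega> p (grad (divg \<phi>))" .
  qed
  have brk: "\<phi> \<in> broken_Hgraddiv \<T>" if t: "\<phi> \<in> test_functions \<Omega>" for \<phi>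
    by (rule in_broken_Hgraddiv[OF m \<Omega> test_in_L2[OF t \<Omega>s] test_weak_graddiv[OF \<Omega>s t]])
  \<comment> \<open>On test functions of the whole domain a conforming trace vanishes by the
    definition of the weak derivative, so only volume terms remain and give the two
    equations.\<close>
  have tr0: "tr_graddiv \<T> c \<phi> = 0" if t: "\<phi> \<in> test_functions \<Omega>" and c: "c \<in> L2_space \<Omega>" "weak_graddiv \<Omega> c l" for c l \<phi>
    using tr_graddiv_conforming[OF m \<Omega> c test_in_L2[OF t \<Omega>s] test_weak_graddiv[OF \<Omega>s t]] weak_graddivD(2)[OF c(2) t]
    by simp
  show 1: "weak_graddiv \<Omega> u (\<lambda>x. - w x)"
    unfolding weak_graddiv_def
  proof (intro conjI ballI uminus_in_L2 w)
    fix \<phi> :: "'a \<Rightarrow> 'a" assume t: "\<phi> \<in> test_functions \<Omega>"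
    show "L2_inner \<Omega> u (grad (divg \<phi>)) = L2_inner \<Omega> (\<lambda>x. - w x) \<phi>"
      using eq\<tau>[OF brk[OF t]] tr0[OF t aL ah] conf[OF t u] conf[OF t w] by (simp add: a(1) L2_inner_uminus_left)
  qed
  show 2: "weak_graddiv \<Omega> w (\<lambda>x. u x - f x)"
    unfolding weak_graddiv_def
  proof (intro conjI ballI diff_in_L2 u f)
    fix \<phi> :: "'a \<Rightarrow> 'a" assume t: "\<phi> \<in> test_functions \<Omega>"
    show "L2_inner \<Omega> w (grad (divg \<phi>)) = L2_inner \<Omega> (\<lambda>x. u x - f x) \<phi>"
      using eqv[OF brk[OF t]] tr0[OF t b(2,3)] conf[OF t u] conf[OF t w] conf(1)[OF t f]
        L2_inner_diff_left[OF u f test_in_L2[OF t \<Omega>s]] by (simp add: b(1))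
  qed
  show "uh = tr_graddiv \<T> u"
  proof
    fix \<tau> show "uh \<tau> = tr_graddiv \<T> u \<tau>"
    proof (cases "\<tau> \<in> broken_Hgraddiv \<T>")
      case True
      then show ?thesis using eq\<tau> tr_graddiv_apply[OF m \<Omega> 1 True] by (simp add: L2_inner_uminus_left sum_negf)
    next
      \<comment> \<open>Outside the broken space both functionals are extensional and take the value
        \<open>undefined\<close>.\<close>
      case False then show ?thesis by (simp add: a(1) tr_graddiv_def)
    qed
  qed
  show "wh = tr_graddiv \<T> w"
  proof
    fix v show "wh v = tr_graddiv \<T> w v"
    proof (cases "v \<in> broken_Hgraddiv \<T>")
      case True
      have "(\<Sum>T\<in>\<T>. L2_inner T (\<lambda>x. u x - f x) v) = (\<Sum>T\<in>\<T>. L2_inner T u v - L2_inner T f v)"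
        by (rule sum.cong[OF refl], rule L2_inner_diff_left[OF L2_space_mesh[OF m \<Omega> u]
            L2_space_mesh[OF m \<Omega> f] broken_HgraddivD(1)[OF True]])
      then show ?thesis using eqv tr_graddiv_apply[OF m \<Omega> 2 True] True by (simp add: sum_subtractf)
    next
      case False then show ?thesis by (simp add: b(1) tr_graddiv_def)
    qed
  qed
qed

section \<open>Uniqueness\<close>

lemma AE_mesh_element:
  assumes m: "mesh \<Omega> \<T>" and \<Omega>: "open \<Omega>" and T: "T \<in> \<T>" and ae: "AE x in lebesgue_on \<Omega>. P x"
  shows "AE x in lebesgue_on T. P x"
proof -
  have "AE x in lebesgue. x \<in> \<Omega> \<longrightarrow> P x"
    using ae open_lebesgue[OF \<Omega>] by (simp add: AE_restrict_space_iff)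
  then have "AE x in lebesgue. x \<in> T \<longrightarrow> P x"
    by (rule AE_mp) (use mesh_element(2)[OF m T] in \<open>auto intro!: AE_I2\<close>)
  then show ?thesis using open_lebesgue[OF mesh_element(1)[OF m T]] by (simp add: AE_restrict_space_iff)
qed

text \<open>Since \<open>trial_eq\<close> compares skeleton functionals by equality in HOL, almost
  everywhere equality of fields and derivatives has to be lifted to it.\<close>

lemma tr_graddiv_cong_AE:
  assumes m: "mesh \<Omega> \<T>" and \<Omega>: "open \<Omega>"
    and v: "v \<in> L2_space \<Omega>" "weak_graddiv \<Omega> v g" and v': "v' \<in> L2_space \<Omega>" "weak_graddiv \<Omega> v' g'"
    and ae: "AE x in lebesgue_on \<Omega>. v x = v' x" "AE x in lebesgue_on \<Omega>. g x = g' x"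
  shows "tr_graddiv \<T> v = tr_graddiv \<T> v'"
proof
  fix \<tau> show "tr_graddiv \<T> v \<tau> = tr_graddiv \<T> v' \<tau>"
  proof (cases "\<tau> \<in> broken_Hgraddiv \<T>")
    case True
    have "L2_inner T v (wgraddiv T \<tau>) = L2_inner T v' (wgraddiv T \<tau>)" if T: "T \<in> \<T>" for T
      by (rule L2_inner_AE_eq[OF AE_mesh_element[OF m \<Omega> T ae(1)] L2_space_mesh[OF m \<Omega> v(1) T]
          L2_space_mesh[OF m \<Omega> v'(1) T] broken_HgraddivD(3)[OF True T]])
    moreover have "L2_inner T g \<tau> = L2_inner T g' \<tau>" if T: "T \<in> \<T>" for T
      by (rule L2_inner_AE_eq[OF AE_mesh_element[OF m \<Omega> T ae(2)] L2_space_mesh[OF m \<Omega> weak_graddivD(1)[OF v(2)] T]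
          L2_space_mesh[OF m \<Omega> weak_graddivD(1)[OF v'(2)] T] broken_HgraddivD(1)[OF True T]])
    ultimately show ?thesis
      using tr_graddiv_apply[OF m \<Omega> v(2) True] tr_graddiv_apply[OF m \<Omega> v'(2) True] by simp
  next
    case False then show ?thesis by (simp add: tr_graddiv_def)
  qed
qed

text \<open>The differences satisfy \<open>\<nabla>div \<zeta> = \<delta>\<close>, and \<zeta> lies
  in the full space, so it can be paired with skeleton traces. Pairing each solution's
  \<open>uh\<close> with \<zeta> shows that the field differences are orthogonal to
  themselves.\<close>

lemma solution_unique:
  assumes m: "mesh \<Omega> \<T>" and bdd: "bounded \<Omega>" and lip: "lipschitz_domain \<Omega>" and f: "f \<in> L2_space \<Omega>"
    and U: "U \<in> trial_space \<Omega> \<T>" "\<forall>V\<in>test_space \<T>. bform \<T> U V = load \<Omega> f V"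
    and U': "U' \<in> trial_space \<Omega> \<T>" "\<forall>V\<in>test_space \<T>. bform \<T> U' V = load \<Omega> f V"
  shows "trial_eq \<Omega> U' U"
proof -
  have \<Omega>: "open \<Omega>" using lip by (simp add: lipschitz_domain_def)
  obtain u w uh wh where Ue: "U = (u, w, uh, wh)" by (cases U) auto
  obtain u' w' uh' wh' where Ue': "U' = (u', w', uh', wh')" by (cases U') auto
  note S = solution_structure[OF m \<Omega> f U(1)[unfolded Ue] U(2)[unfolded Ue]]
  note S' = solution_structure[OF m \<Omega> f U'(1)[unfolded Ue'] U'(2)[unfolded Ue']]
  have L: "u \<in> L2_space \<Omega>" "w \<in> L2_space \<Omega>" "uh \<in> skel_space0 \<Omega> \<T>"
    and L': "u' \<in> L2_space \<Omega>" "w' \<in> L2_space \<Omega>" "uh' \<in> skel_space0 \<Omega> \<T>"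
    using U(1) U'(1) by (auto simp: Ue Ue' trial_space_def)
  define \<delta> where "\<delta> x = u' x - u x" for x
  define \<zeta> where "\<zeta> x = w' x - w x" for x
  have \<delta>L: "\<delta> \<in> L2_space \<Omega>" and \<zeta>L: "\<zeta> \<in> L2_space \<Omega>"
    unfolding \<delta>_def[abs_def] \<zeta>_def[abs_def] by (intro diff_in_L2 L L')+
  have \<zeta>g: "weak_graddiv \<Omega> \<zeta> \<delta>"
    using weak_graddiv_lincomb[OF \<Omega> L'(2) L(2) S'(2) S(2), of "-1"]
    by (simp add: \<delta>_def[abs_def] \<zeta>_def[abs_def])
  \<comment> \<open>The pairing with \<zeta> depends only on the skeleton trace of \<open>y\<close>,
    so \<open>y\<close> can be exchanged for some \<open>a\<close> with vanishing traces, where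
    Green's formula gives zero.\<close>
  have orth: "L2_inner \<Omega> y \<delta> + L2_inner \<Omega> z \<zeta> = 0"
    if y: "y \<in> L2_space \<Omega>" "weak_graddiv \<Omega> y (\<lambda>x. - z x)" "tr_graddiv \<T> y \<in> skel_space0 \<Omega> \<T>" for y z
  proof -
    obtain a s h where a: "tr_graddiv \<T> y = tr_graddiv \<T> a" "H0_rep \<Omega> a s h"
      by (rule skel_space0E[OF \<Omega> y(3)])
    have "L2_inner \<Omega> y \<delta> - L2_inner \<Omega> (\<lambda>x. - z x) \<zeta> = L2_inner \<Omega> a \<delta> - L2_inner \<Omega> h \<zeta>"
      using tr_graddiv_conforming[OF m \<Omega> y(1,2) \<zeta>L \<zeta>g]
        tr_graddiv_conforming[OF m \<Omega> H0_repD(1,6)[OF a(2)] \<zeta>L \<zeta>g] a(1) by simp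
    also have "\<dots> = 0" using Green_formula[OF bdd lip a(2) \<zeta>L \<zeta>g] by simp
    finally show ?thesis by (simp add: L2_inner_uminus_left)
  qed
  \<comment> \<open>Applying \<open>orth\<close> to the two solutions separately and subtracting
    avoids any appeal to the linear structure of \<open>skel_space0\<close>.\<close>
  have "L2_inner \<Omega> \<delta> \<delta> + L2_inner \<Omega> \<zeta> \<zeta> = 0"
    using orth[OF L(1) S(1)] orth[OF L'(1) S'(1)] L(3) L'(3) S(3) S'(3)
      L2_inner_diff_left[OF L'(1) L(1) \<delta>L] L2_inner_diff_left[OF L'(2) L(2) \<zeta>L]
    by (simp add: \<delta>_def[symmetric] \<zeta>_def[symmetric])
  then have z: "L2_inner \<Omega> \<delta> \<delta> = 0" "L2_inner \<Omega> \<zeta> \<zeta> = 0"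
    using L2_inner_self_nonneg[of \<Omega> \<delta>] L2_inner_self_nonneg[of \<Omega> \<zeta>] by linarith+
  have u_ae: "AE x in lebesgue_on \<Omega>. u' x = u x"
    using L2_inner_self_eq_0[OF \<delta>L z(1)] by (simp add: \<delta>_def)
  have w_ae: "AE x in lebesgue_on \<Omega>. w' x = w x"
    using L2_inner_self_eq_0[OF \<zeta>L z(2)] by (simp add: \<zeta>_def)
  have "tr_graddiv \<T> u' = tr_graddiv \<T> u"
    by (rule tr_graddiv_cong_AE[OF m \<Omega> L'(1) S'(1) L(1) S(1) u_ae]) (rule eventually_mono[OF w_ae], simp)
  moreover have "tr_graddiv \<T> w' = tr_graddiv \<T> w"
    by (rule tr_graddiv_cong_AE[OF m \<Omega> L'(2) S'(2) L(2) S(2) w_ae]) (rule eventually_mono[OF u_ae], simp)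
  ultimately have "uh' = uh" "wh' = wh" using S(3,4) S'(3,4) by simp_all
  then show ?thesis using u_ae w_ae by (simp add: trial_eq_def Ue Ue')
qed

section \<open>Norm bounds and conclusion\<close>

lemma graddiv_norm_eq:
  assumes "open \<Omega>" "weak_graddiv \<Omega> v g"
  shows "(graddiv_norm \<Omega> v)\<^sup>2 = (L2_norm \<Omega> v)\<^sup>2 + (L2_norm \<Omega> g)\<^sup>2"
  by (simp add: graddiv_norm_def wgraddiv_norm[OF assms])

text \<open>The lower bound is recorded because the skeleton norms enter \<open>trial_norm\<close>
  squared.\<close>

lemma skel_norm_le:
  assumes "v \<in> Hgraddiv \<Omega>"
  shows "0 \<le> skel_norm \<Omega> \<T> (tr_graddiv \<T> v)" "skel_norm \<Omega> \<T> (tr_graddiv \<T> v) \<le> graddiv_norm \<Omega> v"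
proof -
  let ?S = "{graddiv_norm \<Omega> v' | v'. v' \<in> Hgraddiv \<Omega> \<and> tr_graddiv \<T> v' = tr_graddiv \<T> v}"
  have nn: "0 \<le> s" if "s \<in> ?S" for s using that by (auto simp: graddiv_norm_def)
  have mem: "graddiv_norm \<Omega> v \<in> ?S" using assms by blast
  show "0 \<le> skel_norm \<Omega> \<T> (tr_graddiv \<T> v)"
    unfolding skel_norm_def by (rule cInf_greatest) (use mem nn in blast)+
  show "skel_norm \<Omega> \<T> (tr_graddiv \<T> v) \<le> graddiv_norm \<Omega> v"
    unfolding skel_norm_def by (rule cInf_lower[OF mem]) (use nn in \<open>auto simp: bdd_below_def\<close>)
qed

theorem theorem12:
  fixes \<Omega> :: "'a::euclidean_space set"
  assumes "DIM('a) \<ge> 2"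
    and "bounded \<Omega>"
    and "simply_connected \<Omega>"
    and "lipschitz_domain \<Omega>"
  shows "\<exists>C>0. \<forall>\<T>. mesh \<Omega> \<T> \<longrightarrow> (\<forall>f\<in>L2_space \<Omega>.
    \<exists>U\<in>trial_space \<Omega> \<T>.
      (\<forall>V\<in>test_space \<T>. bform \<T> U V = load \<Omega> f V) \<and>
      (\<forall>U'\<in>trial_space \<Omega> \<T>.
         (\<forall>V\<in>test_space \<T>. bform \<T> U' V = load \<Omega> f V) \<longrightarrow> trial_eq \<Omega> U' U) \<and>
      trial_norm \<Omega> \<T> U \<le> C * L2_norm \<Omega> f \<and>
      solves_bvp \<Omega> f (fst U))"
proof (intro exI[of _ "3::real"] conjI allI impI ballI)
  fix \<T> :: "'a set set" and f :: "'a \<Rightarrow> 'a"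
  assume m: "mesh \<Omega> \<T>" and f: "f \<in> L2_space \<Omega>"
  have \<Omega>: "open \<Omega>" using assms(4) by (simp add: lipschitz_domain_def)
  obtain u q g where r: "H0_rep \<Omega> u q g" and gg: "weak_graddiv \<Omega> g (\<lambda>x. f x - u x)"
    and en: "L2_inner \<Omega> u u + L2_inner \<Omega> g g = L2_inner \<Omega> f u"
    by (rule bvp_exists[OF \<Omega> f])
  note H = H0_repD[OF r]
  \<comment> \<open>With this sign the equation for \<open>g\<close> becomes
    \<open>\<nabla>div w = u - f\<close>, as the bilinear form requires.\<close>
  define w where "w x = - g x" for x
  have wL: "w \<in> L2_space \<Omega>" unfolding w_def[abs_def] by (rule uminus_in_L2[OF H(5)])
  have gw: "weak_graddiv \<Omega> u (\<lambda>x. - w x)" using H(6) by (simp add: w_def)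
  have ww: "weak_graddiv \<Omega> w (\<lambda>x. u x - f x)"
    using weak_graddiv_lincomb[OF \<Omega> zero_in_L2 H(5) weak_graddiv_zero gg, of "-1"] by (simp add: w_def[abs_def])
  have uH0: "u \<in> H0graddiv \<Omega>" by (rule H0_rep_imp_H0graddiv[OF \<Omega> r])
  have uH: "u \<in> Hgraddiv \<Omega>" and wH: "w \<in> Hgraddiv \<Omega>"
    using H(1) gw wL ww by (auto simp: Hgraddiv_def)
  let ?U = "(u, w, tr_graddiv \<T> u, tr_graddiv \<T> w)"
  have UT: "?U \<in> trial_space \<Omega> \<T>"
    using H(1) wL uH0 wH by (auto simp: trial_space_def skel_space0_def skel_space_def)
  have sol: "bform \<T> ?U V = load \<Omega> f V" if "V \<in> test_space \<T>" for V
    by (rule exact_solution[OF m \<Omega> f H(1) gw wL ww that])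
  have uniq: "trial_eq \<Omega> U' ?U" if "U' \<in> trial_space \<Omega> \<T>" "\<forall>V\<in>test_space \<T>. bform \<T> U' V = load \<Omega> f V" for U'
    by (rule solution_unique[OF m assms(2,4) f UT ballI[OF sol] that])
  have norm: "trial_norm \<Omega> \<T> ?U \<le> 3 * L2_norm \<Omega> f"
  proof -
    define F where "F = L2_norm \<Omega> f"
    have F0: "F \<ge> 0" by (simp add: F_def)
    have nw: "L2_norm \<Omega> (\<lambda>x. - w x) = L2_norm \<Omega> w" by (simp add: L2_norm_def)
    have "(L2_norm \<Omega> u)\<^sup>2 + (L2_norm \<Omega> w)\<^sup>2 = L2_inner \<Omega> f u"
      using en by (simp add: L2_norm_sq w_def L2_inner_def)
    also have "\<dots> \<le> F * L2_norm \<Omega> u" using L2_Cauchy_Schwarz[OF f H(1)] by (simp add: F_def)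
    finally have e1: "(L2_norm \<Omega> u)\<^sup>2 + (L2_norm \<Omega> w)\<^sup>2 \<le> F * L2_norm \<Omega> u" .
    have uF: "L2_norm \<Omega> u \<le> F"
    \<comment> \<open>Arguing by contradiction avoids dividing by a norm that may be zero.\<close>
    proof (rule ccontr)
      assume "\<not> L2_norm \<Omega> u \<le> F"
      then have "F * L2_norm \<Omega> u < L2_norm \<Omega> u * L2_norm \<Omega> u"
        using F0 by (intro mult_strict_right_mono) auto
      moreover have "(L2_norm \<Omega> u)\<^sup>2 \<le> F * L2_norm \<Omega> u"
        using e1 zero_le_power2[of "L2_norm \<Omega> w"] by linarith
      ultimately show False by (simp add: power2_eq_square)
    qed
    have "F * L2_norm \<Omega> u \<le> F * F" using uF F0 by (rule mult_left_mono)
    then have e2: "(L2_norm \<Omega> u)\<^sup>2 + (L2_norm \<Omega> w)\<^sup>2 \<le> F\<^sup>2" using e1 by (simp add: power2_eq_square)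
    have "L2_norm \<Omega> (\<lambda>x. u x - f x) \<le> 2 * F"
      using L2_norm_triangle_diff[OF H(1) f] uF by (simp add: F_def)
    then have e3: "(L2_norm \<Omega> (\<lambda>x. u x - f x))\<^sup>2 \<le> 4 * F\<^sup>2"
      using power_mono[of "L2_norm \<Omega> (\<lambda>x. u x - f x)" "2 * F" 2] by (simp add: power_mult_distrib)
    have s1: "(skel_norm \<Omega> \<T> (tr_graddiv \<T> u))\<^sup>2 \<le> F\<^sup>2"
      using power_mono[OF skel_norm_le(2,1)[OF uH, of \<T>], of 2] graddiv_norm_eq[OF \<Omega> gw] e2 by (simp add: nw)
    have s2: "(skel_norm \<Omega> \<T> (tr_graddiv \<T> w))\<^sup>2 \<le> (L2_norm \<Omega> w)\<^sup>2 + 4 * F\<^sup>2"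
      using power_mono[OF skel_norm_le(2,1)[OF wH, of \<T>], of 2] graddiv_norm_eq[OF \<Omega> ww] e3 by simp
    \<comment> \<open>The fields contribute at most \<open>F\<^sup>2\<close>, the trace of
      \<open>u\<close> another \<open>F\<^sup>2\<close>, and the trace of \<open>w\<close> at most
      \<open>F\<^sup>2 + 4 * F\<^sup>2\<close>; the total \<open>7 * F\<^sup>2\<close> is rounded up
      to a square.\<close>
    have "(3 * F)\<^sup>2 = 9 * F\<^sup>2" by (simp add: power_mult_distrib)
    then have "(L2_norm \<Omega> u)\<^sup>2 + (L2_norm \<Omega> w)\<^sup>2 + (skel_norm \<Omega> \<T> (tr_graddiv \<T> u))\<^sup>2
        + (skel_norm \<Omega> \<T> (tr_graddiv \<T> w))\<^sup>2 \<le> (3 * F)\<^sup>2"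
      using e2 s1 s2 zero_le_power2[of "L2_norm \<Omega> u"] zero_le_power2[of F] by linarith
    then have "trial_norm \<Omega> \<T> ?U \<le> sqrt ((3 * F)\<^sup>2)"
      unfolding trial_norm_def split by (rule real_sqrt_le_mono)
    also have "sqrt ((3 * F)\<^sup>2) = 3 * F" unfolding real_sqrt_abs using F0 by simp
    finally show ?thesis by (simp only: F_def)
  qed
  have bvp: "solves_bvp \<Omega> f u"
    unfolding solves_bvp_def
  proof (intro conjI ballI uH)
    fix \<phi> :: "'a \<Rightarrow> 'a" assume t: "\<phi> \<in> test_functions \<Omega>"
    note t' = grad_test[OF divg_test[OF t]]
    \<comment> \<open>The fourth-order operator is split in two: the equation for \<open>u\<close>
      is tested with \<open>grad (divg \<phi>)\<close>, the one for \<open>g\<close> with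
      \<open>\<phi>\<close>.\<close>
    show "L2_inner \<Omega> u (grad (divg (grad (divg \<phi>)))) + L2_inner \<Omega> u \<phi> = L2_inner \<Omega> f \<phi>"
      using weak_graddivD(2)[OF H(6) t'] weak_graddivD(2)[OF gg t]
        L2_inner_diff_left[OF f H(1) test_in_L2[OF t open_lebesgue[OF \<Omega>]]] by simp
  next
    show "vanishing_traces \<Omega> u" using uH0 by (simp add: H0graddiv_def)
  qed
  show "\<exists>U\<in>trial_space \<Omega> \<T>.
      (\<forall>V\<in>test_space \<T>. bform \<T> U V = load \<Omega> f V) \<and>
      (\<forall>U'\<in>trial_space \<Omega> \<T>.
         (\<forall>V\<in>test_space \<T>. bform \<T> U' V = load \<Omega> f V) \<longrightarrow> trial_eq \<Omega> U' U) \<and>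
      trial_norm \<Omega> \<T> U \<le> 3 * L2_norm \<Omega> f \<and>
      solves_bvp \<Omega> f (fst U)"
    by (rule bexI[OF _ UT]) (use sol uniq norm bvp in auto)
qed simp

end
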